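(* Let $X$ be a locally connected, compact metric space. Then the following are equivalent. (i) $C(X)$ is algebraically closed. (ii) For all closed $Y\subseteq X$, all admissible $p\in C(Y)[t]$, and all $T\in \mathrm{End}(C(Y))$, $T$ extends to $C(Y)_{p}$ via $\pi_{Y}^{*}$. (iii) For all closed $Y\subseteq X$, all admissible $p\in C(Y)[t]$, and all $T\in \mathrm{End}(C(Y))$, $T$ extends to $C(Y_{p})$ via $\pi_{Y}^{*}$.
   Context: All algebras are commutative, unital, complex algebras; $\mathrm{End}(A)$ is the set of unital algebra endomorphisms of $A$. A compact space means a compact Hausdorff space. $C(X)$ is the algebra of continuous complex-valued functions on $X$. An algebra $A$ is algebraically closed if every non-constant monic polynomial with coefficients in $A$ has a root in $A$. Let $Y$ be a compact space and let $p\in C(Y)[t]$ be monic of degree at least $2$. For $y \in Y$ let $p^{(\widehat y)}\in\mathbb{C}[t]$ be the polynomial obtained by evaluating the coefficients of $p$ at $y$. Put $Y_p=\{(y,\lambda)\in Y\times\mathbb{C}: p^{(\widehat y)}(\lambda)=0\}$, a compact space, and let $\pi_Y:Y_p\to Y$ and $\pi_p:Y_p\to\mathbb{C}$ be the restrictions of the coordinate projections. Define $\pi_Y^*:C(Y)\to C(Y_p)$ by $\pi_Y^*(g)=g\circ\pi_Y$; this is an injective unital homomorphism. The discriminant $D_p\in C(Y)$ is $D_p(y)=\prod_{i<j}(\lambda_i-\lambda_j)^2$, where $p^{(\widehat y)}=(t-\lambda_1)\cdots(t-\lambda_n)$. The polynomial $p$ is called admissible if it is monic, of degree at least $2$, and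 the zero set $Z(D_p)$ of $D_p$ has empty interior in $Y$. $C(Y)_p$ denotes the subalgebra of $C(Y_p)$ generated by $\{\pi_p\}\cup\pi_Y^*(C(Y))$, i.e. the set of all functions $\sum_{k=0}^m (q_k\circ\pi_Y)\pi_p^k$ with $q_k\in C(Y)$ (for admissible $p$, this is isomorphic to the Arens-Hoffman extension $C(Y)[t]/pC(Y)[t]$, and $C(Y_p)$ is the Cole extension). If $B$ is $C(Y)_p$ or $C(Y_p)$, then $T\in\mathrm{End}(C(Y))$ extends to $B$ via $\pi_Y^*$ if there is $T'\in\mathrm{End}(B)$ with $T'\pi_Y^*=\pi_Y^*T$. *)

theory Defs
  imports "HOL-Analysis.Analysis" "HOL-Algebra.Algebra"
    "HOL-Computational_Algebra.Fundamental_Theorem_Algebra"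
begin

section \<open>Complex algebras\<close>

text \<open>A commutative unital complex algebra is a record \<open>A\<close> with
  \<open>algebra complex_field A\<close>, where \<open>algebra\<close> is the locale of \<open>HOL-Algebra.Module\<close>.\<close>

definition complex_field :: "complex ring" where
  "complex_field = \<lparr>carrier = UNIV, mult = (*), one = 1, ring.zero = 0, add = (+)\<rparr>"

definition alg_hom ::
  "(complex, 'a, 'm) module_scheme \<Rightarrow> (complex, 'b, 'n) module_scheme \<Rightarrow> ('a \<Rightarrow> 'b) set" where
  "alg_hom A B = {h \<in> ring_hom A B. \<forall>c. \<forall>x \<in> carrier A. h (c \<odot>\<^bsub>A\<^esub> x) = c \<odot>\<^bsub>B\<^esub> h x}"

definition alg_End :: "(complex, 'a, 'm) module_scheme \<Rightarrow> ('a \<Rightarrow> 'a) set" where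
  "alg_End A = alg_hom A A"

definition unital_subalgebra :: "(complex, 'a, 'm) module_scheme \<Rightarrow> 'a set \<Rightarrow> bool" where
  "unital_subalgebra A S \<longleftrightarrow> subring S A \<and> (\<forall>c. \<forall>x \<in> S. c \<odot>\<^bsub>A\<^esub> x \<in> S)"

definition generated_subalgebra ::
  "(complex, 'a, 'm) module_scheme \<Rightarrow> 'a set \<Rightarrow> (complex, 'a, 'm) module_scheme" where
  "generated_subalgebra A G = A\<lparr>carrier := unital_subalgebra A hull G\<rparr>"

text \<open>Polynomials over \<open>A\<close> are coefficient lists, leading coefficient first.\<close>

definition monic_poly :: "('a, 'm) ring_scheme \<Rightarrow> 'a list \<Rightarrow> bool" where
  "monic_poly A p \<longleftrightarrow> p \<in> carrier (poly_ring A) \<and> p \<noteq> [] \<and> lead_coeff p = \<one>\<^bsub>A\<^esub>"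

definition alg_closed :: "('a, 'm) ring_scheme \<Rightarrow> bool" where
  "alg_closed A \<longleftrightarrow> (\<forall>p. monic_poly A p \<and> Polynomials.degree p \<ge> 1 \<longrightarrow>
     (\<exists>a \<in> carrier A. ring.eval A p a = \<zero>\<^bsub>A\<^esub>))"


section \<open>Algebras of continuous functions\<close>

text \<open>Elements of $C(Y)$ are represented by functions that are \<open>undefined\<close> outside \<open>Y\<close>,
  so that equality in the algebra is equality on \<open>Y\<close>.\<close>

definition cont_alg :: "'a::topological_space set \<Rightarrow> (complex, 'a \<Rightarrow> complex) module" where
  "cont_alg Y = \<lparr>carrier = {f \<in> extensional Y. continuous_on Y f},
     mult = (\<lambda>f g. \<lambda>y\<in>Y. f y * g y), one = (\<lambda>y\<in>Y. 1),
     ring.zero = (\<lambda>y\<in>Y. 0), add = (\<lambda>f g. \<lambda>y\<in>Y. f y + g y),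
     smult = (\<lambda>c f. \<lambda>y\<in>Y. c * f y)\<rparr>"

definition poly_at :: "('a \<Rightarrow> complex) list \<Rightarrow> 'a \<Rightarrow> complex poly" where
  "poly_at p y = Poly (rev (map (\<lambda>f. f y) p))"

definition root_disc :: "complex list \<Rightarrow> complex" where
  "root_disc ls = (\<Prod>j<length ls. \<Prod>i<j. (ls ! i - ls ! j)\<^sup>2)"

text \<open>The value does not depend on the chosen enumeration of the roots; see
  \<open>discriminant_eq\<close> below.\<close>

definition discriminant :: "('a \<Rightarrow> complex) list \<Rightarrow> 'a \<Rightarrow> complex" where
  "discriminant p y = root_disc (SOME ls. poly_at p y = (\<Prod>l\<leftarrow>ls. [:- l, 1:]))"

definition admissible :: "'a::topological_space set \<Rightarrow> ('a \<Rightarrow> complex) list \<Rightarrow> bool" where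
  "admissible Y p \<longleftrightarrow> monic_poly (cont_alg Y) p \<and> Polynomials.degree p \<ge> 2 \<and>
     top_of_set Y interior_of {y \<in> Y. discriminant p y = 0} = {}"

definition root_space :: "'a set \<Rightarrow> ('a \<Rightarrow> complex) list \<Rightarrow> ('a \<times> complex) set" where
  "root_space Y p = {(y, l). y \<in> Y \<and> poly (poly_at p y) l = 0}"

definition pullback ::
  "'a set \<Rightarrow> ('a \<Rightarrow> complex) list \<Rightarrow> ('a \<Rightarrow> complex) \<Rightarrow> 'a \<times> complex \<Rightarrow> complex" where
  "pullback Y p g = (\<lambda>z \<in> root_space Y p. g (fst z))"

definition cole_ext ::
  "'a::topological_space set \<Rightarrow> ('a \<Rightarrow> complex) list \<Rightarrow> (complex, 'a \<times> complex \<Rightarrow> complex) module" where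
  "cole_ext Y p = cont_alg (root_space Y p)"

definition arens_hoffman_ext ::
  "'a::topological_space set \<Rightarrow> ('a \<Rightarrow> complex) list \<Rightarrow> (complex, 'a \<times> complex \<Rightarrow> complex) module" where
  "arens_hoffman_ext Y p = generated_subalgebra (cole_ext Y p)
     (insert (\<lambda>z \<in> root_space Y p. snd z) (pullback Y p ` carrier (cont_alg Y)))"

definition extends_to ::
  "'a::topological_space set \<Rightarrow> ('a \<Rightarrow> complex) list \<Rightarrow> (('a \<Rightarrow> complex) \<Rightarrow> 'a \<Rightarrow> complex) \<Rightarrow>
    (complex, 'a \<times> complex \<Rightarrow> complex) module \<Rightarrow> bool" where
  "extends_to Y p T B \<longleftrightarrow> (\<exists>T' \<in> alg_End B. \<forall>g \<in> carrier (cont_alg Y).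
     T' (pullback Y p g) = pullback Y p (T g))"


section \<open>Basic properties of the definitions\<close>

lemma cont_alg_simps [simp]:
  "carrier (cont_alg Y) = {f \<in> extensional Y. continuous_on Y f}"
  "f \<otimes>\<^bsub>cont_alg Y\<^esub> g = (\<lambda>y\<in>Y. f y * g y)"
  "\<one>\<^bsub>cont_alg Y\<^esub> = (\<lambda>y\<in>Y. 1)"
  "\<zero>\<^bsub>cont_alg Y\<^esub> = (\<lambda>y\<in>Y. 0)"
  "f \<oplus>\<^bsub>cont_alg Y\<^esub> g = (\<lambda>y\<in>Y. f y + g y)"
  "c \<odot>\<^bsub>cont_alg Y\<^esub> f = (\<lambda>y\<in>Y. c * f y)"
  by (simp_all add: cont_alg_def)

lemma continuous_on_restrict [simp]: "continuous_on Y (restrict f Y) = continuous_on Y f"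
  by (rule continuous_on_cong) auto

lemma cring_complex_field: "cring complex_field"
proof (rule cringI)
  show "abelian_group complex_field"
    by (rule abelian_groupI) (auto simp: complex_field_def intro: exI[of _ "- _"] add.left_inverse)
  show "comm_monoid complex_field"
    by (rule comm_monoidI) (auto simp: complex_field_def)
qed (auto simp: complex_field_def algebra_simps)

lemma cring_cont_alg: "cring (cont_alg Y)"
proof (rule cringI)
  show "abelian_group (cont_alg Y)"
  proof (rule abelian_groupI)
    fix f assume f: "f \<in> carrier (cont_alg Y)"
    then have "(\<lambda>y\<in>Y. - f y) \<in> carrier (cont_alg Y)"
      by (auto intro: continuous_intros)
    moreover have "(\<lambda>y\<in>Y. - f y) \<oplus>\<^bsub>cont_alg Y\<^esub> f = \<zero>\<^bsub>cont_alg Y\<^esub>"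
      by (auto simp: fun_eq_iff)
    ultimately show "\<exists>g\<in>carrier (cont_alg Y). g \<oplus>\<^bsub>cont_alg Y\<^esub> f = \<zero>\<^bsub>cont_alg Y\<^esub>"
      by blast
  qed (auto intro: continuous_intros simp: fun_eq_iff extensional_def)
  show "comm_monoid (cont_alg Y)"
    by (rule comm_monoidI) (auto intro: continuous_intros simp: fun_eq_iff extensional_def)
qed (auto simp: fun_eq_iff algebra_simps)

lemma algebra_cont_alg: "algebra complex_field (cont_alg Y)"
  by (rule algebraI[OF cring_complex_field cring_cont_alg])
    (auto intro: continuous_intros simp: fun_eq_iff extensional_def complex_field_def algebra_simps)

lemma root_disc_snoc:
  "root_disc (ls @ [x]) = root_disc ls * (\<Prod>l\<in>#mset ls. (l - x)\<^sup>2)"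
proof -
  have "(\<Prod>l\<in>#mset ls. (l - x)\<^sup>2) = (\<Prod>i<length ls. (ls ! i - x)\<^sup>2)"
    by (simp add: prod_mset_prod_list prod.list_conv_set_nth atLeast0LessThan flip: mset_map)
  then show ?thesis
    by (simp add: root_disc_def nth_append)
qed

lemma root_disc_insert:
  "root_disc (ls @ x # ls') = root_disc (ls @ ls') * (\<Prod>l\<in>#mset (ls @ ls'). (l - x)\<^sup>2)"
proof (induction ls' rule: rev_induct)
  case Nil
  then show ?case by (simp add: root_disc_snoc)
next
  case (snoc y ls')
  have "root_disc (ls @ x # ls' @ [y]) = root_disc (ls @ x # ls') * (\<Prod>l\<in>#mset (ls @ x # ls'). (l - y)\<^sup>2)"
    using root_disc_snoc[of "ls @ x # ls'" y] by simp
  moreover have "root_disc (ls @ ls' @ [y]) = root_disc (ls @ ls') * (\<Prod>l\<in>#mset (ls @ ls'). (l - y)\<^sup>2)"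
    using root_disc_snoc[of "ls @ ls'" y] by simp
  ultimately show ?case
    using snoc.IH by (simp add: power2_commute[of x y])
qed

lemma root_disc_perm: "mset ls = mset ls' \<Longrightarrow> root_disc ls = root_disc ls'"
proof (induction ls arbitrary: ls' rule: rev_induct)
  case Nil
  then show ?case by simp
next
  case (snoc x ls)
  have "x \<in> set ls'"
    using snoc.prems by (metis in_set_conv_decomp set_mset_mset)
  then obtain as bs where ls': "ls' = as @ x # bs"
    by (meson split_list)
  then have eq: "mset ls = mset (as @ bs)"
    using snoc.prems by simp
  have "root_disc (ls @ [x]) = root_disc ls * (\<Prod>l\<in>#mset ls. (l - x)\<^sup>2)"
    by (rule root_disc_snoc)
  also have "\<dots> = root_disc (as @ bs) * (\<Prod>l\<in>#mset (as @ bs). (l - x)\<^sup>2)"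
    by (simp only: snoc.IH[OF eq] eq)
  also have "\<dots> = root_disc ls'"
    unfolding ls' by (rule root_disc_insert[symmetric])
  finally show ?case .
qed

lemma discriminant_eq:
  assumes "poly_at p y = (\<Prod>l\<leftarrow>ls. [:- l, 1:])"
  shows "discriminant p y = root_disc ls"
proof -
  have pr: "proots (\<Prod>l\<leftarrow>ls. [:- l, 1:]) = mset ls" for ls :: "complex list"
  proof (induction ls)
    case (Cons a ls)
    have "(\<Prod>l\<leftarrow>ls. [:- l, 1:]) \<noteq> 0"
      by (auto simp: prod_list_zero_iff)
    with Cons show ?case
      by (simp only: list.map prod_list.Cons) (subst proots_mult, auto)
  qed simp
  define ms where "ms = (SOME ls. poly_at p y = (\<Prod>l\<leftarrow>ls. [:- l, 1:]))"
  have "poly_at p y = (\<Prod>l\<leftarrow>ms. [:- l, 1:])"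
    unfolding ms_def by (rule someI[of _ ls]) (rule assms)
  then have "mset ms = mset ls"
    using assms pr by metis
  then show ?thesis
    unfolding discriminant_def ms_def[symmetric] by (rule root_disc_perm)
qed

lemma poly_at_factors:
  assumes "monic_poly (cont_alg Y) p" "y \<in> Y"
  shows "\<exists>ls. length ls = Polynomials.degree p \<and> poly_at p y = (\<Prod>l\<leftarrow>ls. [:- l, 1:])"
proof -
  obtain g p' where p: "p = g # p'" and g: "g = \<one>\<^bsub>cont_alg Y\<^esub>"
    using assms(1) unfolding monic_poly_def by (cases p) auto
  have len: "length (coeffs (poly_at p y)) = length p" and lc: "Polynomial.lead_coeff (poly_at p y) = 1"
  proof -
    have "coeffs (poly_at p y) = rev (map (\<lambda>f. f y) p)"
      unfolding poly_at_def by (simp add: p g assms(2))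
    then show "length (coeffs (poly_at p y)) = length p" by simp
    have "poly_at p y \<noteq> 0"
      using \<open>coeffs (poly_at p y) = _\<close> by (auto simp: p)
    then show "Polynomial.lead_coeff (poly_at p y) = 1"
      using \<open>coeffs (poly_at p y) = _\<close> last_coeffs_eq_coeff_degree[of "poly_at p y"]
      by (simp add: p g assms(2))
  qed
  have nz: "poly_at p y \<noteq> 0"
    using lc by auto
  obtain A where A: "size A = Polynomial.degree (poly_at p y)"
      "poly_at p y = Polynomial.smult (Polynomial.lead_coeff (poly_at p y)) (\<Prod>x\<in>#A. [:-x, 1:])"
    using alg_closed_imp_factorization[OF nz] by (elim exE conjE)
  obtain ls where ls: "A = mset ls"
    by (metis ex_mset)
  have "poly_at p y = (\<Prod>x\<in>#A. [:-x, 1:])"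
    using A(2) unfolding lc smult_1_left .
  also have "\<dots> = (\<Prod>l\<leftarrow>ls. [:- l, 1:])"
    by (simp add: ls prod_mset_prod_list flip: mset_map)
  finally have "poly_at p y = (\<Prod>l\<leftarrow>ls. [:- l, 1:])" .
  moreover have "length ls = Polynomials.degree p"
    using A(1) len length_coeffs_degree[OF nz] unfolding ls by simp
  ultimately show ?thesis by blast
qed

lemma poly_root_space_mult:
  fixes q r :: "nat \<Rightarrow> 'a::topological_space \<Rightarrow> complex"
  assumes "\<forall>k\<le>m. q k \<in> carrier (cont_alg Y)" "\<forall>k\<le>n. r k \<in> carrier (cont_alg Y)"
  shows "\<exists>m' q'. (\<forall>k\<le>m'. q' k \<in> carrier (cont_alg Y)) \<and> (\<forall>y\<in>Y. \<forall>w.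
    (\<Sum>k\<le>m. q k y * w ^ k) * (\<Sum>k\<le>n. r k y * w ^ k) = (\<Sum>k\<le>m'. q' k y * w ^ k))"
proof -
  define a where "a k y = (if k \<le> m then q k y else 0)" for k y
  define b where "b k y = (if k \<le> n then r k y else 0)" for k y
  have ca: "continuous_on Y (a k)" for k
    using assms(1) by (cases "k \<le> m") (auto simp: a_def[abs_def])
  have cb: "continuous_on Y (b k)" for k
    using assms(2) by (cases "k \<le> n") (auto simp: b_def[abs_def])
  have "(\<Sum>k\<le>m. q k y * w ^ k) * (\<Sum>k\<le>n. r k y * w ^ k) =
      (\<Sum>j\<le>m + n. (\<lambda>y\<in>Y. \<Sum>k\<le>j. a k y * b (j - k) y) y * w ^ j)" if "y \<in> Y" for y w
    using polynomial_product[of m "\<lambda>k. a k y" n "\<lambda>k. b k y" w] that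
    by (simp add: a_def b_def)
  moreover have "(\<lambda>y\<in>Y. \<Sum>k\<le>j. a k y * b (j - k) y) \<in> carrier (cont_alg Y)" for j
    by (auto intro!: continuous_intros ca cb)
  ultimately show ?thesis
    by (intro exI[of _ "m + n"] exI[of _ "\<lambda>j. \<lambda>y\<in>Y. \<Sum>k\<le>j. a k y * b (j - k) y"]) blast
qed

lemma poly_root_space_add:
  fixes q r :: "nat \<Rightarrow> 'a::topological_space \<Rightarrow> complex"
  assumes "\<forall>k\<le>m. q k \<in> carrier (cont_alg Y)" "\<forall>k\<le>n. r k \<in> carrier (cont_alg Y)"
  shows "\<exists>m' q'. (\<forall>k\<le>m'. q' k \<in> carrier (cont_alg Y)) \<and> (\<forall>y\<in>Y. \<forall>w.
    (\<Sum>k\<le>m. q k y * w ^ k) + (\<Sum>k\<le>n. r k y * w ^ k) = (\<Sum>k\<le>m'. q' k y * w ^ k))"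
proof -
  define a where "a k y = (if k \<le> m then q k y else 0)" for k y
  define b where "b k y = (if k \<le> n then r k y else 0)" for k y
  have ca: "continuous_on Y (a k)" for k
    using assms(1) by (cases "k \<le> m") (auto simp: a_def[abs_def])
  have cb: "continuous_on Y (b k)" for k
    using assms(2) by (cases "k \<le> n") (auto simp: b_def[abs_def])
  have "(\<Sum>k\<le>m. q k y * w ^ k) = (\<Sum>k\<le>m + n. a k y * w ^ k)" for y w
    by (rule sum.mono_neutral_cong_left) (auto simp: a_def)
  moreover have "(\<Sum>k\<le>n. r k y * w ^ k) = (\<Sum>k\<le>m + n. b k y * w ^ k)" for y w
    by (rule sum.mono_neutral_cong_left) (auto simp: b_def)
  ultimately have "(\<Sum>k\<le>m. q k y * w ^ k) + (\<Sum>k\<le>n. r k y * w ^ k) =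
      (\<Sum>k\<le>m + n. (\<lambda>y\<in>Y. a k y + b k y) y * w ^ k)" if "y \<in> Y" for y w
    using that by (simp add: sum.distrib distrib_right)
  moreover have "(\<lambda>y\<in>Y. a k y + b k y) \<in> carrier (cont_alg Y)" for k
    by (auto intro!: continuous_intros ca cb)
  ultimately show ?thesis
    by (intro exI[of _ "m + n"] exI[of _ "\<lambda>k. \<lambda>y\<in>Y. a k y + b k y"]) blast
qed

lemma continuous_on_pullback:
  assumes "g \<in> carrier (cont_alg Y)"
  shows "continuous_on (root_space Y p) (\<lambda>z. g (fst z))"
proof (rule continuous_on_compose2[of Y g])
  show "continuous_on Y g" using assms by simp
qed (auto simp: root_space_def intro: continuous_intros)

lemma carrier_arens_hoffman_ext:
  fixes Y :: "'a::topological_space set"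
  shows "carrier (arens_hoffman_ext Y p) =
    {(\<lambda>z \<in> root_space Y p. \<Sum>k\<le>m. q k (fst z) * snd z ^ k) | m q.
       \<forall>k\<le>(m::nat). q k \<in> carrier (cont_alg Y)}" (is "_ = ?E")
proof -
  let ?R = "root_space Y p" and ?A = "cont_alg (root_space Y p)"
  let ?f = "\<lambda>m q. \<lambda>z \<in> root_space Y p. \<Sum>k\<le>(m::nat). q k (fst z) * snd z ^ k"
  interpret A: cring ?A by (rule cring_cont_alg)
  have inY: "fst z \<in> Y" if "z \<in> ?R" for z
    using that by (auto simp: root_space_def)
  have inY': "y \<in> Y" if "(y, w) \<in> ?R" for y w
    using inY[OF that] by simp
  have constE: "(\<lambda>z\<in>?R. c) \<in> ?E" for c
    by (rule CollectI, rule exI[of _ 0], rule exI[of _ "\<lambda>k. \<lambda>y\<in>Y. c"]) (auto simp: inY' fun_eq_iff)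
  have multE: "f \<otimes>\<^bsub>?A\<^esub> g \<in> ?E" if "f \<in> ?E" "g \<in> ?E" for f g
  proof -
    obtain m q n r where q: "f = ?f m q" "\<forall>k\<le>m. q k \<in> carrier (cont_alg Y)"
      and r: "g = ?f n r" "\<forall>k\<le>n. r k \<in> carrier (cont_alg Y)"
      using \<open>f \<in> ?E\<close> \<open>g \<in> ?E\<close> by blast
    obtain m' q' where q': "\<forall>k\<le>m'. q' k \<in> carrier (cont_alg Y)" and eq: "\<forall>y\<in>Y. \<forall>w.
      (\<Sum>k\<le>m. q k y * w ^ k) * (\<Sum>k\<le>n. r k y * w ^ k) = (\<Sum>k\<le>m'. q' k y * w ^ k)"
      using poly_root_space_mult[OF q(2) r(2)] by blast
    have "f \<otimes>\<^bsub>?A\<^esub> g = ?f m' q'"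
      using eq by (auto simp: q r inY' fun_eq_iff)
    with q' show ?thesis by blast
  qed
  have addE: "f \<oplus>\<^bsub>?A\<^esub> g \<in> ?E" if "f \<in> ?E" "g \<in> ?E" for f g
  proof -
    obtain m q n r where q: "f = ?f m q" "\<forall>k\<le>m. q k \<in> carrier (cont_alg Y)"
      and r: "g = ?f n r" "\<forall>k\<le>n. r k \<in> carrier (cont_alg Y)"
      using \<open>f \<in> ?E\<close> \<open>g \<in> ?E\<close> by blast
    obtain m' q' where q': "\<forall>k\<le>m'. q' k \<in> carrier (cont_alg Y)" and eq: "\<forall>y\<in>Y. \<forall>w.
      (\<Sum>k\<le>m. q k y * w ^ k) + (\<Sum>k\<le>n. r k y * w ^ k) = (\<Sum>k\<le>m'. q' k y * w ^ k)"
      using poly_root_space_add[OF q(2) r(2)] by blast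
    have "f \<oplus>\<^bsub>?A\<^esub> g = ?f m' q'"
      using eq by (auto simp: q r inY' fun_eq_iff)
    with q' show ?thesis by blast
  qed
  have smultE: "c \<odot>\<^bsub>?A\<^esub> f \<in> ?E" if "f \<in> ?E" for c f
  proof -
    have "c \<odot>\<^bsub>?A\<^esub> f = (\<lambda>z\<in>?R. c) \<otimes>\<^bsub>?A\<^esub> f"
      by (auto simp: fun_eq_iff)
    then show ?thesis using multE[OF constE that] by simp
  qed
  have carrE: "?E \<subseteq> carrier ?A"
    by (auto intro!: continuous_intros continuous_on_pullback simp del: cont_alg_simps(1))
      (auto intro!: continuous_intros continuous_on_pullback)
  have uminus: "\<ominus>\<^bsub>?A\<^esub> f = (-1) \<odot>\<^bsub>?A\<^esub> f" if "f \<in> carrier ?A" for f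
    by (rule A.minus_equality) (use that in \<open>auto simp: fun_eq_iff intro: continuous_intros\<close>)
  have "unital_subalgebra ?A hull
      (insert (\<lambda>z \<in> ?R. snd z) (pullback Y p ` carrier (cont_alg Y))) = ?E"
  proof (rule hull_unique)
    show "insert (\<lambda>z \<in> ?R. snd z) (pullback Y p ` carrier (cont_alg Y)) \<subseteq> ?E"
    proof (intro insert_subsetI subsetI)
      show "(\<lambda>z \<in> ?R. snd z) \<in> ?E"
        by (rule CollectI, rule exI[of _ 1], rule exI[of _ "\<lambda>k. \<lambda>y\<in>Y. of_nat k"])
          (auto simp: inY' fun_eq_iff)
      fix f assume "f \<in> pullback Y p ` carrier (cont_alg Y)"
      then obtain g where "g \<in> carrier (cont_alg Y)" "f = pullback Y p g" by blast
      then show "f \<in> ?E"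
        by (intro CollectI exI[of _ 0] exI[of _ "\<lambda>k. g"]) (auto simp: pullback_def fun_eq_iff)
    qed
    show "unital_subalgebra ?A ?E"
      unfolding unital_subalgebra_def
    proof (intro conjI A.subringI carrE allI ballI)
      show "\<one>\<^bsub>?A\<^esub> \<in> ?E" using constE[of 1] by simp
      show "\<ominus>\<^bsub>?A\<^esub> f \<in> ?E" if "f \<in> ?E" for f
        using uminus[of f] smultE[OF that, of "-1"] carrE that by (metis (no_types, lifting) subsetD)
    qed (fact multE addE smultE)+
  next
    fix S assume gens: "insert (\<lambda>z \<in> ?R. snd z) (pullback Y p ` carrier (cont_alg Y)) \<subseteq> S"
      and S: "unital_subalgebra ?A S"
    have S_mult: "(\<lambda>z\<in>?R. f z * g z) \<in> S" and S_add: "(\<lambda>z\<in>?R. f z + g z) \<in> S"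
      if "f \<in> S" "g \<in> S" for f g
      using S that subringE(6,7)[of S ?A f g] by (auto simp: unital_subalgebra_def)
    have S_one: "(\<lambda>z\<in>?R. 1) \<in> S"
      using S subringE(3)[of S ?A] by (auto simp: unital_subalgebra_def)
    have pow: "(\<lambda>z\<in>?R. snd z ^ k) \<in> S" for k
    proof (induction k)
      case (Suc k)
      have "(\<lambda>z\<in>?R. snd z ^ Suc k) = (\<lambda>z\<in>?R. (\<lambda>z\<in>?R. snd z) z * (\<lambda>z\<in>?R. snd z ^ k) z)"
        by (auto simp: fun_eq_iff)
      moreover have "(\<lambda>z\<in>?R. snd z) \<in> S" using gens by blast
      ultimately show ?case using S_mult[OF _ Suc] by presburger
    qed (use S_one in \<open>simp only: power_0\<close>)
    have monomS: "(\<lambda>z\<in>?R. g (fst z) * snd z ^ k) \<in> S" if "g \<in> carrier (cont_alg Y)" for g k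
    proof -
      have "(\<lambda>z\<in>?R. g (fst z) * snd z ^ k) = (\<lambda>z\<in>?R. pullback Y p g z * (\<lambda>z\<in>?R. snd z ^ k) z)"
        by (auto simp: fun_eq_iff pullback_def)
      moreover have "pullback Y p g \<in> S" using gens that by blast
      ultimately show ?thesis using S_mult[OF _ pow] by presburger
    qed
    have "?f m q \<in> S" if "\<forall>k\<le>m. q k \<in> carrier (cont_alg Y)" for m q
      using that
    proof (induction m)
      case 0
      have "?f 0 q = (\<lambda>z\<in>?R. q 0 (fst z) * snd z ^ 0)"
        by (auto simp: fun_eq_iff)
      moreover have "(\<lambda>z\<in>?R. q 0 (fst z) * snd z ^ 0) \<in> S"
        using 0 by (intro monomS) blast
      ultimately show ?case by presburger
    next
      case (Suc m)
      have "?f (Suc m) q = (\<lambda>z\<in>?R. ?f m q z + (\<lambda>z\<in>?R. q (Suc m) (fst z) * snd z ^ Suc m) z)"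
        by (auto simp: fun_eq_iff)
      moreover have "?f m q \<in> S" by (rule Suc.IH) (use Suc.prems le_SucI in blast)
      moreover have "(\<lambda>z\<in>?R. q (Suc m) (fst z) * snd z ^ Suc m) \<in> S"
        using Suc.prems by (intro monomS) blast
      ultimately show ?case using S_add by presburger
    qed
    then show "?E \<subseteq> S" by blast
  qed
  then show ?thesis
    by (simp add: arens_hoffman_ext_def generated_subalgebra_def cole_ext_def)
qed

end

theory Submission
  imports Defs "HOL-Complex_Analysis.Great_Picard"
begin

text \<open>Endomorphisms of \<open>C(Y)\<close> are compositions with continuous maps \<open>\<phi>\<close>, and \<open>T\<close> extends as soon as
  the polynomial \<open>p \<circ> \<phi>\<close> has a root in \<open>C(Y)\<close>; by Tietze's theorem such a root exists if \<open>C(M)\<close> is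
  algebraically closed. Conversely, an extension of \<open>T\<close> yields a continuous root of \<open>p \<circ> \<phi>\<close> on the
  root space \<open>Y\<^sub>p\<close>.

  If \<open>M\<close> contains a simple closed curve \<open>Y\<close>, identify it with the unit circle and take
  \<open>p = (t\<^sup>2 - z) * (t\<^sup>3 - z)\<close> and \<open>\<phi> z = - z\<close>. The root space consists of a double and a triple cover
  of the circle which meet in the single point \<open>(1, 1)\<close>. A root of \<open>(t\<^sup>2 + z) * (t\<^sup>3 + z)\<close> on it would
  be a continuous choice along both covers, starting with the same value at \<open>(1, 1)\<close> and
  returning to it after two and after three turns. A choice can switch between square roots and
  cube roots only where these collide, which does not allow both.

  If \<open>M\<close> contains no simple closed curve, any two points in a component are joined by a unique
  arc, and a maximality argument extends a root at a base point along all arcs. Such a root is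
  continuous on \<open>M\<close>: nearby points are joined by a small arc, and the values along it form a
  connected set close to the finite set of roots at one point, hence a set of small diameter.
  So \<open>C(M)\<close> is algebraically closed.\<close>

section \<open>Paths in locally connected compact metric spaces\<close>

text \<open>Why two covers and a rotation: on the single cover \<open>w ^ n = z\<close> the
  polynomial \<open>t ^ n + z\<close> has a continuous root, \<open>\<i> * w\<close> for n = 2 and
  \<open>- w\<close> for n = 3. Only a point shared by both covers can obstruct, and at (1, 1) these
  two choices disagree. With the identity in place of the rotation the coordinate w itself would be
  a root; the rotation moves the fibre where the required roots collide to z = -1, away from the
  point z = 1 where the covers meet.

  Collisions also shape the positive direction. The roots do not form a covering, so a lift along an
  arc exists (by Arzela-Ascoli) but is not unique, and arcs with a common beginning need compatible
  lifts; Zorn's lemma fixes them all at once. In place of unique lifting one estimate recurs: a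
  connected set whose points are all closer than e to a set of at most n points has diameter at most
  \<open>3 * n * e\<close>.

  Nearby points must be joined by small arcs, while the hypothesis only gives small connected sets.
  Compactness, through completeness, turns chains of such sets into paths.\<close>

definition small_link :: "'a::metric_space set \<Rightarrow> real \<Rightarrow> 'a \<Rightarrow> 'a \<Rightarrow> bool" where
  "small_link M e a b \<longleftrightarrow>
    (\<exists>V. openin (top_of_set M) V \<and> connected V \<and> a \<in> V \<and> b \<in> V \<and> (\<forall>u\<in>V. \<forall>v\<in>V. dist u v \<le> e))"

lemma small_link_in: "small_link M e a b \<Longrightarrow> a \<in> M \<and> b \<in> M \<and> dist a b \<le> e"
  unfolding small_link_def by (meson openin_imp_subset subsetD)

lemma small_connected_neighbourhood:
  fixes M :: "'a::metric_space set"
  assumes "locally connected M" "x \<in> M" "e > 0"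
  obtains V where "openin (top_of_set M) V" "connected V" "x \<in> V" "V \<subseteq> ball x e"
proof -
  have "openin (top_of_set M) (M \<inter> ball x e)" "x \<in> M \<inter> ball x e"
    using assms by auto
  then obtain V where "openin (top_of_set M) V" "connected V" "x \<in> V" "V \<subseteq> M \<inter> ball x e"
    using assms(1) unfolding locally_connected by metis
  then show thesis using that by blast
qed

lemma small_link_neighbourhood:
  assumes "locally connected M" "x \<in> M" "e > 0"
  obtains V where "openin (top_of_set M) V" "connected V" "x \<in> V" "V \<subseteq> ball x e"
    "\<And>u v. u \<in> V \<Longrightarrow> v \<in> V \<Longrightarrow> small_link M e u v"
proof -
  obtain V where V: "openin (top_of_set M) V" "connected V" "x \<in> V" "V \<subseteq> ball x (e/2)"
    using small_connected_neighbourhood[OF assms(1,2), of "e/2"] assms(3) by auto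
  have "dist u v \<le> e" if "u \<in> V" "v \<in> V" for u v
  proof -
    have "u \<in> ball x (e/2)" "v \<in> ball x (e/2)" using V(4) that by auto
    then show ?thesis
      using dist_triangle2[of u v x] by (simp add: dist_commute)
  qed
  then have "small_link M e u v" if "u \<in> V" "v \<in> V" for u v
    unfolding small_link_def using V that by blast
  moreover have "V \<subseteq> ball x e" using V(4) assms(3) subset_ball[of "e/2" e x] by auto
  ultimately show thesis using that V by blast
qed

text \<open>The points that \<open>e'\<close>-links reach from \<open>a\<close> without leaving the
  connected witness \<open>V\<close> form a clopen subset of \<open>V\<close>, hence all of it;
  staying in \<open>V\<close> keeps them within \<open>e\<close> of \<open>a\<close>. The chain is
  stationary from \<open>K\<close> on, so that it can be padded to any greater length.\<close>

lemma small_link_refine: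
  assumes "locally connected M" "small_link M e a b" "e' > 0"
  shows "\<exists>c K. c 0 = a \<and> (\<forall>i\<ge>K. c i = b) \<and> (\<forall>i. dist a (c i) \<le> e) \<and>
    (\<forall>i. small_link M e' (c i) (c (Suc i)))"
proof -
  obtain V where V: "openin (top_of_set M) V" "connected V" "a \<in> V" "b \<in> V"
    and dV: "\<And>u v. u \<in> V \<Longrightarrow> v \<in> V \<Longrightarrow> dist u v \<le> e"
    using assms(2) unfolding small_link_def by blast
  have VM: "V \<subseteq> M" using V(1) openin_imp_subset by blast
  define Q where "Q u v \<longleftrightarrow> u \<in> V \<and> v \<in> V \<and> small_link M e' u v" for u v
  define W where "W = {v \<in> V. Q\<^sup>*\<^sup>* a v}"
  have nb: "\<exists>U. openin (top_of_set V) U \<and> v \<in> U \<and> (\<forall>w\<in>U. Q v w \<and> Q w v)" if v: "v \<in> V" for v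
  proof -
    obtain U where U: "openin (top_of_set M) U" "v \<in> U"
      "\<And>u w. u \<in> U \<Longrightarrow> w \<in> U \<Longrightarrow> small_link M e' u w"
      using small_link_neighbourhood[OF assms(1) subsetD[OF VM v] assms(3)] by metis
    have "openin (top_of_set V) (V \<inter> U)"
      using openin_subset_trans[OF openin_Int[OF V(1) U(1)] inf_le1 VM] .
    then show ?thesis
      using U v unfolding Q_def by (intro exI[of _ "V \<inter> U"]) auto
  qed
  have "openin (top_of_set V) W"
  proof (subst openin_subopen, intro ballI)
    fix v assume v: "v \<in> W"
    obtain U where U: "openin (top_of_set V) U" "v \<in> U" "\<forall>w\<in>U. Q v w \<and> Q w v"
      using nb[of v] v unfolding W_def by blast
    have "U \<subseteq> W"
    proof
      fix w assume "w \<in> U"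
      then have "Q v w" "w \<in> V" using U by (auto simp: Q_def)
      then show "w \<in> W" using v unfolding W_def by (auto intro: rtranclp.rtrancl_into_rtrancl)
    qed
    then show "\<exists>T. openin (top_of_set V) T \<and> v \<in> T \<and> T \<subseteq> W" using U by blast
  qed
  moreover have "openin (top_of_set V) (V - W)"
  proof (subst openin_subopen, intro ballI)
    fix v assume v: "v \<in> V - W"
    obtain U where U: "openin (top_of_set V) U" "v \<in> U" "\<forall>w\<in>U. Q v w \<and> Q w v"
      using nb[of v] v by blast
    have "U \<subseteq> V - W"
    proof
      fix w assume "w \<in> U"
      then have "Q w v" "w \<in> V" using U by (auto simp: Q_def)
      then show "w \<in> V - W" using v unfolding W_def by (auto intro: rtranclp.rtrancl_into_rtrancl)
    qed
    then show "\<exists>T. openin (top_of_set V) T \<and> v \<in> T \<and> T \<subseteq> V - W" using U by blast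
  qed
  moreover have "a \<in> W" using V by (simp add: W_def)
  ultimately have "W = V"
    using V(2) unfolding connected_clopen closedin_def by (auto simp: W_def)
  then have "Q\<^sup>*\<^sup>* a b" using V(4) unfolding W_def by blast
  then obtain K where "(Q ^^ K) a b" by (meson rtranclp_imp_relpowp)
  then obtain f where f: "f 0 = a" "f K = b" "\<forall>i<K. Q (f i) (f (Suc i))"
    unfolding relpowp_fun_conv by blast
  define c where "c i = (if i \<le> K then f i else b)" for i
  have fV: "f i \<in> V" if "i \<le> K" for i
    using that f V by (cases "i = K") (auto simp: Q_def)
  have cV: "c i \<in> V" for i using fV V by (auto simp: c_def)
  have "small_link M e' (c i) (c (Suc i))" for i
  proof (cases "i < K")
    case True
    then show ?thesis using f unfolding c_def Q_def by auto
  next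
    case False
    then have "c i = b" "c (Suc i) = b" using f by (auto simp: c_def)
    then show ?thesis
      using small_link_neighbourhood[OF assms(1) subsetD[OF VM V(4)] assms(3)] by metis
  qed
  moreover have "c 0 = a" "\<forall>i\<ge>K. c i = b" using f by (auto simp: c_def)
  ultimately show ?thesis using dV cV V(3) by blast
qed

text \<open>Every link is subdivided into the same number \<open>K\<close> of pieces, so that the point with
  parameter \<open>t \<in> [0, 1]\<close> on a chain of length \<open>N\<close> can be taken to be number \<open>\<lfloor>t * N\<rfloor>\<close>.\<close>

lemma chain_refine:
  assumes "locally connected M" "\<forall>i<N. small_link M e (c i) (c (Suc i))" "e' > 0"
  shows "\<exists>K c'. K > 0 \<and> (\<forall>m\<le>N. c' (m * K) = c m) \<and>
    (\<forall>i<N. \<forall>j<K. dist (c i) (c' (i * K + j)) \<le> e) \<and>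
    (\<forall>m<N * K. small_link M e' (c' m) (c' (Suc m)))"
proof -
  have "\<forall>i. \<exists>d K. i < N \<longrightarrow> d 0 = c i \<and> (\<forall>j\<ge>K. d j = c (Suc i)) \<and> (\<forall>j. dist (c i) (d j) \<le> e) \<and>
    (\<forall>j. small_link M e' (d j) (d (Suc j)))"
    using small_link_refine[OF assms(1) _ assms(3)] assms(2) by metis
  then obtain d K where d: "\<And>i. i < N \<Longrightarrow> d i 0 = c i" "\<And>i j. i < N \<Longrightarrow> j \<ge> K i \<Longrightarrow> d i j = c (Suc i)"
    "\<And>i j. i < N \<Longrightarrow> dist (c i) (d i j) \<le> e"
    "\<And>i j. i < N \<Longrightarrow> small_link M e' (d i j) (d i (Suc j))"
    by metis
  define L where "L = Suc (Max (insert 0 (K ` {..<N})))"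
  have KL: "K i \<le> L" if "i < N" for i
    unfolding L_def using that by (intro le_SucI Max_ge) auto
  have L0: "L > 0" by (simp add: L_def)
  define c' where "c' m = (if m div L < N then d (m div L) (m mod L) else c (m div L))" for m
  have "c' (m * L) = c m" if "m \<le> N" for m
    using that L0 d(1) by (auto simp: c'_def)
  moreover have "dist (c i) (c' (i * L + j)) \<le> e" if "i < N" "j < L" for i j
    using that L0 d(3) by (auto simp: c'_def)
  moreover have "small_link M e' (c' m) (c' (Suc m))" if "m < N * L" for m
  proof -
    define i j where "i = m div L" and "j = m mod L"
    have m: "m = i * L + j" "j < L" "i < N"
      using that L0 by (auto simp: i_def j_def less_mult_imp_div_less)
    have cm: "c' m = d i j" using m by (simp add: c'_def)
    show ?thesis
    proof (cases "Suc j < L")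
      case True
      have "Suc m = i * L + Suc j" using m by simp
      then have "Suc m div L = i" "Suc m mod L = Suc j"
        using True by (auto simp: div_nat_eqI mod_nat_eqI)
      then have "c' (Suc m) = d i (Suc j)" using m by (simp add: c'_def)
      then show ?thesis using cm d(4) m by simp
    next
      case False
      then have "Suc m = Suc i * L" "Suc j = L" using m by auto
      then have "Suc m div L = Suc i" "Suc m mod L = 0"
        using L0 by (simp_all del: mult_Suc)
      then have "c' (Suc m) = c (Suc i)"
        using d(1) m by (simp add: c'_def)
      also have "\<dots> = d i (Suc j)"
        using d(2)[OF m(3), of "Suc j"] KL[OF m(3)] \<open>Suc j = L\<close> by simp
      finally show ?thesis using cm d(4) m by simp
    qed
  qed
  ultimately show ?thesis using L0 by blast
qed


text \<open>Repeated refinement with links of size \<open>r / 2 ^ n\<close> moves the point of a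
  given parameter by at most \<open>r / 2 ^ n\<close> per stage, so the chains converge uniformly.
  The radius \<open>3 * r\<close> consists of \<open>r\<close> for the initial chain and
  \<open>2 * r\<close> for the geometric series.\<close>

lemma small_link_imp_path:
  assumes "compact M" "locally connected M" "small_link M r x y" "r > 0"
  obtains f where "path f" "path_image f \<subseteq> M \<inter> cball x (3 * r)" "pathstart f = x" "pathfinish f = y"
proof -
  define e where "e n = r / 2 ^ n" for n :: nat
  have e0: "e n > 0" for n using assms(4) by (simp add: e_def)
  have eS: "e (Suc n) = e n / 2" for n by (simp add: e_def)
  \<comment> \<open>A state holds the number of links and the chain. Stage 0 must be a single link,
    so its only points are \<open>x\<close> and \<open>y\<close>.\<close>
  define P where "P n s \<longleftrightarrow> fst s > 0 \<and> (n = 0 \<longrightarrow> fst s = 1) \<and> snd s 0 = x \<and> snd s (fst s) = y \<and>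
    (\<forall>i<fst s. small_link M (e n) (snd s i) (snd s (Suc i)))" for n and s :: "nat \<times> (nat \<Rightarrow> 'a)"
  define Q where "Q n s s' \<longleftrightarrow> (\<exists>K>0. fst s' = fst s * K \<and> (\<forall>m\<le>fst s. snd s' (m * K) = snd s m) \<and>
    (\<forall>i<fst s. \<forall>j<K. dist (snd s i) (snd s' (i * K + j)) \<le> e n))" for n and s s' :: "nat \<times> (nat \<Rightarrow> 'a)"
  have "P 0 (1, \<lambda>i. if i = 0 then x else y)"
    using assms(3) by (simp add: P_def e_def)
  moreover have "\<exists>s'. P (Suc n) s' \<and> Q n s s'" if P: "P n s" for n s
  proof -
    obtain K c' where "K > 0" "\<forall>m\<le>fst s. c' (m * K) = snd s m"
      "\<forall>i<fst s. \<forall>j<K. dist (snd s i) (c' (i * K + j)) \<le> e n"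
      "\<forall>m<fst s * K. small_link M (e (Suc n)) (c' m) (c' (Suc m))"
      using chain_refine[OF assms(2), of "fst s" "e n" "snd s" "e (Suc n)"] P e0 unfolding P_def by metis
    moreover from this(2) have "c' 0 = snd s 0" "c' (fst s * K) = snd s (fst s)"
      by (metis mult_0 le0, simp)
    ultimately show ?thesis
      using P unfolding P_def Q_def by (intro exI[of _ "(fst s * K, c')"]) auto
  qed
  ultimately obtain s where s: "\<And>n. P n (s n)" "\<And>n. Q n (s n) (s (Suc n))"
    using dependent_nat_choice[of P Q] by metis
  define N where "N n = fst (s n)" for n
  define c where "c n = snd (s n)" for n
  have N0: "N n > 0" and c0: "c n 0 = x" and cN: "c n (N n) = y" for n
    using s(1)[of n] by (auto simp: P_def N_def c_def)
  have link: "small_link M (e n) (c n i) (c n (Suc i))" if "i < N n" for n i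
    using s(1)[of n] that by (auto simp: P_def N_def c_def)
  have cM: "c n i \<in> M" if "i \<le> N n" for n i
    using small_link_in[OF link, of "i - 1" n] small_link_in[OF link, of 0 n] that N0 by (cases i) auto
  define a where "a n t = c n (nat \<lfloor>t * real (N n)\<rfloor>)" for n t
  have idx: "nat \<lfloor>t * real (N n)\<rfloor> \<le> N n" if "t \<in> {0..1}" for n t
    using that N0[of n] by (simp add: nat_le_iff floor_le_iff mult_left_le_one_le order.strict_trans1[of _ "real (N n)"])
  have idx': "nat \<lfloor>t * real (N n)\<rfloor> < N n" if "t \<in> {0..<1}" for n t
    using that N0[of n] by (simp add: nat_less_iff floor_less_iff)
  have aM: "a n t \<in> M" if "t \<in> {0..1}" for n t
    unfolding a_def using cM idx that by blast
  have a_step: "dist (a n t) (a (Suc n) t) \<le> e n" if t: "t \<in> {0..1}" for n t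
  \<comment> \<open>At \<open>t = 1\<close> the index is \<open>N n\<close>, beyond the start of the
    last link, where the refinement bound says nothing; but all chains end in
    \<open>y\<close>.\<close>
  proof (cases "t = 1")
    case True
    then show ?thesis using cN e0[of n] by (simp add: a_def)
  next
    case False
    then have t': "t \<in> {0..<1}" using t by auto
    obtain K where K: "K > 0" "N (Suc n) = N n * K"
      "\<forall>i<N n. \<forall>j<K. dist (c n i) (c (Suc n) (i * K + j)) \<le> e n"
      using s(2)[of n] unfolding Q_def N_def c_def by blast
    define m where "m = nat \<lfloor>t * real (N (Suc n))\<rfloor>"
    have "m div K = nat \<lfloor>t * real (N n)\<rfloor>"
    proof -
      have "real_of_int \<lfloor>t * real (N (Suc n))\<rfloor> = real m"
        using t by (simp add: m_def)
      have "\<lfloor>t * real (N n)\<rfloor> = \<lfloor>t * real (N (Suc n)) / real K\<rfloor>"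
        using K by simp
      also have "\<dots> = \<lfloor>t * real (N (Suc n))\<rfloor> div int K"
        using floor_divide_real_eq_div[of "int K" "t * real (N (Suc n))"] by simp
      finally show ?thesis
        using t by (simp add: m_def nat_div_distrib)
    qed
    moreover have "m = (m div K) * K + m mod K" by simp
    ultimately show ?thesis
      using K(1,3) idx'[OF t'] unfolding a_def m_def[symmetric] by (metis mod_less_divisor)
  qed
  have a_tail: "dist (a n t) (a (n + k) t) \<le> 2 * e n - 2 * e (n + k)" if t: "t \<in> {0..1}" for n k t
  proof (induction k)
    case (Suc k)
    have "dist (a n t) (a (n + Suc k) t) \<le> dist (a n t) (a (n + k) t) + dist (a (n + k) t) (a (Suc (n + k)) t)"
      using dist_triangle by auto
    also have "\<dots> \<le> 2 * e n - 2 * e (n + k) + e (n + k)"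
      using Suc a_step[OF t] by (intro add_mono) auto
    finally show ?case using eS[of "n + k"] by simp
  qed simp
  have e_lim: "e \<longlonglongrightarrow> 0"
    unfolding e_def using tendsto_mult[OF tendsto_const[of r] LIMSEQ_inverse_realpow_zero[of 2]]
    by (simp add: divide_inverse power_inverse)
  have e_small: "\<exists>n. e n < d" if "d > 0" for d
    using order_tendstoD(2)[OF e_lim that] by (meson eventually_sequentially order_refl)
  have "\<exists>l. l \<in> M \<and> (\<lambda>n. a n t) \<longlonglongrightarrow> l" if t: "t \<in> {0..1}" for t
  proof -
    have "Cauchy (\<lambda>n. a n t)"
    proof (rule CauchyI')
      fix d :: real assume "d > 0"
      then obtain n where n: "e n < d / 4" using e_small[of "d / 4"] by auto
      have "dist (a p t) (a q t) < d" if "p \<ge> n" "p < q" for p q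
      proof -
        have tail: "dist (a n t) (a m t) \<le> 2 * e n" if "m \<ge> n" for m
          using a_tail[OF t, of n "m - n"] e0[of m] that by simp
        show ?thesis
          using tail[of p] tail[of q] that n dist_triangle3[of "a p t" "a q t" "a n t"] by linarith
      qed
      then show "\<exists>M. \<forall>m\<ge>M. \<forall>n>m. dist (a m t) (a n t) < d" by blast
    qed
    then show ?thesis
      using compact_imp_complete[OF assms(1)] aM[OF t] unfolding complete_def by metis
  qed
  then obtain f where fM: "\<And>t. t \<in> {0..1} \<Longrightarrow> f t \<in> M" and f: "\<And>t. t \<in> {0..1} \<Longrightarrow> (\<lambda>n. a n t) \<longlonglongrightarrow> f t"
    by metis
  have af: "dist (a n t) (f t) \<le> 2 * e n" if t: "t \<in> {0..1}" for n t
  proof (rule tendsto_upperbound[OF tendsto_dist[OF tendsto_const f[OF t]]])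
    show "\<forall>\<^sub>F m in sequentially. dist (a n t) (a m t) \<le> 2 * e n"
    proof (rule eventually_sequentiallyI[of n])
      fix m assume "n \<le> m"
      then show "dist (a n t) (a m t) \<le> 2 * e n"
        using a_tail[OF t, of n "m - n"] e0[of m] by simp
    qed
  qed simp
  \<comment> \<open>The \<open>a n\<close> are step functions. Continuity of their limit rests on
    the fact that parameters less than \<open>1 / N n\<close> apart have equal or consecutive
    indices.\<close>
  have a_osc: "dist (a n u) (a n t) \<le> e n" if ut: "u \<in> {0..1}" "t \<in> {0..1}" "u \<le> t" "t - u < 1 / N n" for n u t
  proof -
    define i j where "i = nat \<lfloor>u * real (N n)\<rfloor>" and "j = nat \<lfloor>t * real (N n)\<rfloor>"
    have "(t - u) * N n < 1"
      using ut(4) N0[of n] by (simp add: field_simps)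
    then have "t * N n < u * N n + 1" by (simp add: algebra_simps)
    then have "\<lfloor>t * real (N n)\<rfloor> \<le> \<lfloor>u * real (N n)\<rfloor> + 1" by linarith
    moreover have "\<lfloor>u * real (N n)\<rfloor> \<le> \<lfloor>t * real (N n)\<rfloor>"
      using ut(3) by (intro floor_mono mult_right_mono) auto
    ultimately have "j = i \<or> j = Suc i"
      using ut(1,2) unfolding i_def j_def by linarith
    moreover have "j \<le> N n" using idx[OF ut(2)] by (simp add: j_def)
    ultimately show ?thesis
      using small_link_in[OF link, of i n] e0[of n] unfolding a_def i_def[symmetric] j_def[symmetric] by auto
  qed
  have "continuous_on {0..1} f"
    unfolding continuous_on_iff
  proof (intro ballI allI impI)
    fix t :: real and d :: real assume t: "t \<in> {0..1}" "d > 0"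
    obtain n where n: "e n < d / 5" using e_small[of "d / 5"] t by auto
    have "dist (f u) (f t) < d" if u: "u \<in> {0..1}" "dist u t < 1 / N n" for u
    proof -
      have "dist (a n u) (a n t) \<le> e n"
        using a_osc[of u t n] a_osc[of t u n] u t by (cases "u \<le> t") (auto simp: dist_real_def dist_commute)
      then show ?thesis
        using af[OF u(1), of n] af[OF t(1), of n] n dist_triangle[of "f u" "f t" "a n u"] 
          dist_triangle[of "a n u" "f t" "a n t"] by (simp add: dist_commute)
    qed
    then show "\<exists>\<delta>>0. \<forall>u\<in>{0..1}. dist u t < \<delta> \<longrightarrow> dist (f u) (f t) < d"
      using N0[of n] by (intro exI[of _ "1 / N n"]) auto
  qed
  moreover have "f 0 = x"
    using LIMSEQ_unique[OF f[of 0], of x] by (simp add: a_def c0)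
  moreover have "f 1 = y"
    using LIMSEQ_unique[OF f[of 1], of y] by (simp add: a_def cN)
  moreover have "dist x (f t) \<le> 3 * r" if t: "t \<in> {0..1}" for t
  proof -
    have "dist x (a 0 t) \<le> r"
    proof -
      have N1: "N 0 = 1" using s(1)[of 0] by (simp add: P_def N_def)
      then have "nat \<lfloor>t * real (N 0)\<rfloor> = 0 \<or> nat \<lfloor>t * real (N 0)\<rfloor> = N 0"
        using idx[OF t, of 0] by linarith
      then have "a 0 t = x \<or> a 0 t = y" by (auto simp: a_def c0 cN)
      then show ?thesis using small_link_in[OF assms(3)] assms(4) by auto
    qed
    then show ?thesis
      using af[OF t, of 0] dist_triangle[of x "f t" "a 0 t"] by (simp add: e_def)
  qed
  ultimately show thesis
    using fM by (intro that[of f]) (auto simp: path_def path_image_def pathstart_def pathfinish_def)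
qed

text \<open>The compact case of the Mazurkiewicz-Moore-Menger theorem. Paths from \<open>x\<close>
  inside \<open>W\<close> to the points of a neighbourhood suffice (the im kleinen form), and links
  of size \<open>r / 4\<close> give paths within \<open>3 * (r / 4) < r\<close> of
  \<open>x\<close>.\<close>

theorem locally_connected_compact_imp_locally_path_connected:
  fixes M :: "'a::metric_space set"
  assumes "compact M" "locally connected M"
  shows "locally path_connected M"
  unfolding locally_path_connected_im_kleinen
proof (intro allI impI, elim conjE)
  fix W x assume W: "openin (top_of_set M) W" "x \<in> W"
  then obtain r where r: "r > 0" "M \<inter> ball x r \<subseteq> W"
    unfolding openin_contains_ball by (metis inf_commute)
  have xM: "x \<in> M" using W openin_imp_subset by blast
  obtain U where U: "openin (top_of_set M) U" "x \<in> U" "U \<subseteq> ball x (r/4)"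
    "\<And>u v. u \<in> U \<Longrightarrow> v \<in> U \<Longrightarrow> small_link M (r/4) u v"
    using small_link_neighbourhood[OF assms(2) xM, of "r/4"] r(1) by (metis zero_less_divide_iff zero_less_numeral)
  have "\<exists>p. path p \<and> path_image p \<subseteq> W \<and> pathstart p = x \<and> pathfinish p = y" if y: "y \<in> U" for y
  proof -
    obtain p where "path p" "path_image p \<subseteq> M \<inter> cball x (3 * (r/4))" "pathstart p = x" "pathfinish p = y"
      using small_link_imp_path[OF assms U(4)[OF U(2) y]] r(1) by auto
    moreover have "M \<inter> cball x (3 * (r/4)) \<subseteq> W"
      using r by (intro order_trans[OF _ r(2)]) auto
    ultimately show ?thesis by blast
  qed
  moreover have "U \<subseteq> W"
    using U(1,3) r openin_imp_subset[OF U(1)] by (intro order_trans[OF _ r(2)]) auto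
  ultimately show "\<exists>u. openin (top_of_set M) u \<and> x \<in> u \<and> u \<subseteq> W \<and>
      (\<forall>y. y \<in> u \<longrightarrow> (\<exists>p. path p \<and> path_image p \<subseteq> W \<and> pathstart p = x \<and> pathfinish p = y))"
    using U by blast
qed

text \<open>The Kuratowski embedding \<open>x \<mapsto> dist x \<cdot> - dist x\<^sub>0 \<cdot>\<close> makes theorems about paths in Banach
  spaces available in all metric spaces.\<close>

lemma isometric_embedding:
  obtains k :: "'a::metric_space \<Rightarrow> 'a \<Rightarrow>\<^sub>C real" where "\<And>x y. dist (k x) (k y) = dist x y"
proof -
  define z where "z = (undefined :: 'a)"
  have b: "(\<lambda>u. dist x u - dist z u) \<in> bcontfun" for x
  proof (rule bcontfun_normI[of _ "dist x z"])
    show "continuous_on UNIV (\<lambda>u. dist x u - dist z u)" by (intro continuous_intros)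
    show "norm (dist x u - dist z u) \<le> dist x z" for u
      using dist_triangle[of x u z] dist_triangle[of z u x] by (simp add: dist_commute)
  qed
  define k where "k x = Bcontfun (\<lambda>u. dist x u - dist z u)" for x
  have k: "apply_bcontfun (k x) u = dist x u - dist z u" for x u
    unfolding k_def by (simp add: Bcontfun_inverse[OF b])
  have "dist (k x) (k y) = dist x y" for x y
  proof (rule antisym)
    show "dist (k x) (k y) \<le> dist x y"
    proof (rule dist_bound)
      fix u show "dist (apply_bcontfun (k x) u) (apply_bcontfun (k y) u) \<le> dist x y"
        using dist_triangle[of x u y] dist_triangle[of y u x] by (simp add: k dist_real_def dist_commute)
    qed
    show "dist x y \<le> dist (k x) (k y)"
      using dist_bounded[of "k x" y "k y"] by (simp add: k dist_real_def)
  qed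
  then show thesis using that by blast
qed


section \<open>Segments in sets without simple closed curves\<close>

definition has_loop :: "'a::topological_space set \<Rightarrow> bool" where
  "has_loop M \<longleftrightarrow> (\<exists>g. simple_path g \<and> pathfinish g = pathstart g \<and> path_image g \<subseteq> M)"

text \<open>If \<open>g s\<close> lies off \<open>h\<close>, take the last parameter
  \<open>u\<close> before and the first parameter \<open>v\<close> after \<open>s\<close> at which
  \<open>g\<close> meets \<open>h\<close>. The piece of \<open>g\<close> between them meets
  \<open>h\<close> only at its ends, and the piece of \<open>h\<close> between the same two points
  closes it to a simple closed curve.\<close>

lemma arcs_same_ends_subset:
  fixes M :: "'a::{complete_space,real_normed_vector} set"
  assumes "\<not> has_loop M" and g: "arc g" "path_image g \<subseteq> M" and h: "arc h" "path_image h \<subseteq> M"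
    and ends: "pathstart g = pathstart h" "pathfinish g = pathfinish h"
  shows "path_image g \<subseteq> path_image h"
proof (rule ccontr)
  assume "\<not> path_image g \<subseteq> path_image h"
  then obtain s where s: "s \<in> {0..1}" "g s \<notin> path_image h" unfolding path_image_def[of g] by blast
  have cg: "continuous_on {0..1} g" using g(1) by (simp add: arc_def path_def)
  have inj: "inj_on g {0..1}" using g(1) by (simp add: arc_def)
  define Z where "Z = {0..1} \<inter> g -` path_image h"
  have "closed Z"
    unfolding Z_def using g(1) h(1) cg by (intro continuous_closed_preimage) (auto intro: closed_path_image arc_imp_path)
  have Z01: "0 \<in> Z" "1 \<in> Z" "s \<notin> Z"
    using ends s pathstart_in_path_image[of h] pathfinish_in_path_image[of h]
    by (auto simp: Z_def pathstart_def pathfinish_def)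
  have cl: "compact (Z \<inter> {0..s})" "compact (Z \<inter> {s..1})"
    using \<open>closed Z\<close> by (auto intro: closed_Int_compact)
  have ne: "Z \<inter> {0..s} \<noteq> {}" "Z \<inter> {s..1} \<noteq> {}" using Z01 s by auto
  obtain u where u: "u \<in> Z" "u \<le> s" "\<And>w. w \<in> Z \<Longrightarrow> w \<le> s \<Longrightarrow> w \<le> u"
    using compact_attains_sup[OF cl(1) ne(1)] by (auto simp: Z_def)
  obtain v where v: "v \<in> Z" "s \<le> v" "\<And>w. w \<in> Z \<Longrightarrow> s \<le> w \<Longrightarrow> v \<le> w"
    using compact_attains_inf[OF cl(2) ne(2)] by (auto simp: Z_def)
  have uv: "u < s" "s < v" "u \<in> {0..1}" "v \<in> {0..1}"
    using u v Z01 by (auto simp: Z_def order.order_iff_strict)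
  obtain a b where ab: "a \<in> {0..1}" "b \<in> {0..1}" "h a = g u" "h b = g v"
    using u(1) v(1) by (auto simp: Z_def path_image_def)
  have "g u \<noteq> g v" using inj uv by (auto dest: inj_onD)
  then have "a \<noteq> b" using ab by auto
  define \<gamma> where "\<gamma> = subpath u v g +++ subpath b a h"
  have "simple_path \<gamma>"
    unfolding \<gamma>_def
  proof (rule simple_path_join_loop)
    show "arc (subpath u v g)" "arc (subpath b a h)"
      using g h uv ab \<open>a \<noteq> b\<close> by (auto intro!: arc_subpath_arc)
    show "path_image (subpath u v g) \<inter> path_image (subpath b a h) \<subseteq> {pathstart (subpath u v g), pathstart (subpath b a h)}"
    proof
      fix x assume x: "x \<in> path_image (subpath u v g) \<inter> path_image (subpath b a h)"
      then obtain w where w: "x = g w" "u \<le> w" "w \<le> v" using uv by (auto simp: path_image_subpath)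
      moreover have "x \<in> path_image h"
        using x path_image_subpath_subset[OF ab(2,1), of h] by blast
      ultimately have "w \<in> Z" using uv by (auto simp: Z_def)
      then have "w = u \<or> w = v" using u(3)[of w] v(3)[of w] w by (cases "w \<le> s") auto
      then show "x \<in> {pathstart (subpath u v g), pathstart (subpath b a h)}" using w ab by auto
    qed
  qed (use ab in simp_all)
  moreover have "pathfinish \<gamma> = pathstart \<gamma>" using ab by (simp add: \<gamma>_def)
  moreover have "path_image \<gamma> \<subseteq> M"
    using path_image_subpath_subset[OF ab(2,1), of h] path_image_subpath_subset[OF uv(3,4), of g] g(2) h(2)
    unfolding \<gamma>_def by (intro order_trans[OF path_image_join_subset]) blast
  ultimately show False using assms(1) unfolding has_loop_def by blast
qed

text \<open>The case \<open>x = y\<close> is separate because an arc has distinct ends; it provides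
  the segment from the base point to itself.\<close>

definition is_segment :: "'a::topological_space set \<Rightarrow> 'a \<Rightarrow> 'a \<Rightarrow> 'a set \<Rightarrow> bool" where
  "is_segment M x y A \<longleftrightarrow> A \<subseteq> M \<and> (x = y \<and> A = {x} \<or>
     (\<exists>g. arc g \<and> pathstart g = x \<and> pathfinish g = y \<and> path_image g = A))"

lemma is_segment_unique:
  fixes M :: "'a::{complete_space,real_normed_vector} set"
  assumes "\<not> has_loop M" "is_segment M x y A" "is_segment M x y B"
  shows "A = B"
proof (cases "x = y")
  case True
  then show ?thesis using assms(2,3) arc_distinct_ends unfolding is_segment_def by blast
next
  case False
  then obtain g h where "arc g" "pathstart g = x" "pathfinish g = y" "path_image g = A"
    "arc h" "pathstart h = x" "pathfinish h = y" "path_image h = B" "A \<subseteq> M" "B \<subseteq> M"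
    using assms(2,3) unfolding is_segment_def by blast
  then show ?thesis
    using arcs_same_ends_subset[OF assms(1), of g h] arcs_same_ends_subset[OF assms(1), of h g] by auto
qed

lemma path_contains_segment:
  fixes p :: "real \<Rightarrow> 'a::{complete_space,real_normed_vector}"
  assumes "path p" "path_image p \<subseteq> M"
  obtains A where "is_segment M (pathstart p) (pathfinish p) A" "A \<subseteq> path_image p"
proof (cases "pathstart p = pathfinish p")
  case True
  then show thesis using that[of "{pathstart p}"] assms by (auto simp: is_segment_def)
next
  case False
  obtain q where "arc q" "path_image q \<subseteq> path_image p" "pathstart q = pathstart p" "pathfinish q = pathfinish p"
    using path_contains_arc[OF assms(1) refl refl False] by blast
  then show thesis using that[of "path_image q"] assms(2) unfolding is_segment_def by blast
qed

lemma is_segment_path: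
  assumes "is_segment M x y A"
  shows "\<exists>p. path p \<and> path_image p = A \<and> pathstart p = x \<and> pathfinish p = y"
proof (cases "x = y \<and> A = {x}")
  case True
  then show ?thesis by (intro exI[of _ "\<lambda>t. x"]) (auto simp: path_def path_image_def pathstart_def pathfinish_def)
qed (use assms arc_imp_path in \<open>auto simp: is_segment_def\<close>)

lemma is_segment_facts:
  fixes M :: "'a::{complete_space,real_normed_vector} set"
  assumes "is_segment M x y A"
  shows "A \<subseteq> M" "x \<in> A" "y \<in> A" "compact A" "connected A" "is_segment M y x A"
proof -
  obtain p where p: "path p" "path_image p = A" "pathstart p = x" "pathfinish p = y"
    using is_segment_path[OF assms] by blast
  show "A \<subseteq> M" using assms by (simp add: is_segment_def)
  show "x \<in> A" "y \<in> A" "compact A" "connected A"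
    using p by (auto intro: compact_path_image connected_path_image)
  show "is_segment M y x A"
    using assms unfolding is_segment_def
    by (metis arc_reversepath path_image_reversepath pathfinish_reversepath pathstart_reversepath)
qed

text \<open>The path along \<open>A\<close> from \<open>x\<close> to \<open>z\<close> and then along
  \<open>B\<close> to \<open>y\<close> contains a segment, which by uniqueness is \<open>C\<close>.
  Continuity along segments from a base point thereby passes to segments between arbitrary
  points.\<close>

lemma is_segment_triangle:
  fixes M :: "'a::{complete_space,real_normed_vector} set"
  assumes "\<not> has_loop M" "is_segment M z x A" "is_segment M z y B" "is_segment M x y C"
  shows "C \<subseteq> A \<union> B"
proof -
  obtain p q where p: "path p" "path_image p = A" "pathstart p = x" "pathfinish p = z"
    and q: "path q" "path_image q = B" "pathstart q = z" "pathfinish q = y"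
    using is_segment_path[OF is_segment_facts(6)[OF assms(2)]] is_segment_path[OF assms(3)] by metis
  have "path (p +++ q)" "path_image (p +++ q) = A \<union> B" "pathstart (p +++ q) = x" "pathfinish (p +++ q) = y"
    using p q by (simp_all add: path_image_join)
  then obtain D where "is_segment M x y D" "D \<subseteq> A \<union> B"
    using path_contains_segment[of "p +++ q" M] is_segment_facts(1)[OF assms(2)] is_segment_facts(1)[OF assms(3)]
    by (metis Un_least)
  then show ?thesis using is_segment_unique[OF assms(1,4)] by blast
qed

lemma is_segment_subpath:
  fixes M :: "'a::{complete_space,real_normed_vector} set"
  assumes "arc g" "path_image g \<subseteq> M" "u \<in> {0..1}"
  shows "is_segment M (pathstart g) (g u) (g ` {0..u})"
proof (cases "u = 0")
  case True
  then show ?thesis using assms by (auto simp: is_segment_def pathstart_def path_image_def)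
next
  case False
  have "arc (subpath 0 u g)" using assms False by (intro arc_subpath_arc) auto
  moreover have "path_image (subpath 0 u g) = g ` {0..u}" using assms by (simp add: path_image_subpath)
  moreover have "path_image (subpath 0 u g) \<subseteq> M"
    using path_image_subpath_subset[of 0 u g] assms by auto
  ultimately show ?thesis
    unfolding is_segment_def by (metis pathfinish_subpath pathstart_subpath pathstart_def)
qed

section \<open>Continuous dependence of roots\<close>

text \<open>Recording the polynomial at each point, rather than a list of coefficient functions,
  lets a family be pulled back along arcs and embeddings.\<close>

definition monic_family :: "'b::topological_space set \<Rightarrow> nat \<Rightarrow> ('b \<Rightarrow> complex poly) \<Rightarrow> bool" where
  "monic_family M n P \<longleftrightarrow> (\<forall>x\<in>M. Polynomial.degree (P x) = n \<and> Polynomial.lead_coeff (P x) = 1) \<and>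
     (\<forall>k. continuous_on M (\<lambda>x. Polynomial.coeff (P x) k))"

lemma monic_family_subset: "monic_family M n P \<Longrightarrow> S \<subseteq> M \<Longrightarrow> monic_family S n P"
  unfolding monic_family_def by (meson continuous_on_subset subsetD)

lemma monic_family_compose:
  assumes "monic_family M n P" "continuous_on S g" "g ` S \<subseteq> M"
  shows "monic_family S n (\<lambda>x. P (g x))"
  unfolding monic_family_def
proof (intro conjI allI)
  show "continuous_on S (\<lambda>x. Polynomial.coeff (P (g x)) k)" for k
    using continuous_on_compose2[OF _ assms(2,3), of "\<lambda>x. Polynomial.coeff (P x) k"] assms(1)
    unfolding monic_family_def by blast
qed (use assms in \<open>auto simp: monic_family_def\<close>)

lemma monic_family_continuous_poly:
  assumes "monic_family M n P" "continuous_on M h"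
  shows "continuous_on M (\<lambda>x. poly (P x) (h x))"
proof -
  have "continuous_on M (\<lambda>x. \<Sum>k\<le>n. Polynomial.coeff (P x) k * h x ^ k)"
    using assms unfolding monic_family_def by (intro continuous_intros) auto
  then show ?thesis
    by (rule continuous_on_eq) (use assms in \<open>simp add: poly_altdef monic_family_def\<close>)
qed

text \<open>For \<open>norm l > 1\<close> the equation expresses \<open>l ^ n\<close> through n
  lower terms, each of norm at most \<open>B * norm l ^ (n - 1)\<close>.\<close>

lemma monic_poly_roots_bound:
  fixes q :: "complex poly"
  assumes "Polynomial.lead_coeff q = 1" "poly q l = 0" "\<And>k. norm (Polynomial.coeff q k) \<le> B"
  shows "norm l \<le> 1 + B * Polynomial.degree q"
proof (cases "norm l \<le> 1")
  case True
  have "B \<ge> 0" using assms(3)[of 0] norm_ge_zero order_trans by blast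
  then show ?thesis using True by (smt (verit) mult_nonneg_nonneg of_nat_0_le_iff)
next
  case False
  have B: "B \<ge> 0" using assms(3)[of 0] norm_ge_zero order_trans by blast
  define n where "n = Polynomial.degree q"
  have n: "n \<noteq> 0"
  proof
    assume "n = 0"
    then have "q = [:1:]" using assms(1) by (metis n_def degree_0_id lead_coeff_pCons(2) coeff_pCons_0 degree_pCons_0 degree_eq_zeroE)
    then show False using assms(2) by simp
  qed
  have "0 = (\<Sum>k\<le>n. Polynomial.coeff q k * l ^ k)" using assms(2) by (simp add: poly_altdef n_def)
  also have "\<dots> = (\<Sum>k<n. Polynomial.coeff q k * l ^ k) + l ^ n"
    using assms(1) by (simp add: n_def lessThan_Suc_atMost[symmetric])
  finally have "l ^ n = - (\<Sum>k<n. Polynomial.coeff q k * l ^ k)" by (simp add: eq_neg_iff_add_eq_0 add.commute)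
  then have "norm l ^ n = norm (\<Sum>k<n. Polynomial.coeff q k * l ^ k)" by (metis norm_minus_cancel norm_power)
  also have "\<dots> \<le> (\<Sum>k<n. B * norm l ^ (n - 1))"
  proof (rule sum_norm_le)
    fix k assume "k \<in> {..<n}"
    then show "norm (Polynomial.coeff q k * l ^ k) \<le> B * norm l ^ (n - 1)"
      using False B assms(3)[of k] by (auto simp: norm_mult norm_power intro!: mult_mono power_increasing)
  qed
  also have "\<dots> = B * n * norm l ^ (n - 1)" by simp
  finally have "norm l * norm l ^ (n - 1) \<le> (B * n) * norm l ^ (n - 1)"
    using n by (metis power_eq_if)
  then have "norm l \<le> B * n"
    by (rule mult_right_le_imp_le) (use False in \<open>auto intro!: zero_less_power\<close>)
  then show ?thesis by (simp add: n_def)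
qed

lemma monic_family_roots_bounded:
  assumes "compact M" "monic_family M n P"
  obtains B where "B > 0" "\<And>x l. x \<in> M \<Longrightarrow> poly (P x) l = 0 \<Longrightarrow> norm l \<le> B"
proof -
  have "\<exists>b. \<forall>x\<in>M. norm (Polynomial.coeff (P x) k) \<le> b" for k
  proof -
    have "bounded ((\<lambda>x. Polynomial.coeff (P x) k) ` M)"
      using assms unfolding monic_family_def by (intro compact_imp_bounded compact_continuous_image) auto
    then show ?thesis by (auto simp: bounded_iff)
  qed
  then obtain b where b: "\<And>k x. x \<in> M \<Longrightarrow> norm (Polynomial.coeff (P x) k) \<le> b k" by metis
  define B where "B = Max (insert 0 (b ` {..n}))"
  have B0: "B \<ge> 0" by (simp add: B_def)
  have B: "norm (Polynomial.coeff (P x) k) \<le> B" if "x \<in> M" for x k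
  proof (cases "k \<le> n")
    case True
    then have "b k \<le> B" unfolding B_def by (intro Max_ge) auto
    then show ?thesis using b[OF that, of k] by linarith
  next
    case False
    then have "Polynomial.coeff (P x) k = 0" using assms(2) that by (auto simp: monic_family_def coeff_eq_0)
    then show ?thesis using B0 by simp
  qed
  have "norm l \<le> 1 + B * n" if "x \<in> M" "poly (P x) l = 0" for x l
    using monic_poly_roots_bound[of "P x" l B] that B assms(2) by (auto simp: monic_family_def)
  then show thesis using B0 by (intro that[of "1 + B * n"]) (auto intro: add_pos_nonneg)
qed

text \<open>The value at \<open>l\<close> is the product of the differences between \<open>l\<close>
  and the roots, counted with multiplicity.\<close>

lemma monic_poly_lower_bound:
  fixes q :: "complex poly"
  assumes "Polynomial.lead_coeff q = 1" "\<And>m. poly q m = 0 \<Longrightarrow> e \<le> norm (l - m)" "e \<ge> 0"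
  shows "e ^ Polynomial.degree q \<le> norm (poly q l)"
proof -
  have nz: "q \<noteq> 0" using assms(1) by auto
  obtain A where A: "size A = Polynomial.degree q" "q = Polynomial.smult (Polynomial.lead_coeff q) (\<Prod>x\<in>#A. [:-x, 1:])"
    using alg_closed_imp_factorization[OF nz] by (elim exE conjE)
  then have q: "q = (\<Prod>x\<in>#A. [:-x, 1:])" using assms(1) by simp
  have pl: "poly (\<Prod>x\<in>#B. [:-x, 1:]) z = (\<Prod>x\<in>#B. z - x)" for B and z :: complex
    by (induction B) (auto simp: algebra_simps)
  have lb: "e ^ size B \<le> norm (\<Prod>x\<in>#B. l - x)" if "\<forall>x\<in>#B. e \<le> norm (l - x)" for B
    using that
  proof (induction B)
    case (add x B)
    then show ?case using assms(3) by (auto simp: norm_mult intro!: mult_mono)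
  qed simp
  have "poly q m = 0" if "m \<in># A" for m
    using that by (subst q, subst pl) (auto simp: prod_mset_zero_iff)
  then have "e ^ size A \<le> norm (\<Prod>x\<in>#A. l - x)" using assms(2) by (intro lb) auto
  also have "\<dots> = norm (poly q l)" by (metis pl q)
  finally show ?thesis using A(1) by simp
qed

text \<open>At a root \<open>l\<close> of \<open>P x\<close> the value of \<open>P y\<close> is the
  difference of the two polynomials, which is small because the coefficients are uniformly
  continuous and the roots bounded. Without a root of \<open>P y\<close> closer than
  \<open>e\<close> to \<open>l\<close> it would be at least \<open>e ^ n\<close>.\<close>

lemma roots_uniformly_close:
  fixes P :: "'b::metric_space \<Rightarrow> complex poly"
  assumes "compact M" "monic_family M n P" "e > 0"
  obtains d where "d > 0" "\<And>x y l. x \<in> M \<Longrightarrow> y \<in> M \<Longrightarrow> dist x y < d \<Longrightarrow> poly (P x) l = 0 \<Longrightarrow>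
    \<exists>m. poly (P y) m = 0 \<and> dist l m < e"
proof -
  obtain B where B: "B > 0" "\<And>x l. x \<in> M \<Longrightarrow> poly (P x) l = 0 \<Longrightarrow> norm l \<le> B"
    using monic_family_roots_bounded[OF assms(1,2)] by blast
  define S where "S = (\<Sum>k\<le>n. B ^ k)"
  have S: "S > 0" unfolding S_def using B(1) by (intro sum_pos) auto
  \<comment> \<open>\<open>S\<close> bounds the sum of the powers of \<open>norm l\<close> for every
    root \<open>l\<close>, so coefficients within \<open>r\<close> change the value by at most
    \<open>r * S = e ^ n / 2\<close>.\<close>
  define r where "r = e ^ n / (2 * S)"
  have r: "r > 0" using S assms(3) by (simp add: r_def)
  have "\<exists>d>0. \<forall>x\<in>M. \<forall>y\<in>M. dist x y < d \<longrightarrow> dist (Polynomial.coeff (P x) k) (Polynomial.coeff (P y) k) < r" for k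
  proof -
    have "uniformly_continuous_on M (\<lambda>x. Polynomial.coeff (P x) k)"
      using assms by (intro compact_uniformly_continuous) (auto simp: monic_family_def)
    then show ?thesis using r unfolding uniformly_continuous_on_def by (metis dist_commute)
  qed
  then obtain D where D: "\<And>k. D k > 0"
    "\<And>k x y. x \<in> M \<Longrightarrow> y \<in> M \<Longrightarrow> dist x y < D k \<Longrightarrow> dist (Polynomial.coeff (P x) k) (Polynomial.coeff (P y) k) < r"
    by metis
  define d where "d = Min (D ` {..n})"
  have d: "d > 0" "\<And>k. k \<le> n \<Longrightarrow> d \<le> D k" using D(1) by (auto simp: d_def)
  have "\<exists>m. poly (P y) m = 0 \<and> dist l m < e" if xy: "x \<in> M" "y \<in> M" "dist x y < d" and l: "poly (P x) l = 0" for x y l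
  proof (rule ccontr)
    assume "\<nexists>m. poly (P y) m = 0 \<and> dist l m < e"
    then have "e ^ Polynomial.degree (P y) \<le> norm (poly (P y) l)"
      using assms(2,3) xy by (intro monic_poly_lower_bound) (auto simp: monic_family_def dist_norm not_less)
    then have "e ^ n \<le> norm (poly (P y) l - poly (P x) l)"
      using l xy assms(2) by (simp add: monic_family_def)
    also have "poly (P y) l - poly (P x) l = (\<Sum>k\<le>n. (Polynomial.coeff (P y) k - Polynomial.coeff (P x) k) * l ^ k)"
      using xy assms(2) by (simp add: poly_altdef monic_family_def sum_subtractf left_diff_distrib)
    also have "norm \<dots> \<le> (\<Sum>k\<le>n. r * B ^ k)"
    proof (rule sum_norm_le)
      fix k assume "k \<in> {..n}"
      then have "norm (Polynomial.coeff (P y) k - Polynomial.coeff (P x) k) \<le> r"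
        using D(2)[of x y k] d(2)[of k] xy by (auto simp: dist_norm norm_minus_commute)
      then show "norm ((Polynomial.coeff (P y) k - Polynomial.coeff (P x) k) * l ^ k) \<le> r * B ^ k"
        using B(2)[OF xy(1) l] r by (auto simp: norm_mult norm_power intro!: mult_mono power_mono)
    qed
    also have "\<dots> = r * S" by (simp add: sum_distrib_left S_def)
    also have "\<dots> = e ^ n / 2" using S by (simp add: r_def)
    finally show False using assms(3) by simp
  qed
  then show thesis using that d(1) by blast
qed

text \<open>If the diameter were larger, the distance from a fixed point would take \<open>n + 1\<close> values
  that are more than \<open>2 * e\<close> apart, and these would need \<open>n + 1\<close> different centres.\<close>

lemma connected_near_finite_diameter:
  fixes S :: "'a::metric_space set" and e :: real
  assumes "connected S" "finite L" "card L \<le> n" "\<And>s. s \<in> S \<Longrightarrow> \<exists>m\<in>L. dist s m < e"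
    and s: "s \<in> S" "s' \<in> S"
  shows "dist s s' \<le> 3 * real n * e"
proof (rule ccontr)
  assume far: "\<not> dist s s' \<le> 3 * real n * e"
  obtain m where "dist s m < e" using assms(4)[OF s(1)] by blast
  then have e: "e > 0" using zero_le_dist[of s m] by linarith
  have "\<exists>u\<in>S. dist s u = 3 * real j * e" if "j \<le> n" for j :: nat
  proof -
    have "connected (dist s ` S)"
      using assms(1) by (intro connected_continuous_image) (auto intro: continuous_intros)
    moreover have "dist s s \<in> dist s ` S" "dist s s' \<in> dist s ` S" using s by blast+
    moreover have "dist s s \<le> 3 * real j * e" using e by simp
    moreover have "3 * real j * e \<le> 3 * real n * e" using that e by simp
    then have "3 * real j * e \<le> dist s s'" using far by linarith
    ultimately have "3 * real j * e \<in> dist s ` S" by (rule connectedD_interval)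
    then show ?thesis by force
  qed
  then obtain u where u: "\<And>j. j \<le> n \<Longrightarrow> u j \<in> S" "\<And>j. j \<le> n \<Longrightarrow> dist s (u j) = 3 * real j * e"
    by metis
  have "\<exists>m. m \<in> L \<and> dist (u j) m < e" if "j \<le> n" for j
    using assms(4)[OF u(1)[OF that]] by blast
  then obtain m where m: "\<And>j. j \<le> n \<Longrightarrow> m j \<in> L" "\<And>j. j \<le> n \<Longrightarrow> dist (u j) (m j) < e"
    by metis
  have "j = k" if "j \<le> n" "k \<le> n" "m j = m k" for j k
  proof (rule ccontr)
    assume "j \<noteq> k"
    then have "1 \<le> \<bar>real j - real k\<bar>" by linarith
    then have "3 * e \<le> 3 * e * \<bar>real j - real k\<bar>" using e by simp
    also have "\<dots> = \<bar>3 * e * (real j - real k)\<bar>" using e by (simp add: abs_mult)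
    also have "\<dots> = \<bar>3 * real j * e - 3 * real k * e\<bar>" by (simp add: algebra_simps)
    also have "\<dots> = \<bar>dist s (u j) - dist s (u k)\<bar>" using u that by simp
    also have "\<dots> \<le> dist (u j) (u k)"
      using dist_triangle[of s "u j" "u k"] dist_triangle[of s "u k" "u j"] by (simp add: dist_commute)
    also have "\<dots> \<le> dist (u j) (m j) + dist (m k) (u k)"
      using dist_triangle[of "u j" "u k" "m j"] that by simp
    also have "\<dots> < 2 * e" using m(2)[OF that(1)] m(2)[OF that(2)] by (simp add: dist_commute)
    finally show False using e by simp
  qed
  then have "inj_on m {..n}" by (auto simp: inj_on_def)
  then have "card {..n} \<le> card L" using m(1) assms(2) by (intro card_inj_on_le[of m]) auto
  then show False using assms(3) by simp
qed

lemma connected_near_roots_diameter: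
  fixes S :: "complex set" and e :: real
  assumes "connected S" "Polynomial.lead_coeff q = 1" "\<And>s. s \<in> S \<Longrightarrow> \<exists>m. poly q m = 0 \<and> dist s m < e"
    and "s \<in> S" "s' \<in> S"
  shows "dist s s' \<le> 3 * real (Polynomial.degree q) * e"
proof (rule connected_near_finite_diameter[of S "{m. poly q m = 0}"])
  have "q \<noteq> 0" using assms(2) by auto
  then show "finite {m. poly q m = 0}" "card {m. poly q m = 0} \<le> Polynomial.degree q"
    by (auto simp: poly_roots_finite card_poly_roots_bound)
qed (use assms in auto)

section \<open>Continuous roots along intervals\<close>

lemma small_radius:
  fixes e :: real
  assumes "e > 0"
  obtains \<eta> where "\<eta> > 0" "3 * real n * \<eta> < e"
proof -
  \<comment> \<open>The summand 1 keeps the denominator positive for \<open>n = 0\<close> and the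
    inequality strict.\<close>
  define \<eta> where "\<eta> = e / (3 * real n + 1)"
  have "\<eta> > 0" using assms by (simp add: \<eta>_def add_nonneg_pos)
  moreover have "(3 * real n + 1) * \<eta> = e"
    unfolding \<eta>_def by (simp add: add_nonneg_pos order_less_imp_not_eq2)
  ultimately show thesis using that by (simp add: distrib_right)
qed

text \<open>On a grid of mesh \<open>d / 2\<close> each root has a root within \<open>e / 3\<close>
  at the next grid point. Linear interpolation adds at most another \<open>e / 3\<close> in
  between.\<close>

lemma approximate_root_path:
  fixes Q :: "real \<Rightarrow> complex poly"
  assumes fam: "monic_family {a..b} n Q" and ab: "a \<le> b" and l: "poly (Q a) l = 0" and e: "e > 0"
  obtains q where "continuous_on {a..b} q" "q a = l"
    "\<And>t. t \<in> {a..b} \<Longrightarrow> \<exists>m. poly (Q t) m = 0 \<and> dist (q t) m < e"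
proof -
  obtain d where d: "d > 0" "\<And>x y l. x \<in> {a..b} \<Longrightarrow> y \<in> {a..b} \<Longrightarrow> dist x y < d \<Longrightarrow> poly (Q x) l = 0 \<Longrightarrow>
    \<exists>m. poly (Q y) m = 0 \<and> dist l m < e / 3"
    using roots_uniformly_close[OF compact_Icc fam, of "e/3"] e by auto
  \<comment> \<open>The value at the current right end is required to be an exact root, as the next
    piece has to start from one; \<open>min b\<close> stops the grid at \<open>b\<close>.\<close>
  have "\<exists>q. continuous_on {a..min b (a + real i * (d/2))} q \<and> q a = l \<and>
    poly (Q (min b (a + real i * (d/2)))) (q (min b (a + real i * (d/2)))) = 0 \<and>
    (\<forall>t\<in>{a..min b (a + real i * (d/2))}. \<exists>m. poly (Q t) m = 0 \<and> dist (q t) m < e)" for i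
  proof (induction i)
    case 0
    then show ?case using ab l e by (intro exI[of _ "\<lambda>t. l"]) (auto simp: min_def)
  next
    case (Suc i)
    define c where "c = min b (a + real i * (d/2))"
    define c' where "c' = min b (a + real (Suc i) * (d/2))"
    have c: "a \<le> c" "c \<le> c'" "c' \<le> b" "c' - c < d"
    proof -
      define u where "u = a + real i * (d/2)"
      have u: "a + real (Suc i) * (d/2) = u + d/2" "a \<le> u"
        using d(1) by (simp_all add: u_def algebra_simps)
      show "a \<le> c" "c \<le> c'" "c' \<le> b" "c' - c < d"
        using ab d(1) u(2) unfolding c_def c'_def u(1) u_def[symmetric] by (auto simp: min_def)
    qed
    obtain q where q: "continuous_on {a..c} q" "q a = l" "poly (Q c) (q c) = 0"
      "\<And>t. t \<in> {a..c} \<Longrightarrow> \<exists>m. poly (Q t) m = 0 \<and> dist (q t) m < e"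
      using Suc.IH unfolding c_def[symmetric] by blast
    show ?case unfolding c'_def[symmetric]
    proof (cases "c = c'")
      case True
      then show "\<exists>q. continuous_on {a..c'} q \<and> q a = l \<and> poly (Q c') (q c') = 0 \<and>
        (\<forall>t\<in>{a..c'}. \<exists>m. poly (Q t) m = 0 \<and> dist (q t) m < e)" using q by blast
    next
      case False
      obtain \<rho> where \<rho>: "poly (Q c') \<rho> = 0" "dist (q c) \<rho> < e / 3"
        using d(2)[of c c' "q c"] c q(3) by (auto simp: dist_real_def)
      define r where "r t = q c + of_real ((t - c) / (c' - c)) * (\<rho> - q c)" for t
      define q' where "q' t = (if t \<le> c then q t else r t)" for t
      have "continuous_on ({a..c} \<union> {c..c'}) (\<lambda>t. if t \<le> c then q t else r t)"
        using q(1) unfolding r_def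
        by (intro continuous_on_If) (auto intro!: continuous_intros simp: False)
      moreover have "{a..c} \<union> {c..c'} = {a..c'}" using c by auto
      ultimately have "continuous_on {a..c'} q'" unfolding q'_def[abs_def] by simp
      moreover have "q' a = l" using q(2) c by (simp add: q'_def)
      moreover have "poly (Q c') (q' c') = 0" using False c \<rho> by (auto simp: q'_def r_def)
      moreover have "\<exists>m. poly (Q t) m = 0 \<and> dist (q' t) m < e" if t: "t \<in> {a..c'}" for t
      proof (cases "t \<le> c")
        case True
        then show ?thesis using q(4) t by (simp add: q'_def)
      next
        case tc: False
        obtain m where m: "poly (Q t) m = 0" "dist (q c) m < e / 3"
          using d(2)[of c t "q c"] c q(3) t tc by (auto simp: dist_real_def)
        define w where "w = (t - c) / (c' - c)"
        have "\<bar>w\<bar> \<le> 1" using t tc by (auto simp: w_def)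
        have "dist (q' t) (q c) = norm (complex_of_real w * (\<rho> - q c))"
          using tc unfolding q'_def r_def dist_norm w_def by simp
        also have "\<dots> = \<bar>w\<bar> * norm (\<rho> - q c)" by (simp only: norm_mult norm_of_real)
        also have "\<dots> \<le> 1 * norm (\<rho> - q c)" using \<open>\<bar>w\<bar> \<le> 1\<close> by (intro mult_right_mono) auto
        also have "\<dots> < e / 3" using \<rho>(2) by (simp add: dist_norm norm_minus_commute)
        finally have "dist (q' t) m < e"
          using m(2) e dist_triangle[of "q' t" m "q c"] by simp
        then show ?thesis using m(1) by blast
      qed
      ultimately show "\<exists>q. continuous_on {a..c'} q \<and> q a = l \<and> poly (Q c') (q c') = 0 \<and>
        (\<forall>t\<in>{a..c'}. \<exists>m. poly (Q t) m = 0 \<and> dist (q t) m < e)" by blast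
    qed
  qed
  moreover obtain i :: nat where "(b - a) / (d/2) \<le> real i" using real_arch_simple by blast
  then have "min b (a + real i * (d/2)) = b" using d(1) by (simp add: field_simps min_def)
  ultimately show thesis using that by metis
qed

text \<open>Approximate root paths are equicontinuous even where roots collide: over a short
  interval the values form a connected set close to the roots at a single parameter. Arzela-Ascoli
  then yields a limit, whose values are limits of exact roots.\<close>

lemma root_path_lifting:
  fixes Q :: "real \<Rightarrow> complex poly"
  assumes fam: "monic_family {a..b} n Q" and ab: "a \<le> b" and l: "poly (Q a) l = 0"
  obtains k where "continuous_on {a..b} k" "k a = l" "\<And>t. t \<in> {a..b} \<Longrightarrow> poly (Q t) (k t) = 0"
proof -
  have "\<exists>q. continuous_on {a..b} q \<and> q a = l \<and>
    (\<forall>t\<in>{a..b}. \<exists>m. poly (Q t) m = 0 \<and> dist (q t) m < inverse (real (Suc i)))" for i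
    using approximate_root_path[OF fam ab l, of "inverse (real (Suc i))"] by (metis inverse_positive_iff_positive of_nat_0_less_iff zero_less_Suc)
  then obtain q where q: "\<And>i. continuous_on {a..b} (q i)" "\<And>i. q i a = l"
    "\<And>i t. t \<in> {a..b} \<Longrightarrow> \<exists>m. poly (Q t) m = 0 \<and> dist (q i t) m < inverse (real (Suc i))"
    by metis
  have lead: "Polynomial.degree (Q t) = n" "Polynomial.lead_coeff (Q t) = 1" if "t \<in> {a..b}" for t
    using fam that by (auto simp: monic_family_def)
  obtain B where B: "B > 0" "\<And>x l. x \<in> {a..b} \<Longrightarrow> poly (Q x) l = 0 \<Longrightarrow> norm l \<le> B"
    using monic_family_roots_bounded[OF compact_Icc fam] by metis
  have bound: "norm (q i t) \<le> B + 1" if t: "t \<in> {a..b}" for i t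
  proof -
    obtain m where m: "poly (Q t) m = 0" "dist (q i t) m < inverse (real (Suc i))" using q(3)[OF t] by blast
    have "inverse (real (Suc i)) \<le> 1" by (simp add: field_simps)
    then have "norm (q i t - m) \<le> 1" using m(2) unfolding dist_norm by linarith
    then show ?thesis using B(2)[OF t m(1)] norm_triangle_sub[of "q i t" m] by linarith
  qed
  have equi: "\<exists>d. 0 < d \<and> (\<forall>i u. u \<in> {a..b} \<and> norm (t - u) < d \<longrightarrow> norm (q i t - q i u) < e)"
    if t: "t \<in> {a..b}" and e: "0 < e" for t e
  proof -
    obtain \<eta> where \<eta>: "\<eta> > 0" and \<eta>e: "3 * real n * \<eta> < e"
      using small_radius[OF e] by blast
    obtain d where d: "d > 0" "\<And>x y l. x \<in> {a..b} \<Longrightarrow> y \<in> {a..b} \<Longrightarrow> dist x y < d \<Longrightarrow> poly (Q x) l = 0 \<Longrightarrow>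
      \<exists>m. poly (Q y) m = 0 \<and> dist l m < \<eta> / 2"
      using roots_uniformly_close[OF compact_Icc fam, of "\<eta>/2"] \<eta> by auto
    obtain K where K: "inverse (real (Suc K)) < \<eta> / 2" using reals_Archimedean[of "\<eta>/2"] \<eta> by auto
    have big: "norm (q i t - q i u) < e" if i: "i \<ge> K" and u: "u \<in> {a..b}" "norm (t - u) < d" for i u
    proof -
      define S where "S = q i ` closed_segment t u"
      have seg: "closed_segment t u \<subseteq> {a..b}" using t u by (auto simp: closed_segment_eq_real_ivl split: if_splits)
      have "dist (q i t) (q i u) \<le> 3 * real (Polynomial.degree (Q t)) * \<eta>"
      proof (rule connected_near_roots_diameter[of S])
        show "connected S" unfolding S_def
          by (intro connected_continuous_image continuous_on_subset[OF q(1) seg]) auto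
        show "Polynomial.lead_coeff (Q t) = 1" using lead t by simp
        fix s assume "s \<in> S"
        then obtain v where v: "v \<in> closed_segment t u" "s = q i v" by (auto simp: S_def)
        have vab: "v \<in> {a..b}" using v seg by blast
        have "dist v t < d" using segment_bound(1)[OF v(1)] u(2) by (simp add: dist_norm abs_minus_commute)
        obtain m where m: "poly (Q v) m = 0" "dist s m < inverse (real (Suc i))" using q(3)[OF vab] v by blast
        obtain m' where m': "poly (Q t) m' = 0" "dist m m' < \<eta> / 2"
          using d(2)[OF vab t \<open>dist v t < d\<close> m(1)] by blast
        have "inverse (real (Suc i)) \<le> inverse (real (Suc K))" using i by (simp add: field_simps)
        then have "dist s m' < \<eta>" using m(2) m'(2) K dist_triangle[of s m' m] by linarith
        then show "\<exists>m. poly (Q t) m = 0 \<and> dist s m < \<eta>" using m' by blast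
      qed (auto simp: S_def)
      then show ?thesis using \<eta>e lead t by (simp add: dist_norm)
    qed
    \<comment> \<open>The first \<open>K\<close> paths may be too far from the roots for the
      connectedness estimate; being finitely many, they are covered by their own continuity.\<close>
    have "\<exists>d>0. \<forall>u\<in>{a..b}. norm (t - u) < d \<longrightarrow> norm (q i t - q i u) < e" for i
      using q(1)[of i] t e unfolding continuous_on_iff by (metis dist_norm dist_commute)
    then obtain D where D: "\<And>i. D i > 0" "\<And>i u. u \<in> {a..b} \<Longrightarrow> norm (t - u) < D i \<Longrightarrow> norm (q i t - q i u) < e"
      by metis
    define d' where "d' = Min (insert d (D ` {..<K}))"
    have "d' > 0" using d(1) D(1) by (simp add: d'_def)
    moreover have "norm (q i t - q i u) < e" if "u \<in> {a..b}" "norm (t - u) < d'" for i u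
    proof (cases "i < K")
      case True
      then have "d' \<le> D i" unfolding d'_def by (intro Min_le) auto
      then show ?thesis using D(2)[OF that(1), of i] that(2) by linarith
    next
      case False
      have "d' \<le> d" unfolding d'_def by (intro Min_le) auto
      then show ?thesis using big[of i u] False that by auto
    qed
    ultimately show ?thesis by blast
  qed
  obtain k r where k: "continuous_on {a..b} k" and r: "strict_mono (r :: nat \<Rightarrow> nat)"
    and lim: "\<And>e. 0 < e \<Longrightarrow> \<exists>N. \<forall>i x. i \<ge> N \<and> x \<in> {a..b} \<longrightarrow> norm (q (r i) x - k x) < e"
    using Arzela_Ascoli[of "{a..b}" q "B + 1"] bound equi by (metis compact_Icc)
  have conv: "(\<lambda>i. q (r i) t) \<longlonglongrightarrow> k t" if "t \<in> {a..b}" for t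
    unfolding LIMSEQ_iff using lim that by blast
  have "k a = l" using LIMSEQ_unique[OF conv[of a], of l] ab by (simp add: q(2))
  moreover have "poly (Q t) (k t) = 0" if t: "t \<in> {a..b}" for t
  proof -
    obtain m where m: "\<And>i. poly (Q t) (m i) = 0" "\<And>i. dist (q i t) (m i) < inverse (real (Suc i))"
      using q(3)[OF t] by metis
    have "(\<lambda>i. inverse (real (Suc (r i)))) \<longlonglongrightarrow> 0"
      using LIMSEQ_subseq_LIMSEQ[OF LIMSEQ_inverse_real_of_nat r] by (simp add: o_def)
    then have "(\<lambda>i. q (r i) t - m (r i)) \<longlonglongrightarrow> 0"
      by (rule Lim_null_comparison[rotated]) (use m(2) in \<open>auto simp: dist_norm intro!: always_eventually less_imp_le\<close>)
    then have "(\<lambda>i. q (r i) t - (q (r i) t - m (r i))) \<longlonglongrightarrow> k t - 0" by (intro tendsto_diff conv[OF t])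
    then have "(\<lambda>i. m (r i)) \<longlonglongrightarrow> k t" by simp
    then have "(\<lambda>i. poly (Q t) (m (r i))) \<longlonglongrightarrow> poly (Q t) (k t)" by (rule tendsto_poly)
    then have "(\<lambda>i. 0) \<longlonglongrightarrow> poly (Q t) (k t)" by (simp add: m(1))
    then show ?thesis using LIMSEQ_unique[OF _ tendsto_const] by blast
  qed
  ultimately show thesis using that k by blast
qed

text \<open>The connectedness estimate again, now for exact roots. The interval \<open>S\<close>
  need not be closed, and uniform continuity is what gives a limit at a missing end.\<close>

lemma continuous_root_uniformly_continuous:
  fixes Q :: "real \<Rightarrow> complex poly"
  assumes fam: "monic_family {a..b} n Q" and S: "S \<subseteq> {a..b}" "\<And>u v. u \<in> S \<Longrightarrow> v \<in> S \<Longrightarrow> {u..v} \<subseteq> S"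
    and k: "continuous_on S k" "\<And>t. t \<in> S \<Longrightarrow> poly (Q t) (k t) = 0"
  shows "uniformly_continuous_on S k"
  unfolding uniformly_continuous_on_def
proof (intro allI impI)
  fix e :: real assume e: "e > 0"
  obtain \<eta> where \<eta>: "\<eta> > 0" and \<eta>e: "3 * real n * \<eta> < e"
    using small_radius[OF e] by blast
  obtain d where d: "d > 0" "\<And>x y l. x \<in> {a..b} \<Longrightarrow> y \<in> {a..b} \<Longrightarrow> dist x y < d \<Longrightarrow> poly (Q x) l = 0 \<Longrightarrow>
    \<exists>m. poly (Q y) m = 0 \<and> dist l m < \<eta>"
    using roots_uniformly_close[OF compact_Icc fam \<eta>] by metis
  have "dist (k u) (k v) < e" if uv: "u \<in> S" "v \<in> S" "dist u v < d" for u v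
  proof -
    have seg: "closed_segment u v \<subseteq> S"
      using uv S(2)[of u v] S(2)[of v u] by (auto simp: closed_segment_eq_real_ivl)
    have uab: "u \<in> {a..b}" using uv S by blast
    have "dist (k u) (k v) \<le> 3 * real (Polynomial.degree (Q u)) * \<eta>"
    proof (rule connected_near_roots_diameter[of "k ` closed_segment u v"])
      show "connected (k ` closed_segment u v)"
        by (intro connected_continuous_image continuous_on_subset[OF k(1) seg]) auto
      show "Polynomial.lead_coeff (Q u) = 1" using fam uab unfolding monic_family_def by blast
      fix s assume "s \<in> k ` closed_segment u v"
      then obtain w where w: "w \<in> closed_segment u v" "s = k w" by blast
      have "dist w u < d" using segment_bound(1)[OF w(1)] uv(3) by (simp add: dist_norm abs_minus_commute)
      moreover have wS: "w \<in> S" using w seg by blast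
      ultimately show "\<exists>m. poly (Q u) m = 0 \<and> dist s m < \<eta>"
        using d(2)[OF subsetD[OF S(1) wS] uab _ k(2)[OF wS]] w(2) by blast
    qed auto
    then show ?thesis using \<eta>e fam uab by (simp add: monic_family_def)
  qed
  then show "\<exists>d>0. \<forall>x\<in>S. \<forall>x'\<in>S. dist x' x < d \<longrightarrow> dist (k x') (k x) < e"
    using d(1) by blast
qed

text \<open>\<open>S\<close> is an initial interval that may lack its supremum. Uniform continuity
  extends the root to the supremum, and a lift starting from the value there covers the
  rest.\<close>

lemma continuous_root_extension:
  fixes Q :: "real \<Rightarrow> complex poly"
  assumes fam: "monic_family {0..1} n Q" and S: "S \<subseteq> {0..1}" "0 \<in> S" "\<And>u. u \<in> S \<Longrightarrow> {0..u} \<subseteq> S"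
    and k: "\<And>u. u \<in> S \<Longrightarrow> continuous_on {0..u} k" "\<And>t. t \<in> S \<Longrightarrow> poly (Q t) (k t) = 0"
  obtains k' where "continuous_on {0..1} k'" "\<And>t. t \<in> S \<Longrightarrow> k' t = k t"
    "\<And>t. t \<in> {0..1} \<Longrightarrow> poly (Q t) (k' t) = 0"
proof -
  define s where "s = Sup S"
  have bdd: "bdd_above S" using S(1) by (meson bdd_above_Icc bdd_above_mono)
  have Ss: "u \<le> s" if "u \<in> S" for u unfolding s_def using that bdd by (rule cSup_upper)
  have s01: "s \<in> {0..1}" using Ss[OF S(2)] cSup_least[of S 1] S unfolding s_def by fastforce
  have Slt: "u \<in> S" if "0 \<le> u" "u < s" for u
  proof -
    obtain v where "v \<in> S" "u < v" using less_cSupD[of S u] \<open>u < s\<close> S(2) unfolding s_def by blast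
    then show ?thesis using S(3)[of v] that by auto
  qed
  have "continuous_on S k"
    unfolding continuous_on_eq_continuous_within
  proof
    fix u assume u: "u \<in> S"
    show "continuous (at u within S) k"
    \<comment> \<open>Continuity on \<open>{0..u}\<close> is only one-sided at \<open>u\<close>.
      Below \<open>s\<close> a larger \<open>v\<close> in \<open>S\<close> supplies the other side;
      at \<open>s\<close> nothing of \<open>S\<close> lies to the right.\<close>
    proof (cases "u = s")
      case True
      then have "S \<subseteq> {0..u}" using Ss S(1) by auto
      then show ?thesis using k(1)[OF u] u continuous_on_subset continuous_on_eq_continuous_within by metis
    next
      case False
      then have us: "u < s" using Ss[OF u] by simp
      then obtain v where v: "u < v" "v < s" using dense by blast
      have vS: "v \<in> S" using Slt v S(1) u by fastforce
      have "continuous (at u within {0..v}) k"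
        using k(1)[OF vS] u v S(1) by (auto simp: continuous_on_eq_continuous_within)
      then have "continuous (at u within S \<inter> {..<v}) k"
        by (rule continuous_within_subset) (use S(1) in auto)
      moreover have "at u within S \<inter> {..<v} = at u within S"
        using v by (intro at_within_nhd[of u "{..<v}"]) auto
      ultimately show ?thesis by simp
    qed
  qed
  moreover have "{u..v} \<subseteq> S" if "u \<in> S" "v \<in> S" for u v
  proof -
    have "{u..v} \<subseteq> {0..v}" using that S(1) by auto
    then show ?thesis using S(3)[OF that(2)] by blast
  qed
  ultimately have "uniformly_continuous_on S k"
    using k(2) by (intro continuous_root_uniformly_continuous[OF fam S(1)])
  then obtain g where g: "uniformly_continuous_on (closure S) g" "\<And>x. x \<in> S \<Longrightarrow> k x = g x"
    using uniformly_continuous_on_extension_on_closure by metis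
  have cl: "closure S \<subseteq> {0..1}" using S(1) by (intro closure_minimal) auto
  have groot: "poly (Q x) (g x) = 0" if "x \<in> closure S" for x
  proof (rule continuous_constant_on_closure[OF _ _ that])
    show "continuous_on (closure S) (\<lambda>x. poly (Q x) (g x))"
      using g(1) by (intro monic_family_continuous_poly[OF monic_family_subset[OF fam cl]] uniformly_continuous_imp_continuous)
  qed (use g(2) k(2) in metis)
  have sc: "s \<in> closure S" unfolding s_def using S(2) bdd by (intro closure_contains_Sup) auto
  have sub: "{0..s} \<subseteq> closure S"
    using Slt sc closure_subset[of S] by (force simp: order.order_iff_strict)
  obtain h where h: "continuous_on {s..1} h" "h s = g s" "\<And>t. t \<in> {s..1} \<Longrightarrow> poly (Q t) (h t) = 0"
    using root_path_lifting[OF monic_family_subset[OF fam], of s 1 "g s"] groot[OF sc] s01 by auto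
  define k' where "k' t = (if t \<le> s then g t else h t)" for t
  have "continuous_on ({0..s} \<union> {s..1}) (\<lambda>t. if t \<le> s then g t else h t)"
    using continuous_on_subset[OF uniformly_continuous_imp_continuous[OF g(1)] sub] h
    by (intro continuous_on_If) auto
  moreover have "{0..s} \<union> {s..1} = {0..1}" using s01 by auto
  ultimately have "continuous_on {0..1} k'" unfolding k'_def[abs_def] by simp
  moreover have "k' t = k t" if "t \<in> S" for t using that g(2) Ss by (simp add: k'_def)
  moreover have "poly (Q t) (k' t) = 0" if "t \<in> {0..1}" for t
    using that groot sub h(3) by (auto simp: k'_def)
  ultimately show thesis using that by blast
qed

section \<open>Continuous roots on spaces without simple closed curves\<close>

text \<open>Partial roots are kept as graphs, so that the union of a chain is an upper bound.
  Membership of a point brings along its whole segment from \<open>x0\<close>, and continuity is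
  demanded only along such segments; continuity on \<open>M\<close> is derived afterwards for the
  maximal graph.\<close>

lemma root_on_path_connected:
  fixes M :: "'a::{complete_space,real_normed_vector} set"
  assumes M: "compact M" "locally path_connected M" "path_connected M" "\<not> has_loop M"
    and fam: "monic_family M n P" and l: "x0 \<in> M" "poly (P x0) l = 0"
  obtains h where "continuous_on M h" "\<And>x. x \<in> M \<Longrightarrow> poly (P x) (h x) = 0"
proof -
  define good where "good G \<longleftrightarrow> (x0, l) \<in> G \<and> (\<forall>x a b. (x, a) \<in> G \<longrightarrow> (x, b) \<in> G \<longrightarrow> a = b) \<and>
    (\<forall>x a. (x, a) \<in> G \<longrightarrow> x \<in> M \<and> poly (P x) a = 0 \<and>
      (\<exists>A k. is_segment M x0 x A \<and> continuous_on A k \<and> (\<forall>y\<in>A. (y, k y) \<in> G)))" for G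
  have "good {(x0, l)}"
    using l unfolding good_def
    by (auto intro!: exI[of _ "{x0}"] exI[of _ "\<lambda>x. l"] simp: is_segment_def)
  moreover have "good (\<Union>\<C>)" if ne: "\<C> \<noteq> {}" and chain: "subset.chain (Collect good) \<C>" for \<C>
  proof -
    have gd: "good G" if "G \<in> \<C>" for G using chain that by (auto simp: subset_chain_def)
    have tot: "G \<subseteq> H \<or> H \<subseteq> G" if "G \<in> \<C>" "H \<in> \<C>" for G H using chain that by (auto simp: subset_chain_def)
    have "(x0, l) \<in> \<Union>\<C>" using ne gd unfolding good_def by blast
    moreover have "a = b" if "(x, a) \<in> \<Union>\<C>" "(x, b) \<in> \<Union>\<C>" for x a b
    proof -
      obtain G H where GH: "G \<in> \<C>" "H \<in> \<C>" "(x, a) \<in> G" "(x, b) \<in> H" using \<open>(x, a) \<in> \<Union>\<C>\<close> \<open>(x, b) \<in> \<Union>\<C>\<close> by blast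
      then have "(x, a) \<in> H \<or> (x, b) \<in> G" using tot[OF GH(1,2)] by blast
      then show ?thesis using gd[OF GH(1)] gd[OF GH(2)] GH unfolding good_def by metis
    qed
    moreover have "x \<in> M \<and> poly (P x) a = 0 \<and>
      (\<exists>A k. is_segment M x0 x A \<and> continuous_on A k \<and> (\<forall>y\<in>A. (y, k y) \<in> \<Union>\<C>))" if xa: "(x, a) \<in> \<Union>\<C>" for x a
    proof -
      obtain G where G: "G \<in> \<C>" "(x, a) \<in> G" using xa by blast
      then have "x \<in> M \<and> poly (P x) a = 0 \<and>
        (\<exists>A k. is_segment M x0 x A \<and> continuous_on A k \<and> (\<forall>y\<in>A. (y, k y) \<in> G))"
        using gd[OF G(1)] unfolding good_def by metis
      then show ?thesis using G(1) by blast
    qed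
    ultimately show ?thesis unfolding good_def by blast
  qed
  ultimately obtain G where G: "good G" and max: "\<And>H. good H \<Longrightarrow> G \<subseteq> H \<Longrightarrow> H = G"
    using subset_Zorn_nonempty[of "Collect good"] by (metis empty_iff mem_Collect_eq)
  define val where "val x = (SOME a. (x, a) \<in> G)" for x
  have val: "(x, val x) \<in> G" if "x \<in> Domain G" for x
    unfolding val_def using that by (metis DomainE someI_ex)
  have val_eq: "val x = a" if "(x, a) \<in> G" for x a
    using val[of x] that G unfolding good_def by blast
  have seg: "\<exists>A. is_segment M x0 x A \<and> A \<subseteq> Domain G \<and> continuous_on A val" if x: "x \<in> Domain G" for x
  proof -
    obtain A k where A: "is_segment M x0 x A" "continuous_on A k" "\<forall>y\<in>A. (y, k y) \<in> G"
      using val[OF x] G unfolding good_def by blast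
    have "continuous_on A val"
      using A(2) by (rule continuous_on_eq) (use A(3) val_eq in metis)
    then show ?thesis using A by blast
  qed
  have root: "x \<in> M" "poly (P x) (val x) = 0" if "x \<in> Domain G" for x
    using val[OF that] G unfolding good_def by blast+
  have x0G: "x0 \<in> Domain G" using G unfolding good_def by blast
  have all: "z \<in> Domain G" if z: "z \<in> M" for z
  proof (rule ccontr)
    assume nz: "z \<notin> Domain G"
    obtain p where p: "path p" "path_image p \<subseteq> M" "pathstart p = x0" "pathfinish p = z"
      using M(3) l(1) z unfolding path_connected_def by blast
    have "x0 \<noteq> z" using x0G nz by blast
    then obtain g where g: "arc g" "pathstart g = x0" "pathfinish g = z" "path_image g \<subseteq> M"
      using path_contains_arc[OF p(1) p(3) p(4)] p(2) by (metis subset_trans)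
    have cg: "continuous_on {0..1} g" using g(1) by (simp add: arc_def path_def)
    have gM: "g ` {0..1} \<subseteq> M" using g(4) by (simp add: path_image_def)
    \<comment> \<open>Uniqueness of segments makes \<open>S\<close> an initial interval on which the
      root is already prescribed. It is not known to be closed, hence the use of
      \<open>continuous_root_extension\<close>.\<close>
    define S where "S = {u \<in> {0..1}. g u \<in> Domain G}"
    have S0: "0 \<in> S" using g(2) x0G by (auto simp: S_def pathstart_def)
    have initial: "g ` {0..u} \<subseteq> Domain G \<and> continuous_on (g ` {0..u}) val" if u: "u \<in> S" for u
    proof -
      obtain A where A: "is_segment M x0 (g u) A" "A \<subseteq> Domain G" "continuous_on A val"
        using seg[of "g u"] u unfolding S_def by blast
      have "is_segment M x0 (g u) (g ` {0..u})"
        using is_segment_subpath[OF g(1,4), of u] u g(2) by (auto simp: S_def)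
      then have "A = g ` {0..u}" using is_segment_unique[OF M(4) A(1)] by blast
      then show ?thesis using A by simp
    qed
    obtain k where k: "continuous_on {0..1} k" "\<And>t. t \<in> S \<Longrightarrow> k t = val (g t)"
      "\<And>t. t \<in> {0..1} \<Longrightarrow> poly (P (g t)) (k t) = 0"
    proof (rule continuous_root_extension[of n "\<lambda>t. P (g t)" S "\<lambda>t. val (g t)"])
      show "monic_family {0..1} n (\<lambda>t. P (g t))" by (rule monic_family_compose[OF fam cg gM])
      show "S \<subseteq> {0..1}" by (auto simp: S_def)
      show "{0..u} \<subseteq> S" if "u \<in> S" for u
        using initial[OF that] that unfolding S_def by auto
      show "continuous_on {0..u} (\<lambda>t. val (g t))" if "u \<in> S" for u
      proof (rule continuous_on_compose2[of "g ` {0..u}" val "{0..u}" g])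
        show "continuous_on (g ` {0..u}) val" using initial[OF that] by blast
        show "continuous_on {0..u} g" using that by (intro continuous_on_subset[OF cg]) (auto simp: S_def)
      qed simp
      show "poly (P (g t)) (val (g t)) = 0" if "t \<in> S" for t using that root by (auto simp: S_def)
    qed (use S0 in auto)
    obtain j where j: "homeomorphism {0..1} (path_image g) g j" using homeomorphism_arc[OF g(1)] by blast
    have jg: "j (g t) = t" if "t \<in> {0..1}" for t using j that by (auto simp: homeomorphism_def)
    \<comment> \<open>The whole arc is added at once: the segment from \<open>x0\<close> to a new
      point is an initial piece of \<open>g\<close>, and on the old points of the arc
      \<open>k\<close> agrees with \<open>G\<close>.\<close>
    define H where "H = G \<union> (\<lambda>t. (g t, k t)) ` {0..1}"
    have clash: "a = k t" if "(g t, a) \<in> G" "t \<in> {0..1}" for a t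
      using k(2)[of t] that val_eq[of "g t" a] by (auto simp: S_def Domain.DomainI)
    have "good H"
      unfolding good_def
    proof (intro conjI allI impI)
      show "(x0, l) \<in> H" using G by (simp add: good_def H_def)
      show "a = b" if "(x, a) \<in> H" "(x, b) \<in> H" for x a b
      proof -
        have "(x, c) \<in> G \<or> x \<in> path_image g \<and> c = k (j x)" if "(x, c) \<in> H" for c
          using that unfolding H_def path_image_def by (auto simp: jg)
        moreover have "c = k (j x)" if "(x, c) \<in> G" "x \<in> path_image g" for c
          using that clash jg by (auto simp: path_image_def)
        moreover have "a = b" if "(x, a) \<in> G" "(x, b) \<in> G" using that G unfolding good_def by blast
        ultimately show ?thesis using that by metis
      qed
      fix x a assume xa: "(x, a) \<in> H"
      show "x \<in> M" "poly (P x) a = 0" using xa root val_eq k(3) gM by (auto simp: H_def)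
      show "\<exists>A k. is_segment M x0 x A \<and> continuous_on A k \<and> (\<forall>y\<in>A. (y, k y) \<in> H)"
      proof (cases "(x, a) \<in> G")
        case True
        then have "\<exists>A k. is_segment M x0 x A \<and> continuous_on A k \<and> (\<forall>y\<in>A. (y, k y) \<in> G)"
          using G unfolding good_def by blast
        then show ?thesis unfolding H_def by blast
      next
        case False
        then obtain t where t: "t \<in> {0..1}" "x = g t" using xa by (auto simp: H_def)
        have "is_segment M x0 x (g ` {0..t})"
          using is_segment_subpath[OF g(1,4) t(1)] g(2) t(2) by simp
        moreover have "continuous_on (g ` {0..t}) (\<lambda>y. k (j y))"
        proof (rule continuous_on_compose2[OF k(1)])
          show "continuous_on (g ` {0..t}) j"
          proof (rule continuous_on_subset[OF homeomorphism_cont2[OF j]])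
            show "g ` {0..t} \<subseteq> path_image g" using t(1) unfolding path_image_def by (intro image_mono) auto
          qed
          show "j ` g ` {0..t} \<subseteq> {0..1}"
          proof
            fix v assume "v \<in> j ` g ` {0..t}"
            then obtain w where w: "w \<in> {0..t}" "v = j (g w)" by blast
            then have "w \<in> {0..1}" using t(1) by auto
            then show "v \<in> {0..1}" using jg w by metis
          qed
        qed
        moreover have "(y, k (j y)) \<in> H" if "y \<in> g ` {0..t}" for y
        proof -
          obtain w where w: "w \<in> {0..t}" "y = g w" using \<open>y \<in> g ` {0..t}\<close> by blast
          then have w1: "w \<in> {0..1}" using t(1) by auto
          then show ?thesis unfolding H_def w(2) jg[OF w1] by blast
        qed
        ultimately show ?thesis by blast
      qed
    qed
    then have "H = G" using max by (simp add: H_def)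
    moreover have "(z, k 1) \<in> H" using g(3) by (auto simp: H_def pathfinish_def)
    ultimately show False using nz by blast
  qed
  have "continuous_on M val"
    unfolding continuous_on_iff
  proof (intro ballI allI impI)
    fix x and e :: real assume x: "x \<in> M" and e: "e > 0"
    obtain \<eta> where \<eta>: "\<eta> > 0" and \<eta>e: "3 * real n * \<eta> < e"
      using small_radius[OF e] by blast
    obtain d where d: "d > 0" "\<And>x y l. x \<in> M \<Longrightarrow> y \<in> M \<Longrightarrow> dist x y < d \<Longrightarrow> poly (P x) l = 0 \<Longrightarrow>
      \<exists>m. poly (P y) m = 0 \<and> dist l m < \<eta>"
      using roots_uniformly_close[OF M(1) fam \<eta>] by metis
    have "openin (top_of_set M) (M \<inter> ball x d)" "x \<in> M \<inter> ball x d" using x d(1) by auto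
    then obtain U where U: "openin (top_of_set M) U" "path_connected U" "x \<in> U" "U \<subseteq> M \<inter> ball x d"
      using M(2) unfolding locally_path_connected by metis
    have close: "dist (val y) (val x) < e" if y: "y \<in> U" for y
    proof -
      have yM: "y \<in> M" using y U by blast
      obtain p where p: "path p" "path_image p \<subseteq> U" "pathstart p = x" "pathfinish p = y"
        using U(2,3) y unfolding path_connected_def by blast
      have pM: "path_image p \<subseteq> M" using p(2) U(4) by blast
      obtain C where C: "is_segment M x y C" "C \<subseteq> path_image p"
        using path_contains_segment[OF p(1) pM] p(3,4) by metis
      obtain A B where A: "is_segment M x0 x A" "continuous_on A val" and B: "is_segment M x0 y B" "continuous_on B val"
        using seg[OF all[OF x]] seg[OF all[OF yM]] by blast
      \<comment> \<open>\<open>val\<close> is continuous on the closed segments \<open>A\<close> and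
        \<open>B\<close> from the base point, hence on their union, which contains the small segment
        \<open>C\<close>.\<close>
      have "continuous_on (A \<union> B) val"
        using is_segment_facts(4)[OF A(1)] is_segment_facts(4)[OF B(1)]
        by (intro continuous_on_closed_Un compact_imp_closed A B)
      then have cont: "continuous_on C val"
        using is_segment_triangle[OF M(4) A(1) B(1) C(1)] by (rule continuous_on_subset)
      have "dist (val y) (val x) \<le> 3 * real (Polynomial.degree (P x)) * \<eta>"
      proof (rule connected_near_roots_diameter[of "val ` C"])
        show "connected (val ` C)" by (rule connected_continuous_image[OF cont is_segment_facts(5)[OF C(1)]])
        show "Polynomial.lead_coeff (P x) = 1" using fam x unfolding monic_family_def by blast
        show "val y \<in> val ` C" "val x \<in> val ` C" using is_segment_facts(2,3)[OF C(1)] by auto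
        fix s assume "s \<in> val ` C"
        then obtain c where c: "c \<in> C" "s = val c" by blast
        then have "c \<in> M" "c \<in> ball x d" using C(2) p(2) U(4) by blast+
        then have "c \<in> M" "dist c x < d" by (simp_all add: dist_commute)
        then show "\<exists>m. poly (P x) m = 0 \<and> dist s m < \<eta>"
          using d(2)[OF _ x, of c s] c(2) root(2)[OF all] by blast
      qed
      moreover have "Polynomial.degree (P x) = n" using fam x unfolding monic_family_def by blast
      ultimately show ?thesis using \<eta>e by simp
    qed
    obtain r where "r > 0" "ball x r \<inter> M \<subseteq> U" using U(1,3) unfolding openin_contains_ball by blast
    then show "\<exists>d>0. \<forall>x'\<in>M. dist x' x < d \<longrightarrow> dist (val x') (val x) < e"
      using close by (intro exI[of _ r]) (auto simp: dist_commute subset_iff)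
  qed
  then show thesis using that root(2)[OF all] by blast
qed

text \<open>Path components of a locally path connected set are open in it, so continuous roots
  found on each of them separately fit together.\<close>

theorem root_on_no_loop:
  fixes M :: "'a::{complete_space,real_normed_vector} set"
  assumes M: "compact M" "locally path_connected M" "\<not> has_loop M"
    and fam: "monic_family M n P" and n: "n > 0"
  obtains h where "continuous_on M h" "\<And>x. x \<in> M \<Longrightarrow> poly (P x) (h x) = 0"
proof -
  define K where "K x = path_component_set M x" for x
  have xK: "x \<in> K x" if "x \<in> M" for x using that by (simp add: K_def path_component_refl)
  have Keq: "K y = K x" if "y \<in> K x" for x y using that path_component_eq by (auto simp: K_def)
  have KM: "K x \<subseteq> M" for x by (simp add: K_def path_component_subset)
  have "\<exists>h. continuous_on (K x) h \<and> (\<forall>y\<in>K x. poly (P y) (h y) = 0)" if x: "x \<in> M" for x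
  proof -
    have "Polynomial.degree (P x) = n" using fam x by (simp add: monic_family_def)
    then have "\<not> constant (poly (P x))" using n by (simp add: constant_degree)
    from Fundamental_Theorem_Algebra.fundamental_theorem_of_algebra[OF this] obtain l where l: "poly (P x) l = 0" by (elim exE)
    have "compact (K x)"
      using closedin_path_component_locally_path_connected[OF M(2)] M(1) unfolding K_def
      by (metis closedin_compact)
    moreover have "locally path_connected (K x)"
      using locally_open_subset[OF M(2)] openin_path_component_locally_path_connected[OF M(2)] unfolding K_def by blast
    moreover have "path_connected (K x)" by (simp add: K_def path_connected_path_component)
    moreover have "\<not> has_loop (K x)" using M(3) KM unfolding has_loop_def by (metis subset_trans)
    ultimately show ?thesis
      using root_on_path_connected[OF _ _ _ _ monic_family_subset[OF fam KM] xK[OF x] l] by metis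
  qed
  then obtain f where f: "\<And>x. x \<in> M \<Longrightarrow> continuous_on (K x) (f x)" "\<And>x y. x \<in> M \<Longrightarrow> y \<in> K x \<Longrightarrow> poly (P y) (f x y) = 0"
    by metis
  \<comment> \<open>The choice depends only on the set \<open>K x\<close>, so all points of one
    component share the same representative and the same root function.\<close>
  define b where "b x = (SOME y. y \<in> K x)" for x
  have b: "b x \<in> K x" if "x \<in> M" for x unfolding b_def using xK[OF that] by (rule someI)
  have bM: "b x \<in> M" if "x \<in> M" for x using b KM that by blast
  define h where "h x = f (b x) x" for x
  have h: "h y = f (b x) y" if "y \<in> K x" for x y unfolding h_def b_def Keq[OF that] ..
  have "continuous_on M h"
    unfolding continuous_on_eq_continuous_within
  proof
    fix x assume x: "x \<in> M"
    have Kb: "K (b x) = K x" using Keq[OF b[OF x]] .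
    have "continuous_on (K x) h"
      using f(1)[OF bM[OF x]] unfolding Kb by (rule continuous_on_eq) (simp add: h)
    then have "continuous (at x within K x) h" using xK[OF x] by (simp add: continuous_on_eq_continuous_within)
    moreover have "at x within K x = at x within M"
    proof -
      obtain T where T: "open T" "K x = M \<inter> T"
        using openin_path_component_locally_path_connected[OF M(2)] unfolding K_def openin_open by metis
      then show ?thesis using xK[OF x] by (intro at_within_nhd[of x T]) auto
    qed
    ultimately show "continuous (at x within M) h" by simp
  qed
  moreover have "poly (P x) (h x) = 0" if x: "x \<in> M" for x
    using f(2)[OF bM[OF x]] Keq[OF b[OF x]] xK[OF x] by (simp add: h_def)
  ultimately show thesis using that by blast
qed

lemma has_loop_image:
  assumes "has_loop S" "continuous_on S f" "inj_on f S"
  shows "has_loop (f ` S)"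
proof -
  obtain g where g: "simple_path g" "pathfinish g = pathstart g" "path_image g \<subseteq> S"
    using assms(1) unfolding has_loop_def by blast
  have "path (f \<circ> g)"
    using g by (intro path_continuous_image continuous_on_subset[OF assms(2)]) (auto dest: simple_path_imp_path)
  moreover have "loop_free (f \<circ> g)"
    unfolding loop_free_def
  proof (intro ballI impI)
    fix x y :: real assume xy: "x \<in> {0..1}" "y \<in> {0..1}" "(f \<circ> g) x = (f \<circ> g) y"
    then have "g x \<in> S" "g y \<in> S" using g(3) by (auto simp: path_image_def)
    then have "g x = g y" using assms(3) xy(3) by (auto dest: inj_onD)
    then show "x = y \<or> x = 0 \<and> y = 1 \<or> x = 1 \<and> y = 0"
      using g(1) xy unfolding simple_path_def loop_free_def by blast
  qed
  moreover have "path_image (f \<circ> g) \<subseteq> f ` S" using g(3) by (auto simp: path_image_compose)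
  moreover have "pathfinish (f \<circ> g) = pathstart (f \<circ> g)" using g(2) by (simp add: pathfinish_compose pathstart_compose)
  ultimately show ?thesis unfolding has_loop_def simple_path_def by blast
qed

theorem continuous_root_if_no_loop:
  fixes M :: "'a::metric_space set"
  assumes M: "compact M" "locally connected M" "\<not> has_loop M"
    and fam: "monic_family M n P" and n: "n > 0"
  obtains h where "continuous_on M h" "\<And>x. x \<in> M \<Longrightarrow> poly (P x) (h x) = 0"
proof -
  obtain k :: "'a \<Rightarrow> 'a \<Rightarrow>\<^sub>C real" where k: "\<And>x y. dist (k x) (k y) = dist x y"
    using isometric_embedding by blast
  have inj: "inj k" by (rule injI) (metis k dist_eq_0_iff)
  define j where "j = inv_into UNIV k"
  have jk: "j (k x) = x" for x unfolding j_def using inj by (rule inv_into_f_f) simp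
  have ck: "continuous_on S k" for S
    unfolding continuous_on_iff k by blast
  have cj: "continuous_on (k ` M) j"
    unfolding continuous_on_iff by (auto simp: jk k)
  have hom: "homeomorphism M (k ` M) k j"
    using ck cj by (auto simp: homeomorphism_def jk image_image)
  have jM: "j ` k ` M = M" by (auto simp: jk image_image)
  have "compact (k ` M)" using M(1) ck by (rule compact_continuous_image[rotated])
  moreover have "locally path_connected (k ` M)"
  proof (rule locally_connected_compact_imp_locally_path_connected)
    show "compact (k ` M)" by fact
    show "locally connected (k ` M)"
      using homeomorphism_locally[OF hom, of connected connected] homeomorphic_connectedness M(2)
      by (metis homeomorphic_def)
  qed
  moreover have "\<not> has_loop (k ` M)"
    using has_loop_image[of "k ` M" j] cj M(3) unfolding jM by (auto simp: inj_on_def jk)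
  moreover have "monic_family (k ` M) n (\<lambda>y. P (j y))"
    using jM by (intro monic_family_compose[OF fam cj]) auto
  ultimately obtain h where h: "continuous_on (k ` M) h" "\<And>y. y \<in> k ` M \<Longrightarrow> poly (P (j y)) (h y) = 0"
    using root_on_no_loop[OF _ _ _ _ n] by metis
  have "continuous_on M (\<lambda>x. h (k x))" by (rule continuous_on_compose2[OF h(1) ck]) auto
  moreover have "poly (P x) (h (k x)) = 0" if "x \<in> M" for x using h(2)[of "k x"] that by (simp add: jk)
  ultimately show thesis using that by blast
qed

section \<open>Branches of roots over the circle\<close>

lemma cis_divide_power: "n > 0 \<Longrightarrow> cis (t / real n) ^ n = cis t"
  by (simp add: Complex.DeMoivre)

text \<open>Dividing \<open>k s\<close> by \<open>cis (s / n)\<close> gives a continuous function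
  with values in the finite set of n-th roots of unity, hence a constant.\<close>

lemma power_branch:
  assumes n: "n > 0" and k: "continuous_on {a..b} k" "\<And>s. s \<in> {a..b} \<Longrightarrow> k s ^ n = cis s" and s: "s \<in> {a..b}"
  shows "k s = k a * cis ((s - a) / n)"
proof -
  define r where "r s = k s * cis (- s / n)" for s
  have "r s ^ n = 1" if "s \<in> {a..b}" for s
  proof -
    have "cis (- s / n) ^ n = cis (- s)" using n by (simp add: Complex.DeMoivre)
    then show ?thesis using k(2)[OF that] by (simp add: r_def power_mult_distrib cis_mult)
  qed
  then have "r ` {a..b} \<subseteq> {z. z ^ n = 1}" by blast
  then have "finite (r ` {a..b})" by (rule finite_subset) (rule finite_nth_roots[OF n])
  moreover have "continuous_on {a..b} r" unfolding r_def using k(1) n by (intro continuous_intros) auto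
  ultimately have "r constant_on {a..b}" by (intro continuous_finite_range_constant) auto
  then have "r s = r a" using s unfolding constant_on_def by auto
  then have "k s * cis (- s / n) * cis (s / n) = k a * cis (- a / n) * cis (s / n)" by (simp add: r_def)
  then show ?thesis by (simp add: mult.assoc cis_mult diff_divide_distrib)
qed

text \<open>A common square and cube root of the nonzero number \<open>cis s\<close> must be 1,
  which forces \<open>cis s = 1\<close>. In the open interval the two alternatives are therefore
  disjoint closed sets, one of them is empty, and the surviving equation passes to the ends by
  closure.\<close>

lemma edge_branch:
  assumes ab: "a < b" and k: "continuous_on {a..b} k"
    and root: "\<And>s. s \<in> {a..b} \<Longrightarrow> k s ^ 2 = cis s \<or> k s ^ 3 = cis s"
    and ne: "\<And>s. s \<in> {a<..<b} \<Longrightarrow> cis s \<noteq> 1"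
  shows "\<exists>n\<in>{2,3}. \<forall>s\<in>{a..b}. k s ^ n = cis s"
proof -
  have ki: "continuous_on {a<..<b} k" using k by (rule continuous_on_subset) auto
  define F where "F n = {s \<in> {a<..<b}. k s ^ n - cis s = 0}" for n
  have cl: "closedin (top_of_set {a<..<b}) (F n)" for n
    unfolding F_def by (intro continuous_closedin_preimage_constant continuous_intros ki)
  have "F 2 \<inter> F 3 = {}"
  proof (rule ccontr)
    assume "F 2 \<inter> F 3 \<noteq> {}"
    then obtain s where s: "s \<in> {a<..<b}" "k s ^ 2 = cis s" "k s ^ 3 = cis s" by (auto simp: F_def)
    have "k s * k s ^ 2 = k s ^ 2" using s by (simp add: power2_eq_square power3_eq_cube)
    then have "k s = 1" using s(2) by auto
    then show False using ne[OF s(1)] s(2) by simp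
  qed
  moreover have "s \<in> F 2 \<union> F 3" if "s \<in> {a<..<b}" for s
    using root[of s] that by (auto simp: F_def)
  then have "{a<..<b} \<subseteq> F 2 \<union> F 3" by blast
  moreover have "F 2 \<union> F 3 \<subseteq> {a<..<b}" by (auto simp: F_def)
  ultimately have "F 2 \<inter> F 3 = {} \<and> F 2 \<union> F 3 = {a<..<b}" by blast
  moreover from this have "F 2 = {} \<or> F 3 = {}"
    using connected_Ioo[of a b] cl[of 2] cl[of 3] unfolding connected_closedin_eq by blast
  ultimately have "F 2 = {a<..<b} \<or> F 3 = {a<..<b}" by auto
  then obtain n where n: "n \<in> {2, 3}" "F n = {a<..<b}" by blast
  have "k s ^ n - cis s = 0" if s: "s \<in> {a..b}" for s
  proof (rule continuous_constant_on_closure[of "{a<..<b}" "\<lambda>s. k s ^ n - cis s"])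
    show "continuous_on (closure {a<..<b}) (\<lambda>s. k s ^ n - cis s)"
      using ab k by (intro continuous_intros) auto
    show "k s ^ n - cis s = 0" if "s \<in> {a<..<b}" for s using that n(2) unfolding F_def by blast
    show "s \<in> closure {a<..<b}" using ab s by simp
  qed
  then show ?thesis using n(1) by auto
qed

text \<open>The square roots and the cube roots of \<open>cis s\<close> have a common value only for
  \<open>s \<in> 2\<pi>\<int>\<close>, and there the common value is \<open>1\<close>.\<close>

lemma branch_transition:
  assumes k: "continuous_on {pi..3 * pi} k"
    and root: "\<And>s. s \<in> {pi..3 * pi} \<Longrightarrow> k s ^ 2 = cis s \<or> k s ^ 3 = cis s"
  obtains m n where "m \<in> {2, 3}" "n \<in> {2, 3}" "k pi ^ m = -1" "k (3 * pi) ^ n = -1"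
    "k (3 * pi) = k pi * cis (pi / real m) * cis (pi / real n)"
proof -
  have c1: "cis s \<noteq> 1" if "s \<in> {pi<..<2 * pi}" for s
  proof
    assume "cis s = 1"
    then have "Im (cis s) = Im 1" by simp
    then have "sin s = 0" by simp
    then show False using sin_lt_zero[of s] that by auto
  qed
  have c2: "cis s \<noteq> 1" if "s \<in> {2 * pi<..<3 * pi}" for s
  proof
    assume "cis s = 1"
    then have "Im (cis s) = Im 1" by simp
    then have "sin s = 0" by simp
    then have "sin (s - 2 * pi) = 0" by (simp add: sin_diff)
    then show False using sin_gt_zero[of "s - 2 * pi"] that by auto
  qed
  have k1: "continuous_on {pi..2 * pi} k" using k by (rule continuous_on_subset) auto
  have k2: "continuous_on {2 * pi..3 * pi} k" using k by (rule continuous_on_subset) auto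
  obtain m where m: "m \<in> {2, 3}" "\<forall>s\<in>{pi..2 * pi}. k s ^ m = cis s"
    using edge_branch[OF _ k1 root c1] by auto
  obtain n where n: "n \<in> {2, 3}" "\<forall>s\<in>{2 * pi..3 * pi}. k s ^ n = cis s"
    using edge_branch[OF _ k2 root c2] by auto
  have "m > 0" "n > 0" using m(1) n(1) by auto
  have "k (2 * pi) = k pi * cis ((2 * pi - pi) / m)"
    using m by (intro power_branch[OF \<open>m > 0\<close> k1]) auto
  moreover have "k (3 * pi) = k (2 * pi) * cis ((3 * pi - 2 * pi) / n)"
    using n by (intro power_branch[OF \<open>n > 0\<close> k2]) auto
  moreover have "k pi ^ m = -1" using m(2) by simp
  moreover have "cis (3 * pi) = -1"
    using cis_mult[of pi "2 * pi"] by simp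
  then have "k (3 * pi) ^ n = -1" using n(2) by simp
  ultimately show thesis using that[OF m(1) n(1)] by simp
qed

lemma cis_pi_third: "cis (pi / 3) = Complex (1 / 2) (sqrt 3 / 2)"
  by (simp add: complex_eq_iff cos_60 sin_60)

text \<open>With \<open>E = cis (pi / 3)\<close>, a continuous root of \<open>(t\<^sup>2 - cis s) * (t\<^sup>3 - cis s)\<close> runs through the
  graph \<open>\<i> \<rightarrow> -\<i> \<rightarrow> \<i>\<close>, \<open>E \<rightarrow> -1 \<rightarrow> cnj E \<rightarrow> E\<close>, \<open>-\<i> \<rightarrow> E\<close>, \<open>cnj E \<rightarrow> \<i>\<close> as \<open>s\<close> runs through the odd
  multiples of \<open>pi\<close>. No vertex lies on closed walks of length 2 and of length 3.\<close>

definition turn :: "complex \<Rightarrow> complex \<Rightarrow> bool" where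
  "turn x y \<longleftrightarrow> x ^ 2 = -1 \<and> y = - x \<or> x = - \<i> \<and> y = cis (pi / 3) \<or> x = cis (- pi / 3) \<and> y = \<i> \<or>
     x ^ 3 = -1 \<and> y = x * cis (pi / 3) ^ 2"

text \<open>Each half turn multiplies by \<open>\<i>\<close> (square roots) or by \<open>E\<close>
  (cube roots). Keeping the kind gives the first and last clauses of \<open>turn\<close>; changing
  it is possible only through the value 1 at \<open>2 * pi\<close>, which determines both
  ends.\<close>

lemma turnI:
  assumes "continuous_on {pi..3 * pi} k" "\<And>s. s \<in> {pi..3 * pi} \<Longrightarrow> k s ^ 2 = cis s \<or> k s ^ 3 = cis s"
  shows "turn (k pi) (k (3 * pi))"
proof -
  define x y where "x = k pi" and "y = k (3 * pi)"
  obtain m n where mn: "m \<in> {2, 3}" "n \<in> {2, 3}" "x ^ m = -1" "y ^ n = -1"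
    and y: "y = x * cis (pi / real m) * cis (pi / real n)"
    using branch_transition[OF assms] unfolding x_def y_def by metis
  define E where "E = cis (pi / 3)"
  have E3: "E ^ 3 = -1" unfolding E_def by (simp add: Complex.DeMoivre)
  have EE: "E * cis (- pi / 3) = 1" unfolding E_def by (simp add: cis_mult)
  have unity: "w = 1" if "w ^ 2 = 1" "w ^ 3 = 1" for w :: complex
  proof -
    have "w ^ 3 = w * w ^ 2" by (simp add: power2_eq_square power3_eq_cube)
    then show ?thesis using that by simp
  qed
  consider "m = 2" "n = 2" | "m = 2" "n = 3" | "m = 3" "n = 2" | "m = 3" "n = 3" using mn by auto
  then have "turn x y"
  proof cases
    case 1
    then show ?thesis using mn y by (simp add: turn_def mult.assoc)
  next
    case 2
    then have y: "y = x * \<i> * E" using y by (simp add: E_def)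
    \<comment> \<open>\<open>x * \<i>\<close> is the value of \<open>k\<close> at
      \<open>2 * pi\<close>, where the two kinds of roots are exchanged.\<close>
    have "(x * \<i>) ^ 2 = 1" using mn 2 by (simp add: power_mult_distrib)
    moreover have "(x * \<i>) ^ 3 = 1" using mn(4) 2 E3 unfolding y by (simp add: power_mult_distrib)
    ultimately have "x * \<i> = 1" by (rule unity)
    then have "x = - \<i>" "y = E" using y by (simp_all add: complex_eq_iff)
    then show ?thesis by (simp add: turn_def E_def)
  next
    case 3
    then have y: "y = x * E * \<i>" using y by (simp add: E_def)
    have "(x * E) ^ 3 = 1" using mn 3 E3 by (simp add: power_mult_distrib)
    moreover have "(x * E) ^ 2 = 1" using mn(4) 3 unfolding y by (simp add: power_mult_distrib)
    ultimately have xE: "x * E = 1" by (metis unity)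
    then have "x = cis (- pi / 3)" using EE by (metis mult.left_commute mult.right_neutral mult.commute)
    then show ?thesis using xE y by (simp add: turn_def)
  next
    case 4
    then have "y = x * E ^ 2" using y by (simp add: E_def power2_eq_square mult.assoc)
    then show ?thesis using mn 4 by (simp add: turn_def E_def)
  qed
  then show ?thesis by (simp add: x_def y_def)
qed

text \<open>Every vertex with an outgoing edge is a square or a cube root of -1. At a square root
  the walk of length 3 is impossible, at a cube root the walk of length 2.\<close>

lemma turn_walks:
  assumes "turn x y" "turn y x" "turn x u" "turn u v" "turn v x"
  shows False
proof -
  define E where "E = cis (pi / 3)"
  define E' where "E' = cis (- pi / 3)"
  have E3: "E ^ 3 = -1" unfolding E_def by (simp add: Complex.DeMoivre)
  have E'3: "E' ^ 3 = -1" unfolding E'_def by (simp add: Complex.DeMoivre complex_eq_iff)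
  have E: "E = Complex (1 / 2) (sqrt 3 / 2)" by (simp add: E_def cis_pi_third)
  have E': "E' = Complex (1 / 2) (- sqrt 3 / 2)" unfolding E'_def
    by (simp add: complex_eq_iff cos_60 sin_60)
  have E2: "E ^ 2 = Complex (-1 / 2) (sqrt 3 / 2)"
    by (simp add: E power2_eq_square complex_eq_iff)
  have turnE: "a ^ 2 = -1 \<and> b = - a \<or> a = - \<i> \<and> b = E \<or> a = E' \<and> b = \<i> \<or> a ^ 3 = -1 \<and> b = a * E ^ 2"
    if "turn a b" for a b using that by (simp add: turn_def E_def E'_def)
  have E22: "E ^ 2 * E ^ 2 \<noteq> 1" unfolding E2 by (simp add: complex_eq_iff)
  have excl: "\<not> (a ^ 2 = -1 \<and> a ^ 3 = -1)" for a :: complex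
  proof
    assume a: "a ^ 2 = -1 \<and> a ^ 3 = -1"
    have "a ^ 3 = a * a ^ 2" by (simp add: power2_eq_square power3_eq_cube)
    then have "a = 1" using a by simp
    then show False using a by simp
  qed
  have cubeE: "(a * E ^ 2) ^ 3 = -1" if "a ^ 3 = -1" for a
  proof -
    have "(a * E ^ 2) ^ 3 = a ^ 3 * (E ^ 3) ^ 2" by (simp add: power_mult_distrib flip: power_mult)
    then show ?thesis using that E3 by simp
  qed
  have ii: "\<i> ^ 2 = -1" "(- \<i>) ^ 2 = -1" by simp_all
  have nz: "a \<noteq> - a" if "a ^ 2 = -1" for a :: complex using that by auto
  have EnE': "E \<noteq> E'" by (simp add: E E')
  have iE: "E \<noteq> \<i>" by (simp add: E complex_eq_iff)
  consider "x ^ 2 = -1" | "x ^ 3 = -1" using turnE[OF assms(1)] ii E'3 by auto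
  then show False
  proof cases
    case 1
    have last: "v ^ 2 = -1 \<and> x = - v \<or> v = E' \<and> x = \<i>"
      using turnE[OF assms(5)] 1 excl E3 cubeE by metis
    have first: "u = - x \<or> x = - \<i> \<and> u = E" using turnE[OF assms(3)] 1 excl E'3 by metis
    have "v = - u \<or> u = - \<i> \<and> v = E" if "u = - x"
      using turnE[OF assms(4)] that 1 excl E'3 by (metis power2_minus)
    moreover have "v = -1" if "u = E"
    proof -
      have "v = E * E ^ 2" using turnE[OF assms(4)] that excl[of E] EnE' E3 ii by metis
      also have "\<dots> = E ^ 3" by (simp add: power2_eq_square power3_eq_cube)
      finally show ?thesis using E3 by simp
    qed
    moreover have "x \<noteq> - x" using nz[OF 1] .
    moreover have "E' \<noteq> -1" by (simp add: E' complex_eq_iff)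
    moreover have "(-1) ^ 2 \<noteq> (-1 :: complex)" by simp
    ultimately show False
      using last first excl E3 E'3 1 EnE' by (metis minus_minus)
  next
    case 2
    have first: "x = E' \<and> y = \<i> \<or> y = x * E ^ 2" using turnE[OF assms(1)] 2 excl ii by metis
    have last: "y = - \<i> \<and> x = E \<or> y ^ 3 = -1 \<and> x = y * E ^ 2"
      using turnE[OF assms(2)] 2 excl ii by (metis power2_minus)
    have "y \<noteq> \<i>"
    proof
      assume y: "y = \<i>"
      moreover have "\<i> \<noteq> - \<i>" by (simp add: complex_eq_iff)
      ultimately have "\<i> ^ 3 = -1" using last by metis
      then show False using excl ii by blast
    qed
    then have y: "y = x * E ^ 2" using first by blast
    then have "y ^ 3 = -1" using cubeE 2 by blast
    then have "x = y * E ^ 2" using last excl ii by metis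
    then have "x * (E ^ 2 * E ^ 2) = x" using y by (simp add: mult.assoc)
    moreover have "x \<noteq> 0" using 2 by auto
    ultimately show False using E22 by simp
  qed
qed

text \<open>Following \<open>h\<close> along the double and the triple cover from (1, 1) until they
  return there gives closed walks of length 2 and 3 through the vertex
  \<open>h (1, 1)\<close>.\<close>

lemma no_rotated_root_on_circle:
  fixes h :: "complex \<times> complex \<Rightarrow> complex"
  defines "R \<equiv> {(z, w). norm z = 1 \<and> (w ^ 2 = z \<or> w ^ 3 = z)}"
  assumes h: "continuous_on R h" and root: "\<And>z w. (z, w) \<in> R \<Longrightarrow> h (z, w) ^ 2 = - z \<or> h (z, w) ^ 3 = - z"
  shows False
proof -
  \<comment> \<open>The shift by \<open>pi\<close> turns roots of \<open>- z\<close> into roots of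
    \<open>cis s\<close> and places the common point (1, 1) at \<open>s = pi\<close>.\<close>
  define k where "k n s = h (cis (s - pi), cis ((s - pi) / real n))" for n :: nat and s
  have R: "(cis (s - pi), cis ((s - pi) / real n)) \<in> R" if "n \<in> {2, 3}" for n s
    using that cis_divide_power[of n "s - pi"] by (auto simp: R_def)
  have cont: "continuous_on UNIV (k n)" if "n \<in> {2, 3}" for n
    unfolding k_def using R[OF that] that by (intro continuous_on_compose2[OF h] continuous_intros) auto
  have roots: "k n s ^ 2 = cis s \<or> k n s ^ 3 = cis s" if "n \<in> {2, 3}" for n s
  proof -
    have "- cis (s - pi) = cis s" by (simp add: complex_eq_iff cos_diff sin_diff)
    then show ?thesis using root[OF R[OF that]] unfolding k_def by metis
  qed
  have step: "turn (k n (pi + 2 * pi * real j)) (k n (pi + 2 * pi * real (Suc j)))" if "n \<in> {2, 3}" for n j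
  proof -
    have "cis (s + 2 * pi * real j) = cis s" for s
      using cis_mult[of s "2 * pi * real j"] cis_multiple_2pi[of "real j"] by (simp add: Ints_of_nat)
    then have "turn (k n (pi + 2 * pi * real j)) (k n (3 * pi + 2 * pi * real j))"
      using roots[OF that] 
      by (intro turnI[of "\<lambda>s. k n (s + 2 * pi * real j)"] continuous_on_compose2[OF cont[OF that]] continuous_intros)
        (auto, metis)
    moreover have "3 * pi + 2 * pi * real j = pi + 2 * pi * real (Suc j)" by (simp add: algebra_simps)
    ultimately show ?thesis by metis
  qed
  have start: "k n pi = h (1, 1)" for n by (simp add: k_def)
  have "k 2 (pi + 2 * pi * real 2) = h (1, 1)"
    using cis_multiple_2pi[of 2] by (simp add: k_def)
  moreover have "k 3 (pi + 2 * pi * real 3) = h (1, 1)"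
    using cis_multiple_2pi[of 3] by (simp add: k_def)
  ultimately show False
    using turn_walks[of "h (1, 1)"] step[of 2 0] step[of 2 1] step[of 3 0] step[of 3 1] step[of 3 2]
    by (simp add: start numeral_2_eq_2 numeral_3_eq_3)
qed

section \<open>Homomorphisms between algebras of continuous functions\<close>

lemma poly_at_Cons: "poly_at (f # p) y = poly_at p y + Polynomial.monom (f y) (length p)"
  unfolding poly_at_def by (simp add: Poly_snoc)

lemma poly_at_snoc: "poly_at (p @ [f]) y = pCons (f y) (poly_at p y)"
  unfolding poly_at_def by simp

lemma eval_cont_alg:
  assumes "set p \<subseteq> carrier (cont_alg Y)" "a \<in> carrier (cont_alg Y)"
  shows "ring.eval (cont_alg Y) p a \<in> carrier (cont_alg Y)"
    and "y \<in> Y \<Longrightarrow> ring.eval (cont_alg Y) p a y = poly (poly_at p y) (a y)"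
proof -
  interpret cring "cont_alg Y" by (rule cring_cont_alg)
  show "eval p a \<in> carrier (cont_alg Y)" by (rule eval_in_carrier[OF assms])
  assume y: "y \<in> Y"
  have pow: "(a [^]\<^bsub>cont_alg Y\<^esub> n) y = a y ^ n" for n :: nat
    using y by (induction n) simp_all
  show "eval p a y = poly (poly_at p y) (a y)"
  proof (induction p)
    case Nil
    then show ?case using y by (simp add: poly_at_def)
  next
    case (Cons f p)
    then show ?case using y pow by (simp add: poly_at_Cons poly_monom)
  qed
qed

text \<open>Over the empty space one equals zero, and a coefficient list may not start with zero;
  hence \<open>Y \<noteq> {}\<close>.\<close>

lemma monic_polyD:
  assumes "monic_poly (cont_alg Y) p"
  obtains p' where "p = (\<lambda>y\<in>Y. 1) # p'" "set p \<subseteq> carrier (cont_alg Y)" "Y \<noteq> {}"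
proof -
  obtain f p' where p: "p = f # p'" "f = \<one>\<^bsub>cont_alg Y\<^esub>"
    using assms unfolding monic_poly_def by (cases p) auto
  have "polynomial\<^bsub>cont_alg Y\<^esub> (carrier (cont_alg Y)) p"
    using assms unfolding monic_poly_def univ_poly_carrier by blast
  then have "set p \<subseteq> carrier (cont_alg Y)" "f \<noteq> \<zero>\<^bsub>cont_alg Y\<^esub>" unfolding polynomial_def p(1) by auto
  moreover from this have "Y \<noteq> {}" using p(2) by auto
  ultimately show thesis using that[of p'] p by simp
qed

lemma monic_polyI:
  assumes "set p' \<subseteq> carrier (cont_alg Y)" "Y \<noteq> {}"
  shows "monic_poly (cont_alg Y) ((\<lambda>y\<in>Y. 1) # p')"
proof -
  have "(\<lambda>y\<in>Y. 1) \<noteq> (\<lambda>y\<in>Y. 0 :: complex)"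
    using assms(2) by (auto simp: fun_eq_iff)
  then show ?thesis
    using assms(1) unfolding monic_poly_def univ_poly_carrier[symmetric] polynomial_def by auto
qed

lemma monic_family_poly_at:
  assumes "monic_poly (cont_alg Y) p"
  shows "monic_family Y (Polynomials.degree p) (poly_at p)"
proof -
  obtain p' where p: "p = (\<lambda>y\<in>Y. 1) # p'" "set p \<subseteq> carrier (cont_alg Y)"
    using monic_polyD[OF assms] by metis
  have "length p = Suc (length p')" by (simp add: p(1))
  have coeff: "Polynomial.coeff (poly_at p y) k = (if k < length p then (rev p ! k) y else 0)" for y k
    by (simp add: poly_at_def nth_default_def rev_map)
  have "Polynomial.degree (poly_at p y) = length p'" "Polynomial.lead_coeff (poly_at p y) = 1" if "y \<in> Y" for y
  proof -
    have one: "Polynomial.coeff (poly_at p y) (length p') = 1"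
      using that unfolding coeff by (simp add: p(1) nth_append)
    have "Polynomial.degree (poly_at p y) \<le> length p'"
      using \<open>length p = Suc (length p')\<close> by (intro degree_le) (simp add: coeff)
    then show "Polynomial.degree (poly_at p y) = length p'"
      using one le_degree[of "poly_at p y" "length p'"] by simp
    then show "Polynomial.lead_coeff (poly_at p y) = 1" using one by simp
  qed
  moreover have "continuous_on Y (\<lambda>y. Polynomial.coeff (poly_at p y) k)" for k
  proof (cases "k < length p")
    case True
    then have "rev p ! k \<in> set p" by (metis length_rev nth_mem set_rev)
    then have "continuous_on Y (rev p ! k)" using p(2) by auto
    then show ?thesis using True by (simp add: coeff)
  qed (simp add: coeff)
  ultimately show ?thesis unfolding monic_family_def by (simp add: p(1))
qed


lemma alg_homD:
  assumes "T \<in> alg_hom (cont_alg Y) (cont_alg Z)" "f \<in> carrier (cont_alg Y)"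
  shows "T f \<in> carrier (cont_alg Z)"
    and "g \<in> carrier (cont_alg Y) \<Longrightarrow> z \<in> Z \<Longrightarrow> T (\<lambda>y\<in>Y. f y * g y) z = T f z * T g z"
    and "g \<in> carrier (cont_alg Y) \<Longrightarrow> z \<in> Z \<Longrightarrow> T (\<lambda>y\<in>Y. f y + g y) z = T f z + T g z"
    and "z \<in> Z \<Longrightarrow> T (\<lambda>y\<in>Y. c * f y) z = c * T f z"
    and "z \<in> Z \<Longrightarrow> T (\<lambda>y\<in>Y. 1) z = 1"
proof -
  have T: "T \<in> ring_hom (cont_alg Y) (cont_alg Z)"
    "\<And>c f. f \<in> carrier (cont_alg Y) \<Longrightarrow> T (c \<odot>\<^bsub>cont_alg Y\<^esub> f) = c \<odot>\<^bsub>cont_alg Z\<^esub> T f"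
    using assms(1) unfolding alg_hom_def by blast+
  show "T f \<in> carrier (cont_alg Z)" by (rule ring_hom_closed[OF T(1) assms(2)])
  show "T (\<lambda>y\<in>Y. f y * g y) z = T f z * T g z" if "g \<in> carrier (cont_alg Y)" "z \<in> Z"
    using ring_hom_mult[OF T(1) assms(2) that(1)] that(2) by simp
  show "T (\<lambda>y\<in>Y. f y + g y) z = T f z + T g z" if "g \<in> carrier (cont_alg Y)" "z \<in> Z"
    using ring_hom_add[OF T(1) assms(2) that(1)] that(2) by simp
  show "T (\<lambda>y\<in>Y. c * f y) z = c * T f z" if "z \<in> Z"
    using T(2)[OF assms(2), of c] that by simp
  show "T (\<lambda>y\<in>Y. 1) z = 1" if "z \<in> Z"
    using ring_hom_one[OF T(1)] that by simp
qed

text \<open>Otherwise finitely many functions in the kernel of the character \<open>f \<mapsto> T f z\<close> have no common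
  zero, and the sum of their squared absolute values is an invertible element of the kernel.\<close>

lemma character_is_evaluation:
  fixes Y :: "'a::topological_space set"
  assumes Y: "compact Y" and T: "T \<in> alg_hom (cont_alg Y) (cont_alg Z)" and z: "z \<in> Z"
  shows "\<exists>y\<in>Y. \<forall>f\<in>carrier (cont_alg Y). T f z = f y"
proof (rule ccontr)
  assume neg: "\<not> ?thesis"
  define I where "I = {f \<in> carrier (cont_alg Y). T f z = 0}"
  note TD = alg_homD[OF T]
  have constC: "(\<lambda>y\<in>Y. c) \<in> carrier (cont_alg Y)" for c by simp
  have Tconst: "T (\<lambda>y\<in>Y. c) z = c" for c
    using TD(4)[OF constC[of 1] z, of c] TD(5)[OF constC[of 1] z] by (simp cong: restrict_cong)
  have "\<exists>f\<in>I. f y \<noteq> 0" if y: "y \<in> Y" for y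
  proof -
    obtain f where f: "f \<in> carrier (cont_alg Y)" "T f z \<noteq> f y" using neg y by blast
    define g where "g = (\<lambda>x\<in>Y. f x + (\<lambda>y\<in>Y. - T f z) x)"
    have "g \<in> carrier (cont_alg Y)" using f(1) by (auto simp: g_def intro!: continuous_intros)
    moreover have "T g z = 0" unfolding g_def using TD(3)[OF f(1) constC z] Tconst by simp
    ultimately have "g \<in> I" by (simp add: I_def)
    moreover have "g y \<noteq> 0" using f(2) y by (simp add: g_def)
    ultimately show ?thesis by blast
  qed
  then obtain F where F: "\<And>y. y \<in> Y \<Longrightarrow> F y \<in> I" "\<And>y. y \<in> Y \<Longrightarrow> F y y \<noteq> 0" by metis
  define U where "U y = {x \<in> Y. F y x \<noteq> 0}" for y
  have "openin (top_of_set Y) (U y)" if "y \<in> Y" for y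
  proof -
    have "continuous_on Y (F y)" using F(1)[OF that] by (simp add: I_def)
    then have "openin (top_of_set Y) (Y \<inter> F y -` (- {0}))" by (rule continuous_openin_preimage_gen) auto
    moreover have "Y \<inter> F y -` (- {0}) = U y" by (auto simp: U_def)
    ultimately show ?thesis by simp
  qed
  moreover have "Y \<subseteq> \<Union> (U ` Y)" using F(2) by (auto simp: U_def)
  ultimately obtain D where D: "D \<subseteq> U ` Y" "finite D" "Y \<subseteq> \<Union> D"
    using Y[unfolded compact_eq_openin_cover, rule_format, of "U ` Y"] by blast
  obtain N where N: "N \<subseteq> Y" "finite N" "D = U ` N" using finite_subset_image[OF D(2,1)] by blast
  have pos: "\<exists>s r. s \<in> I \<and> (\<forall>y\<in>Y. s y = of_real (r y) \<and> r y \<ge> 0 \<and> ((\<exists>x\<in>N'. F x y \<noteq> 0) \<longrightarrow> r y > 0))"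
    if "finite N'" "N' \<subseteq> Y" for N'
    using that
  proof (induction N')
    case empty
    have "(\<lambda>y\<in>Y. 0) \<in> I" using Tconst[of 0] constC[of 0] unfolding I_def by blast
    then show ?case by (intro exI[of _ "\<lambda>y\<in>Y. 0"] exI[of _ "\<lambda>y. 0"] conjI) (assumption, simp)
  next
    case (insert x N')
    then obtain s r where s: "s \<in> I" "\<forall>y\<in>Y. s y = of_real (r y) \<and> r y \<ge> 0 \<and> ((\<exists>x\<in>N'. F x y \<noteq> 0) \<longrightarrow> r y > 0)" by auto
    have Fx: "F x \<in> I" using F insert.prems by auto
    define g where "g = (\<lambda>y\<in>Y. cnj (F x y))"
    have g: "g \<in> carrier (cont_alg Y)" using Fx by (auto simp: g_def I_def intro!: continuous_intros)
    define q where "q = (\<lambda>y\<in>Y. F x y * g y)"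
    have q: "q \<in> carrier (cont_alg Y)" using Fx g by (auto simp: q_def I_def intro!: continuous_intros)
    have Tq: "T q z = 0" unfolding q_def using TD(2)[of "F x" g] Fx g z by (auto simp: I_def)
    define s' where "s' = (\<lambda>y\<in>Y. s y + q y)"
    have "s' \<in> carrier (cont_alg Y)" using s(1) q by (auto simp: s'_def I_def intro!: continuous_intros)
    moreover have "T s' z = 0" unfolding s'_def using TD(3)[of s q] s(1) q z Tq by (auto simp: I_def)
    ultimately have "s' \<in> I" by (simp add: I_def)
    have "s' y = of_real (r y + (norm (F x y))\<^sup>2) \<and> r y + (norm (F x y))\<^sup>2 \<ge> 0 \<and>
      ((\<exists>x\<in>insert x N'. F x y \<noteq> 0) \<longrightarrow> r y + (norm (F x y))\<^sup>2 > 0)" if y: "y \<in> Y" for y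
    proof -
      have "s' y = of_real (r y + (norm (F x y))\<^sup>2)"
        using s(2) y by (simp add: s'_def q_def g_def complex_norm_square[symmetric])
      moreover have "r y \<ge> 0" using s(2) y by blast
      moreover have "r y + (norm (F x y))\<^sup>2 > 0" if ex: "\<exists>x\<in>insert x N'. F x y \<noteq> 0"
      proof (cases "F x y = 0")
        case True
        then show ?thesis using ex s(2) y by simp
      next
        case False
        then show ?thesis using \<open>r y \<ge> 0\<close> by (simp add: add_nonneg_pos)
      qed
      ultimately show ?thesis by simp
    qed
    then have "\<forall>y\<in>Y. s' y = of_real (r y + (norm (F x y))\<^sup>2) \<and> r y + (norm (F x y))\<^sup>2 \<ge> 0 \<and>
      ((\<exists>x\<in>insert x N'. F x y \<noteq> 0) \<longrightarrow> r y + (norm (F x y))\<^sup>2 > 0)" by (intro ballI)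
    with \<open>s' \<in> I\<close> show ?case
      by (intro exI[of _ s'] exI[of _ "\<lambda>y. r y + (norm (F x y))\<^sup>2"] conjI)
  qed
  obtain s r where s: "s \<in> I"
    "\<forall>y\<in>Y. s y = of_real (r y) \<and> r y \<ge> 0 \<and> ((\<exists>x\<in>N. F x y \<noteq> 0) \<longrightarrow> r y > 0)"
    using pos[OF N(2,1)] by (elim exE conjE)
  have nz: "s y \<noteq> 0" if "y \<in> Y" for y
  proof -
    have "\<exists>x\<in>N. F x y \<noteq> 0" using D(3) N that by (auto simp: U_def)
    then show ?thesis using s(2) that by auto
  qed
  define i where "i = (\<lambda>y\<in>Y. inverse (s y))"
  have i: "i \<in> carrier (cont_alg Y)" using s(1) nz by (auto simp: i_def I_def intro!: continuous_intros)
  have "(\<lambda>y\<in>Y. s y * i y) = (\<lambda>y\<in>Y. 1)" using nz by (auto simp: fun_eq_iff i_def)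
  then have "T s z * T i z = 1" using TD(2)[of s i z] s(1) i z Tconst[of 1] by (simp add: I_def)
  then show False using s(1) by (simp add: I_def)
qed

text \<open>Each character \<open>f \<mapsto> T f z\<close> is evaluation at a point, and that point
  is \<open>\<phi> z\<close>.\<close>

lemma alg_hom_is_composition:
  fixes Y :: "'a::metric_space set"
  assumes Y: "compact Y" and T: "T \<in> alg_hom (cont_alg Y) (cont_alg Z)"
  obtains \<phi> where "continuous_on Z \<phi>" "\<phi> ` Z \<subseteq> Y"
    "\<And>f. f \<in> carrier (cont_alg Y) \<Longrightarrow> T f = (\<lambda>z\<in>Z. f (\<phi> z))"
proof -
  obtain \<phi> where \<phi>: "\<And>z. z \<in> Z \<Longrightarrow> \<phi> z \<in> Y" "\<And>z f. z \<in> Z \<Longrightarrow> f \<in> carrier (cont_alg Y) \<Longrightarrow> T f z = f (\<phi> z)"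
    using character_is_evaluation[OF Y T] by metis
  have comp: "T f = (\<lambda>z\<in>Z. f (\<phi> z))" if "f \<in> carrier (cont_alg Y)" for f
    using alg_homD(1)[OF T that] \<phi>(2)[OF _ that] by (intro extensionalityI[of _ Z]) auto
  have cont: "continuous_on Z \<phi>"
    unfolding continuous_on_def
  proof
    fix z assume z: "z \<in> Z"
    \<comment> \<open>For this distance function \<open>T f w\<close> is the distance from
      \<open>\<phi> w\<close> to \<open>\<phi> z\<close>, so continuity of \<open>T f\<close> at
      \<open>z\<close> is continuity of \<open>\<phi>\<close> there.\<close>
    define f where "f = (\<lambda>y\<in>Y. complex_of_real (dist y (\<phi> z)))"
    have f: "f \<in> carrier (cont_alg Y)" by (auto simp: f_def intro!: continuous_intros)
    have "continuous_on Z (T f)" using alg_homD(1)[OF T f] by simp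
    then have "((\<lambda>w. T f w) \<longlongrightarrow> T f z) (at z within Z)" using z by (simp add: continuous_on_def)
    then have "((\<lambda>w. norm (T f w)) \<longlongrightarrow> norm (T f z)) (at z within Z)" by (rule tendsto_norm)
    moreover have "T f w = complex_of_real (dist (\<phi> w) (\<phi> z))" if "w \<in> Z" for w
      using \<phi>(2)[OF that f] \<phi>(1)[OF that] by (simp add: f_def)
    ultimately have "((\<lambda>w. dist (\<phi> w) (\<phi> z)) \<longlongrightarrow> 0) (at z within Z)"
      using z by (auto simp: eventually_at_filter elim!: Lim_transform_eventually)
    then show "(\<phi> \<longlongrightarrow> \<phi> z) (at z within Z)" by (rule tendsto_dist_iff[THEN iffD2])
  qed
  have im: "\<phi> ` Z \<subseteq> Y" by (rule image_subsetI) (rule \<phi>(1))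
  show thesis by (rule that[OF cont im comp])
qed

section \<open>Extending endomorphisms\<close>

lemma Tietze_complex:
  fixes M :: "'a::metric_space set" and f :: "'a \<Rightarrow> complex"
  assumes Y: "closedin (top_of_set M) Y" and f: "continuous_on Y f"
  obtains g where "continuous_on M g" "\<And>y. y \<in> Y \<Longrightarrow> g y = f y"
proof -
  have normal: "normal_space (top_of_set M)"
    by (intro metrizable_imp_normal_space metrizable_space_subtopology metrizable_space_euclidean)
  have sub: "subtopology (top_of_set M) Y = top_of_set Y"
    using closedin_imp_subset[OF Y] by (simp add: subtopology_subtopology inf.absorb2)
  have real: "\<exists>g. continuous_on M g \<and> (\<forall>y\<in>Y. g y = u y)" if "continuous_on Y u" for u :: "'a \<Rightarrow> real"
  proof -
    have "continuous_map (subtopology (top_of_set M) Y) euclideanreal u" unfolding sub using that by simp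
    then obtain g where "continuous_map (top_of_set M) euclideanreal g" "\<And>x. x \<in> Y \<Longrightarrow> g x = u x"
      using Tietze_extension_realinterval[OF normal Y, of UNIV u] by (auto simp: is_interval_univ)
    then show ?thesis by auto
  qed
  obtain g where g: "continuous_on M g" "\<forall>y\<in>Y. g y = Re (f y)"
    using real[of "\<lambda>y. Re (f y)"] continuous_on_Re[OF f] by blast
  obtain g' where g': "continuous_on M g'" "\<forall>y\<in>Y. g' y = Im (f y)"
    using real[of "\<lambda>y. Im (f y)"] continuous_on_Im[OF f] by blast
  show thesis
  proof (rule that[of "\<lambda>x. complex_of_real (g x) + \<i> * complex_of_real (g' x)"])
    show "continuous_on M (\<lambda>x. complex_of_real (g x) + \<i> * complex_of_real (g' x))"
      by (intro continuous_intros g g')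
    show "complex_of_real (g y) + \<i> * complex_of_real (g' y) = f y" if "y \<in> Y" for y
      using g(2) g'(2) that by (simp add: complex_eq_iff)
  qed
qed

lemma alg_closed_cont_alg_root:
  assumes closed: "alg_closed (cont_alg M)" and p: "monic_poly (cont_alg M) p" "Polynomials.degree p \<ge> 1"
  obtains a where "a \<in> carrier (cont_alg M)" "\<And>y. y \<in> M \<Longrightarrow> poly (poly_at p y) (a y) = 0"
proof -
  obtain a where a: "a \<in> carrier (cont_alg M)" "ring.eval (cont_alg M) p a = \<zero>\<^bsub>cont_alg M\<^esub>"
    using closed p unfolding alg_closed_def by blast
  have sp: "set p \<subseteq> carrier (cont_alg M)" using monic_polyD[OF p(1)] by metis
  have "poly (poly_at p y) (a y) = 0" if "y \<in> M" for y
    using eval_cont_alg(2)[OF sp a(1) that] a(2) that by simp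
  then show thesis using that a(1) by blast
qed

text \<open>Tietze's theorem extends the coefficients to \<open>M\<close>, and a root found there is
  restricted to \<open>Y\<close>. The leading coefficient is set to the constant 1 on
  \<open>M\<close> to keep the extension monic.\<close>

lemma alg_closed_closed_subset_root:
  fixes M :: "'a::metric_space set"
  assumes closed: "alg_closed (cont_alg M)" and Y: "closedin (top_of_set M) Y"
    and p: "monic_poly (cont_alg Y) p" "Polynomials.degree p \<ge> 1"
  obtains r where "r \<in> carrier (cont_alg Y)" "\<And>y. y \<in> Y \<Longrightarrow> poly (poly_at p y) (r y) = 0"
proof -
  obtain p' where p': "p = (\<lambda>y\<in>Y. 1) # p'" "set p \<subseteq> carrier (cont_alg Y)" "Y \<noteq> {}"
    using monic_polyD[OF p(1)] by metis
  have YM: "Y \<subseteq> M" using closedin_imp_subset[OF Y] .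
  have "\<exists>g. g \<in> carrier (cont_alg M) \<and> (\<forall>y\<in>Y. g y = f y)" if "f \<in> carrier (cont_alg Y)" for f
  proof -
    have "continuous_on Y f" using that by simp
    then obtain g where g: "continuous_on M g" "\<And>y. y \<in> Y \<Longrightarrow> g y = f y" using Tietze_complex[OF Y] by blast
    show ?thesis using g YM by (intro exI[of _ "restrict g M"]) auto
  qed
  then obtain E where E: "\<And>f. f \<in> carrier (cont_alg Y) \<Longrightarrow> E f \<in> carrier (cont_alg M)"
    "\<And>f y. f \<in> carrier (cont_alg Y) \<Longrightarrow> y \<in> Y \<Longrightarrow> E f y = f y" by metis
  define q where "q = (\<lambda>x\<in>M. 1) # map E p'"
  have "monic_poly (cont_alg M) q"
    unfolding q_def using p' E(1) YM by (intro monic_polyI) auto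
  moreover have "Polynomials.degree q \<ge> 1" using p(2) by (simp add: q_def p'(1))
  ultimately obtain a where a: "a \<in> carrier (cont_alg M)" "\<And>x. x \<in> M \<Longrightarrow> poly (poly_at q x) (a x) = 0"
    using alg_closed_cont_alg_root[OF closed] by metis
  have "poly_at q y = poly_at p y" if y: "y \<in> Y" for y
  proof -
    have "map (\<lambda>f. f y) q = map (\<lambda>f. f y) p"
      using p'(2) E(2)[OF _ y] y YM by (auto simp: q_def p'(1))
    then show ?thesis by (simp add: poly_at_def)
  qed
  then have "poly (poly_at p y) (restrict a Y y) = 0" if "y \<in> Y" for y using a(2)[of y] that YM by auto
  moreover have "restrict a Y \<in> carrier (cont_alg Y)" using a(1) YM continuous_on_subset by auto
  ultimately show thesis using that by blast
qed

section \<open>Extensions of an endomorphism and roots of the transformed polynomial\<close>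

lemma arens_hoffman_extE:
  assumes "F \<in> carrier (arens_hoffman_ext Y p)"
  obtains m q where "F = (\<lambda>z\<in>root_space Y p. \<Sum>k\<le>(m::nat). q k (fst z) * snd z ^ k)"
    "\<forall>k\<le>m. q k \<in> carrier (cont_alg Y)"
  using assms unfolding carrier_arens_hoffman_ext by (elim CollectE exE conjE)

lemma arens_hoffman_extI:
  assumes "\<forall>k\<le>(m::nat). q k \<in> carrier (cont_alg Y)"
  shows "(\<lambda>z\<in>root_space Y p. \<Sum>k\<le>m. q k (fst z) * snd z ^ k) \<in> carrier (arens_hoffman_ext Y p)"
  unfolding carrier_arens_hoffman_ext by (intro CollectI exI[of _ m] exI[of _ q] conjI refl assms)

lemma extension_ops:
  assumes "B = cole_ext Y p \<or> B = arens_hoffman_ext Y p"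
  shows "f \<otimes>\<^bsub>B\<^esub> g = (\<lambda>z\<in>root_space Y p. f z * g z)" "f \<oplus>\<^bsub>B\<^esub> g = (\<lambda>z\<in>root_space Y p. f z + g z)"
    "\<one>\<^bsub>B\<^esub> = (\<lambda>z\<in>root_space Y p. 1)" "c \<odot>\<^bsub>B\<^esub> f = (\<lambda>z\<in>root_space Y p. c * f z)"
  using assms by (auto simp: arens_hoffman_ext_def generated_subalgebra_def cole_ext_def)

text \<open>Through these closure properties the passage from an extended endomorphism to a root
  treats both algebras alike.\<close>

lemma extension_carrier:
  assumes B: "B = cole_ext Y p \<or> B = arens_hoffman_ext Y p"
  shows "carrier B \<subseteq> carrier (cont_alg (root_space Y p))"
    and "g \<in> carrier (cont_alg Y) \<Longrightarrow> pullback Y p g \<in> carrier B"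
    and "(\<lambda>z\<in>root_space Y p. snd z) \<in> carrier B"
    and "f \<in> carrier B \<Longrightarrow> f' \<in> carrier B \<Longrightarrow> f \<otimes>\<^bsub>B\<^esub> f' \<in> carrier B"
    and "f \<in> carrier B \<Longrightarrow> f' \<in> carrier B \<Longrightarrow> f \<oplus>\<^bsub>B\<^esub> f' \<in> carrier B"
proof -
  let ?R = "root_space Y p"
  have inY: "fst z \<in> Y" if "z \<in> ?R" for z using that by (auto simp: root_space_def)
  have sums: "(\<lambda>z \<in> ?R. \<Sum>k\<le>m. q k (fst z) * snd z ^ k) \<in> carrier (cont_alg ?R)"
    if "\<forall>k\<le>m. q k \<in> carrier (cont_alg Y)" for m :: nat and q
    using that continuous_on_pullback[of _ Y p] by (auto intro!: continuous_intros)
  show sub: "carrier B \<subseteq> carrier (cont_alg ?R)"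
    using B
  proof
    assume BB: "B = arens_hoffman_ext Y p"
    show ?thesis
    proof
      fix F assume "F \<in> carrier B"
      then obtain m q where F: "F = (\<lambda>z \<in> ?R. \<Sum>k\<le>(m::nat). q k (fst z) * snd z ^ k)" "\<forall>k\<le>m. q k \<in> carrier (cont_alg Y)"
        unfolding BB by (rule arens_hoffman_extE)
      show "F \<in> carrier (cont_alg ?R)" unfolding F(1) by (rule sums[OF F(2)])
    qed
  qed (simp add: cole_ext_def)
  show "pullback Y p g \<in> carrier B" if "g \<in> carrier (cont_alg Y)"
    using B
  proof
    assume "B = cole_ext Y p"
    then show ?thesis using continuous_on_pullback[OF that, of p] by (simp add: cole_ext_def pullback_def)
  next
    assume "B = arens_hoffman_ext Y p"
    moreover have "pullback Y p g = (\<lambda>z\<in>?R. \<Sum>k\<le>0. (\<lambda>k. g) k (fst z) * snd z ^ k)"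
      unfolding pullback_def by (intro restrict_ext) simp
    ultimately show ?thesis using arens_hoffman_extI[of 0 "\<lambda>k. g" Y p] that by simp
  qed
  show "(\<lambda>z\<in>?R. snd z) \<in> carrier B"
    using B
  proof
    assume "B = cole_ext Y p"
    then show ?thesis by (simp add: cole_ext_def continuous_on_snd)
  next
    assume "B = arens_hoffman_ext Y p"
    \<comment> \<open>The coefficients 0 and 1 of the polynomial t are written uniformly as
      \<open>of_nat k\<close>.\<close>
    moreover have "(\<lambda>z\<in>?R. snd z) = (\<lambda>z\<in>?R. \<Sum>k\<le>1. (\<lambda>y\<in>Y. of_nat k) (fst z) * snd z ^ k)"
      using inY by (intro restrict_ext) simp
    moreover have "\<forall>k\<le>(1::nat). (\<lambda>y\<in>Y. complex_of_real (real k)) \<in> carrier (cont_alg Y)" by simp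
    ultimately show ?thesis using arens_hoffman_extI[of 1 "\<lambda>k. \<lambda>y\<in>Y. of_nat k" Y p] by (simp del: cont_alg_simps sum.atMost_Suc One_nat_def)
  qed
  show "f \<otimes>\<^bsub>B\<^esub> f' \<in> carrier B" "f \<oplus>\<^bsub>B\<^esub> f' \<in> carrier B" if ff': "f \<in> carrier B" "f' \<in> carrier B"
  proof -
    have "f \<otimes>\<^bsub>B\<^esub> f' \<in> carrier B \<and> f \<oplus>\<^bsub>B\<^esub> f' \<in> carrier B"
      using B
    proof
      assume BB: "B = cole_ext Y p"
      show ?thesis using ff' unfolding extension_ops[OF B] BB by (auto simp: cole_ext_def intro!: continuous_intros)
    next
      assume BB: "B = arens_hoffman_ext Y p"
      obtain m q where q: "f = (\<lambda>z \<in> ?R. \<Sum>k\<le>(m::nat). q k (fst z) * snd z ^ k)" "\<forall>k\<le>m. q k \<in> carrier (cont_alg Y)"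
        using ff'(1) unfolding BB by (rule arens_hoffman_extE)
      obtain n r where r: "f' = (\<lambda>z \<in> ?R. \<Sum>k\<le>(n::nat). r k (fst z) * snd z ^ k)" "\<forall>k\<le>n. r k \<in> carrier (cont_alg Y)"
        using ff'(2) unfolding BB by (rule arens_hoffman_extE)
      obtain m1 q1 where 1: "\<forall>k\<le>m1. q1 k \<in> carrier (cont_alg Y)" "\<forall>y\<in>Y. \<forall>w.
        (\<Sum>k\<le>m. q k y * w ^ k) * (\<Sum>k\<le>n. r k y * w ^ k) = (\<Sum>k\<le>(m1::nat). q1 k y * w ^ k)"
        using poly_root_space_mult[OF q(2) r(2)] by blast
      obtain m2 q2 where 2: "\<forall>k\<le>m2. q2 k \<in> carrier (cont_alg Y)" "\<forall>y\<in>Y. \<forall>w.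
        (\<Sum>k\<le>m. q k y * w ^ k) + (\<Sum>k\<le>n. r k y * w ^ k) = (\<Sum>k\<le>(m2::nat). q2 k y * w ^ k)"
        using poly_root_space_add[OF q(2) r(2)] by blast
      have "f \<otimes>\<^bsub>B\<^esub> f' = (\<lambda>z \<in> ?R. \<Sum>k\<le>m1. q1 k (fst z) * snd z ^ k)"
        unfolding extension_ops[OF B] q(1) r(1) using 1(2) inY by (intro restrict_ext) simp
      moreover have "f \<oplus>\<^bsub>B\<^esub> f' = (\<lambda>z \<in> ?R. \<Sum>k\<le>m2. q2 k (fst z) * snd z ^ k)"
        unfolding extension_ops[OF B] q(1) r(1) using 2(2) inY by (intro restrict_ext) simp
      ultimately show ?thesis
        using arens_hoffman_extI[OF 1(1)] arens_hoffman_extI[OF 2(1)] by (simp add: BB)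
    qed
    then show "f \<otimes>\<^bsub>B\<^esub> f' \<in> carrier B" "f \<oplus>\<^bsub>B\<^esub> f' \<in> carrier B" by blast+
  qed
qed

text \<open>The root makes \<open>\<psi>\<close> a continuous map of the root space into itself that
  lies over \<open>\<phi>\<close>; the extension is composition with \<open>\<psi>\<close>.\<close>

lemma root_imp_extends_to:
  fixes Y :: "'a::topological_space set"
  assumes B: "B = cole_ext Y p \<or> B = arens_hoffman_ext Y p"
    and \<phi>: "continuous_on Y \<phi>" "\<phi> ` Y \<subseteq> Y" "\<And>f. f \<in> carrier (cont_alg Y) \<Longrightarrow> T f = (\<lambda>y\<in>Y. f (\<phi> y))"
    and r: "r \<in> carrier (cont_alg Y)" "\<And>y. y \<in> Y \<Longrightarrow> poly (poly_at p (\<phi> y)) (r y) = 0"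
  shows "extends_to Y p T B"
proof -
  let ?R = "root_space Y p"
  define \<psi> where "\<psi> z = (\<phi> (fst z), r (fst z))" for z :: "'a \<times> complex"
  have inY: "fst z \<in> Y" if "z \<in> ?R" for z using that by (auto simp: root_space_def)
  have \<psi>R: "\<psi> z \<in> ?R" if "z \<in> ?R" for z
    using inY[OF that] r(2) \<phi>(2) by (auto simp: \<psi>_def root_space_def)
  have c\<psi>: "continuous_on ?R \<psi>"
  proof -
    have "continuous_on ?R (\<lambda>z. \<phi> (fst z))" "continuous_on ?R (\<lambda>z. r (fst z))"
      using inY r(1) by (auto intro!: continuous_on_compose2[OF \<phi>(1)] continuous_on_compose2[of Y r] continuous_intros)
    then show ?thesis unfolding \<psi>_def by (intro continuous_on_Pair)
  qed
  define T' where "T' F = (\<lambda>z\<in>?R. F (\<psi> z))" for F :: "'a \<times> complex \<Rightarrow> complex"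
  have closed: "T' F \<in> carrier B" if F: "F \<in> carrier B" for F
    using B
  proof
    assume BB: "B = cole_ext Y p"
    have "continuous_on ?R F" using F by (simp add: BB cole_ext_def)
    then have "continuous_on ?R (\<lambda>z. F (\<psi> z))"
      by (rule continuous_on_compose2[OF _ c\<psi>]) (use \<psi>R in blast)
    then show ?thesis by (simp add: BB cole_ext_def T'_def)
  next
    assume BB: "B = arens_hoffman_ext Y p"
    obtain m q where q: "F = (\<lambda>z \<in> ?R. \<Sum>k\<le>(m::nat). q k (fst z) * snd z ^ k)" "\<forall>k\<le>m. q k \<in> carrier (cont_alg Y)"
      using F unfolding BB by (rule arens_hoffman_extE)
    define g where "g = (\<lambda>y\<in>Y. \<Sum>k\<le>m. q k (\<phi> y) * r y ^ k)"
    have "continuous_on Y (\<lambda>y. q k (\<phi> y))" if "k \<le> m" for k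
      using q(2) that by (intro continuous_on_compose2[OF _ \<phi>(1,2)]) auto
    then have g: "g \<in> carrier (cont_alg Y)"
      unfolding g_def using r(1) by (auto intro!: continuous_intros)
    \<comment> \<open>\<open>\<psi>\<close> depends only on the base point, so the image of
      \<open>F\<close> is even the pullback of a function on \<open>Y\<close>.\<close>
    have "T' F = pullback Y p g"
      unfolding T'_def pullback_def using \<psi>R inY by (intro restrict_ext) (simp add: q(1) g_def \<psi>_def)
    then show ?thesis using extension_carrier(2)[OF B g] by simp
  qed
  have "T' \<in> ring_hom B B"
  proof (rule ring_hom_memI)
    show "T' (f \<otimes>\<^bsub>B\<^esub> g) = T' f \<otimes>\<^bsub>B\<^esub> T' g" "T' (f \<oplus>\<^bsub>B\<^esub> g) = T' f \<oplus>\<^bsub>B\<^esub> T' g" for f g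
      unfolding extension_ops[OF B] T'_def using \<psi>R by (auto intro!: restrict_ext)
    show "T' \<one>\<^bsub>B\<^esub> = \<one>\<^bsub>B\<^esub>"
      unfolding extension_ops[OF B] T'_def using \<psi>R by (auto intro!: restrict_ext)
  qed (rule closed)
  moreover have "T' (c \<odot>\<^bsub>B\<^esub> f) = c \<odot>\<^bsub>B\<^esub> T' f" for c f
    unfolding extension_ops[OF B] T'_def using \<psi>R by (auto intro!: restrict_ext)
  ultimately have "T' \<in> alg_End B" unfolding alg_End_def alg_hom_def by blast
  moreover have "T' (pullback Y p g) = pullback Y p (T g)" if "g \<in> carrier (cont_alg Y)" for g
    unfolding T'_def pullback_def \<phi>(3)[OF that] using \<psi>R inY by (auto intro!: restrict_ext simp: \<psi>_def)
  ultimately show ?thesis unfolding extends_to_def by blast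
qed

text \<open>The coordinate function \<open>x\<close> satisfies the polynomial relation given by
  \<open>p\<close>. Applying \<open>T'\<close> transports the coefficients along
  \<open>\<phi>\<close>, so \<open>h = T' x\<close> satisfies the transported relation.\<close>

lemma extends_to_imp_root:
  fixes Y :: "'a::topological_space set"
  assumes B: "B = cole_ext Y p \<or> B = arens_hoffman_ext Y p"
    and \<phi>: "\<And>f. f \<in> carrier (cont_alg Y) \<Longrightarrow> T f = (\<lambda>y\<in>Y. f (\<phi> y))" "\<phi> ` Y \<subseteq> Y"
    and p: "set p \<subseteq> carrier (cont_alg Y)" and ext: "extends_to Y p T B"
  obtains h where "continuous_on (root_space Y p) h"
    "\<And>y w. (y, w) \<in> root_space Y p \<Longrightarrow> poly (poly_at p (\<phi> y)) (h (y, w)) = 0"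
proof -
  let ?R = "root_space Y p"
  obtain T' where T': "T' \<in> ring_hom B B" "\<And>g. g \<in> carrier (cont_alg Y) \<Longrightarrow> T' (pullback Y p g) = pullback Y p (T g)"
    using ext unfolding extends_to_def alg_End_def alg_hom_def by blast
  define x where "x = (\<lambda>z\<in>?R. snd z)"
  have x: "x \<in> carrier B" unfolding x_def by (rule extension_carrier(3)[OF B])
  define h where "h = T' x"
  \<comment> \<open>\<open>v q\<close> and \<open>w q\<close> are the values of \<open>q\<close> at
    \<open>x\<close> and of the transported \<open>q\<close> at \<open>h\<close>. Appending a
    constant term is one Horner step, hence the induction from the right.\<close>
  define v where "v q = (\<lambda>z\<in>?R. poly (poly_at q (fst z)) (snd z))" for q
  define w where "w q = (\<lambda>z\<in>?R. poly (poly_at q (\<phi> (fst z))) (h z))" for q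
  have inY: "fst z \<in> Y" if "z \<in> ?R" for z using that by (auto simp: root_space_def)
  have "v q \<in> carrier B \<and> T' (v q) = w q" if "set q \<subseteq> carrier (cont_alg Y)" for q
    using that
  proof (induction q rule: rev_induct)
    case Nil
    have z: "(\<lambda>y\<in>Y. 0) \<in> carrier (cont_alg Y)" by simp
    have v0: "v [] = pullback Y p (\<lambda>y\<in>Y. 0)"
      unfolding v_def pullback_def using inY by (intro restrict_ext) (simp add: poly_at_def)
    have "T (\<lambda>y\<in>Y. 0) = (\<lambda>y\<in>Y. 0)"
      unfolding \<phi>(1)[OF z] using \<phi>(2) by (intro restrict_ext) auto
    moreover have "pullback Y p (\<lambda>y\<in>Y. 0) = w []"
      unfolding w_def pullback_def using inY by (intro restrict_ext) (simp add: poly_at_def)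
    ultimately show ?case unfolding v0 T'(2)[OF z] using extension_carrier(2)[OF B z] by simp
  next
    case (snoc f q)
    have f: "f \<in> carrier (cont_alg Y)" and q: "v q \<in> carrier B" "T' (v q) = w q" using snoc by auto
    have v: "v (q @ [f]) = pullback Y p f \<oplus>\<^bsub>B\<^esub> (x \<otimes>\<^bsub>B\<^esub> v q)"
      unfolding extension_ops[OF B] by (auto simp: v_def x_def pullback_def poly_at_snoc intro!: restrict_ext)
    have xv: "x \<otimes>\<^bsub>B\<^esub> v q \<in> carrier B" by (rule extension_carrier(4)[OF B x q(1)])
    have "T' (v (q @ [f])) = pullback Y p (T f) \<oplus>\<^bsub>B\<^esub> (h \<otimes>\<^bsub>B\<^esub> w q)"
      unfolding v ring_hom_add[OF T'(1) extension_carrier(2)[OF B f] xv] ring_hom_mult[OF T'(1) x q(1)]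
        T'(2)[OF f] q(2) h_def ..
    also have "\<dots> = w (q @ [f])"
      unfolding extension_ops[OF B] \<phi>(1)[OF f]
      using inY by (auto simp: w_def pullback_def poly_at_snoc intro!: restrict_ext)
    finally show ?case
      using extension_carrier(5)[OF B extension_carrier(2)[OF B f] xv] by (simp add: v)
  qed
  note vw = this
  have "v p = v []"
    unfolding v_def by (intro restrict_ext) (auto simp: root_space_def poly_at_def)
  then have "w p = w []" using vw[OF p] vw[of "[]"] by simp
  have "poly (poly_at p (\<phi> y)) (h (y, u)) = 0" if "(y, u) \<in> ?R" for y u
  proof -
    have "w p (y, u) = w [] (y, u)" using \<open>w p = w []\<close> by simp
    then show ?thesis using that by (simp add: w_def poly_at_def)
  qed
  moreover have "h \<in> carrier B" unfolding h_def by (rule ring_hom_closed[OF T'(1) x])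
  then have "continuous_on ?R h" using extension_carrier(1)[OF B] by auto
  ultimately show thesis using that by blast
qed

section \<open>The counterexample on a simple closed curve\<close>

lemma discriminant_nonzero:
  assumes p: "monic_poly (cont_alg Y) p" and y: "y \<in> Y"
    and roots: "card {w. poly (poly_at p y) w = 0} = Polynomials.degree p"
  shows "discriminant p y \<noteq> 0"
proof -
  obtain ls where ls: "length ls = Polynomials.degree p" "poly_at p y = (\<Prod>l\<leftarrow>ls. [:- l, 1:])"
    using poly_at_factors[OF p y] by blast
  have "poly (\<Prod>l\<leftarrow>ls. [:- l, 1:]) w = 0 \<longleftrightarrow> w \<in> set ls" for w
    by (induction ls) auto
  then have "{w. poly (poly_at p y) w = 0} = set ls" by (simp add: ls(2))
  then have "distinct ls" using roots ls(1) by (simp add: card_distinct)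
  then have "root_disc ls \<noteq> 0"
    unfolding root_disc_def by (auto simp: nth_eq_iff_index_eq)
  then show ?thesis using discriminant_eq[OF ls(2)] by simp
qed

lemma card_two_power_roots:
  assumes "c \<noteq> 0" "c \<noteq> (1::complex)"
  shows "card {w. (w ^ 2 - c) * (w ^ 3 - c) = 0} = 5"
proof -
  have "{w. (w ^ 2 - c) * (w ^ 3 - c) = 0} = {w. w ^ 2 = c} \<union> {w. w ^ 3 = c}" by auto
  moreover have "{w. w ^ 2 = c} \<inter> {w. w ^ 3 = c} = {}"
  proof (rule ccontr)
    assume "{w. w ^ 2 = c} \<inter> {w. w ^ 3 = c} \<noteq> {}"
    then obtain w where w: "w ^ 2 = c" "w ^ 3 = c" by blast
    have "w * w ^ 2 = w ^ 3" by (simp add: power2_eq_square power3_eq_cube)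
    then have "w = 1" using w assms(1) by simp
    then show False using w assms(2) by simp
  qed
  ultimately show ?thesis
    using assms(1) by (simp add: card_Un_disjoint card_nth_roots finite_nth_roots)
qed

text \<open>The witness is the polynomial \<open>(t\<^sup>2 - z) * (t\<^sup>3 - z)\<close> over the unit circle together with the
  rotation \<open>z \<mapsto> - z\<close>.\<close>

lemma loop_has_nonextendable_endomorphism:
  fixes M :: "'a::metric_space set"
  assumes M: "compact M" "has_loop M"
  obtains Y p T where "closedin (top_of_set M) Y" "admissible Y p" "T \<in> alg_End (cont_alg Y)"
    "\<not> extends_to Y p T (cole_ext Y p)" "\<not> extends_to Y p T (arens_hoffman_ext Y p)"
proof -
  obtain g where g: "simple_path g" "pathfinish g = pathstart g" "path_image g \<subseteq> M"
    using M(2) unfolding has_loop_def by blast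
  define Y where "Y = path_image g"
  have cY: "compact Y" unfolding Y_def using g(1) by (simp add: compact_simple_path_image)
  have clY: "closedin (top_of_set M) Y"
    using cY g(3) by (auto simp: Y_def intro!: closed_subset compact_imp_closed)
  obtain e e' where hom: "homeomorphism Y (sphere (0::complex) 1) e e'"
    using homeomorphic_simple_path_image_circle[OF g(1,2), of 1 0] unfolding Y_def homeomorphic_def by auto
  have ce: "continuous_on Y e" and ce': "continuous_on (sphere 0 1) e'"
    using hom by (auto simp: homeomorphism_def)
  have eY: "norm (e y) = 1" "e' (e y) = y" if "y \<in> Y" for y
    using homeomorphism_apply1[OF hom that] homeomorphism_image1[OF hom] that by auto
  have e'S: "e' z \<in> Y" "e (e' z) = z" if "norm z = 1" for z
    using homeomorphism_apply2[OF hom, of z] homeomorphism_image2[OF hom] that by auto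
  have ne: "Y \<noteq> {}" using e'S(1)[of 1] by auto
  define c where "c = (\<lambda>y\<in>Y. - e y)"
  \<comment> \<open>These are the coefficients of \<open>(t^2 - e y) * (t^3 - e y) = t^5 - e y * t^3
    - e y * t^2 + (e y)^2\<close>, with \<open>c\<close> standing for \<open>- e y\<close>.\<close>
  define p where "p = [(\<lambda>y\<in>Y. 1), (\<lambda>y\<in>Y. 0), c, c, (\<lambda>y\<in>Y. 0), (\<lambda>y\<in>Y. (e y)\<^sup>2)]"
  have cc: "c \<in> carrier (cont_alg Y)" using ce by (auto simp: c_def intro!: continuous_intros)
  have c2: "(\<lambda>y\<in>Y. (e y)\<^sup>2) \<in> carrier (cont_alg Y)" using ce by (auto intro!: continuous_intros)
  have monic: "monic_poly (cont_alg Y) p"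
    unfolding p_def using cc c2 ne by (intro monic_polyI) auto
  have pC: "set p \<subseteq> carrier (cont_alg Y)" unfolding p_def using cc c2 by auto
  have poly_p: "poly (poly_at p y) w = (w ^ 2 - e y) * (w ^ 3 - e y)" if "y \<in> Y" for y w
    using that by (simp add: poly_at_def p_def c_def algebra_simps power2_eq_square power3_eq_cube)
  have "admissible Y p"
    unfolding admissible_def
  proof (intro conjI monic)
    show "2 \<le> Polynomials.degree p" by (simp add: p_def)
    \<comment> \<open>Away from \<open>e' 1\<close> there are five distinct roots, so the
      discriminant can vanish at one point only; a single point is not open in a connected space
      with at least two points.\<close>
    have disc: "y = e' 1" if y: "y \<in> Y" "discriminant p y = 0" for y
    proof (rule ccontr)
      assume "y \<noteq> e' 1"
      then have "e y \<noteq> 1" using eY(2)[OF y(1)] by metis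
      moreover have "e y \<noteq> 0" using eY(1)[OF y(1)] by auto
      ultimately have "card {w. poly (poly_at p y) w = 0} = Polynomials.degree p"
        using card_two_power_roots[of "e y"] unfolding poly_p[OF y(1)] by (simp add: p_def)
      then show False using discriminant_nonzero[OF monic y(1)] y(2) by simp
    qed
    show "top_of_set Y interior_of {y \<in> Y. discriminant p y = 0} = {}"
    proof (rule ccontr)
      assume "\<not> ?thesis"
      then obtain U x where U: "openin (top_of_set Y) U" "x \<in> U" "U \<subseteq> {y \<in> Y. discriminant p y = 0}"
        unfolding interior_of_def by blast
      have "U = {e' 1}" using U disc by blast
      moreover have "closedin (top_of_set Y) {e' 1}" using e'S(1)[of 1] by (simp add: closedin_singleton)
      moreover have "connected Y" unfolding Y_def using g(1) by (simp add: connected_simple_path_image)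
      ultimately have "{e' 1} = Y" using U(1) unfolding connected_clopen by blast
      moreover have "e' (-1) \<in> Y" using e'S(1)[of "-1"] by simp
      ultimately have "e' (-1) = e' 1" by blast
      then have "e (e' (-1)) = e (e' 1)" by simp
      then show False using e'S(2)[of 1] e'S(2)[of "-1"] by simp
    qed
  qed
  define \<phi> where "\<phi> y = e' (- e y)" for y
  have \<phi>Y: "\<phi> ` Y \<subseteq> Y"
    unfolding \<phi>_def by (rule image_subsetI, rule e'S(1)) (simp add: eY(1))
  have c\<phi>: "continuous_on Y \<phi>"
    unfolding \<phi>_def
  proof (rule continuous_on_compose2[OF ce'])
    show "continuous_on Y (\<lambda>y. - e y)" by (intro continuous_intros ce)
    show "(\<lambda>y. - e y) ` Y \<subseteq> sphere 0 1" by (rule image_subsetI) (simp add: eY(1))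
  qed
  define T where "T f = (\<lambda>y\<in>Y. f (\<phi> y))" for f :: "'a \<Rightarrow> complex"
  have "T \<in> alg_End (cont_alg Y)"
  proof -
    have "T \<in> ring_hom (cont_alg Y) (cont_alg Y)"
    proof (rule ring_hom_memI)
      show "T f \<in> carrier (cont_alg Y)" if "f \<in> carrier (cont_alg Y)" for f
        using that by (auto simp: T_def intro!: continuous_on_compose2[OF _ c\<phi> \<phi>Y])
    qed (use \<phi>Y in \<open>auto simp: T_def fun_eq_iff\<close>)
    moreover have "T (a \<odot>\<^bsub>cont_alg Y\<^esub> f) = a \<odot>\<^bsub>cont_alg Y\<^esub> T f" for a f
      using \<phi>Y by (auto simp: T_def fun_eq_iff)
    ultimately show ?thesis unfolding alg_End_def alg_hom_def by blast
  qed
  have no: "\<not> extends_to Y p T B" if B: "B = cole_ext Y p \<or> B = arens_hoffman_ext Y p" for B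
  proof
    assume ext: "extends_to Y p T B"
    have Tf: "T f = (\<lambda>y\<in>Y. f (\<phi> y))" for f by (simp add: T_def)
    obtain h where h: "continuous_on (root_space Y p) h"
      "\<And>y w. (y, w) \<in> root_space Y p \<Longrightarrow> poly (poly_at p (\<phi> y)) (h (y, w)) = 0"
      using extends_to_imp_root[OF B Tf \<phi>Y pC ext] by metis
    define R where "R = {(z::complex, w). norm z = 1 \<and> (w ^ 2 = z \<or> w ^ 3 = z)}"
    have R: "(e' z, w) \<in> root_space Y p" if "(z, w) \<in> R" for z w
      using that e'S[of z] poly_p[of "e' z" w] by (auto simp: R_def root_space_def)
    have "continuous_on R (\<lambda>x. h (e' (fst x), snd x))"
    proof (rule continuous_on_compose2[OF h(1)])
      show "continuous_on R (\<lambda>x. (e' (fst x), snd x))"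
        by (intro continuous_on_Pair continuous_on_compose2[OF ce'] continuous_intros) (auto simp: R_def)
      show "(\<lambda>x. (e' (fst x), snd x)) ` R \<subseteq> root_space Y p" using R by auto
    qed
    moreover have "h (e' z, w) ^ 2 = - z \<or> h (e' z, w) ^ 3 = - z" if zw: "(z, w) \<in> R" for z w
    proof -
      have z: "norm z = 1" using zw by (auto simp: R_def)
      have "\<phi> (e' z) \<in> Y" "e (\<phi> (e' z)) = - z"
        using e'S[of z] e'S[of "- z"] z by (simp_all add: \<phi>_def)
      then show ?thesis
        using h(2)[OF R[OF zw]] poly_p[of "\<phi> (e' z)" "h (e' z, w)"] by (auto simp: eq_neg_iff_add_eq_0)
    qed
    ultimately show False
      using no_rotated_root_on_circle[of "\<lambda>x. h (e' (fst x), snd x)"] unfolding R_def by simp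
  qed
  show thesis
    using that[OF clY \<open>admissible Y p\<close> \<open>T \<in> alg_End (cont_alg Y)\<close>] no by blast
qed

section \<open>The equivalence\<close>

lemma alg_closed_if_no_loop:
  fixes M :: "'a::metric_space set"
  assumes M: "compact M" "locally connected M" "\<not> has_loop M"
  shows "alg_closed (cont_alg M)"
  unfolding alg_closed_def
proof (intro allI impI, elim conjE)
  fix p assume p: "monic_poly (cont_alg M) p" "Polynomials.degree p \<ge> 1"
  obtain h where h: "continuous_on M h" "\<And>x. x \<in> M \<Longrightarrow> poly (poly_at p x) (h x) = 0"
    using continuous_root_if_no_loop[OF M monic_family_poly_at[OF p(1)]] p(2) by (metis One_nat_def Suc_le_eq)
  have sp: "set p \<subseteq> carrier (cont_alg M)" using monic_polyD[OF p(1)] by metis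
  have hc: "restrict h M \<in> carrier (cont_alg M)" using h(1) by simp
  have "ring.eval (cont_alg M) p (restrict h M) = \<zero>\<^bsub>cont_alg M\<^esub>"
    using eval_cont_alg[OF sp hc] h(2) by (intro extensionalityI[of _ M]) auto
  then show "\<exists>a\<in>carrier (cont_alg M). ring.eval (cont_alg M) p a = \<zero>\<^bsub>cont_alg M\<^esub>" using hc by blast
qed

text \<open>Applying \<open>T\<close> to the coefficients of \<open>p\<close> gives a monic
  polynomial over \<open>Y\<close> whose value at \<open>y\<close> is \<open>p\<close> at
  \<open>\<phi> y\<close>; its root is what \<open>root_imp_extends_to\<close> requires.\<close>

lemma alg_closed_imp_extends_to:
  fixes M :: "'a::metric_space set"
  assumes M: "compact M" "alg_closed (cont_alg M)" and Y: "closedin (top_of_set M) Y"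
    and p: "admissible Y p" and T: "T \<in> alg_End (cont_alg Y)"
    and B: "B = cole_ext Y p \<or> B = arens_hoffman_ext Y p"
  shows "extends_to Y p T B"
proof -
  have cY: "compact Y" using closedin_compact[OF M(1) Y] .
  have monic: "monic_poly (cont_alg Y) p" "Polynomials.degree p \<ge> 2" using p by (auto simp: admissible_def)
  obtain \<phi> where \<phi>: "continuous_on Y \<phi>" "\<phi> ` Y \<subseteq> Y" "\<And>f. f \<in> carrier (cont_alg Y) \<Longrightarrow> T f = (\<lambda>y\<in>Y. f (\<phi> y))"
    using alg_hom_is_composition[OF cY] T unfolding alg_End_def by metis
  obtain p' where p': "p = (\<lambda>y\<in>Y. 1) # p'" "set p \<subseteq> carrier (cont_alg Y)" "Y \<noteq> {}"
    using monic_polyD[OF monic(1)] by metis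
  define q where "q = (\<lambda>y\<in>Y. 1) # map T p'"
  have "T f \<in> carrier (cont_alg Y)" if "f \<in> carrier (cont_alg Y)" for f
    using T that alg_homD(1) unfolding alg_End_def by blast
  then have "monic_poly (cont_alg Y) q"
    unfolding q_def using p' by (intro monic_polyI) auto
  moreover have "Polynomials.degree q \<ge> 1" using monic(2) by (simp add: q_def p'(1))
  ultimately obtain r where r: "r \<in> carrier (cont_alg Y)" "\<And>y. y \<in> Y \<Longrightarrow> poly (poly_at q y) (r y) = 0"
    using alg_closed_closed_subset_root[OF M(2) Y] by metis
  have "poly_at q y = poly_at p (\<phi> y)" if y: "y \<in> Y" for y
  proof -
    have "\<phi> y \<in> Y" using \<phi>(2) y by blast
    moreover have "T f y = f (\<phi> y)" if "f \<in> set p'" for f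
      using \<phi>(3)[of f] p'(1,2) that y by auto
    ultimately have "map (\<lambda>f. f y) q = map (\<lambda>f. f (\<phi> y)) p" using y by (simp add: q_def p'(1))
    then show ?thesis by (simp add: poly_at_def)
  qed
  then show ?thesis using root_imp_extends_to[OF B \<phi> r(1)] r(2) by metis
qed

text \<open>Without a simple closed curve in \<open>M\<close> all three conditions hold; with one,
  all three fail. A single counterexample refutes both extension properties, and algebraic
  closedness along with them, since it implies them.\<close>

theorem theorem9:
  fixes M :: "'a::metric_space set"
  assumes "compact M" and "locally connected M"
  shows "(alg_closed (cont_alg M) \<longleftrightarrow>
      (\<forall>Y p T. closedin (top_of_set M) Y \<and> admissible Y p \<and> T \<in> alg_End (cont_alg Y) \<longrightarrow>
         extends_to Y p T (arens_hoffman_ext Y p))) \<and>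
    ((\<forall>Y p T. closedin (top_of_set M) Y \<and> admissible Y p \<and> T \<in> alg_End (cont_alg Y) \<longrightarrow>
         extends_to Y p T (arens_hoffman_ext Y p)) \<longleftrightarrow>
      (\<forall>Y p T. closedin (top_of_set M) Y \<and> admissible Y p \<and> T \<in> alg_End (cont_alg Y) \<longrightarrow>
         extends_to Y p T (cole_ext Y p)))"
proof (cases "has_loop M")
  case True
  obtain Y p T where Y: "closedin (top_of_set M) Y" "admissible Y p" "T \<in> alg_End (cont_alg Y)"
    "\<not> extends_to Y p T (cole_ext Y p)" "\<not> extends_to Y p T (arens_hoffman_ext Y p)"
    using loop_has_nonextendable_endomorphism[OF assms(1) True] by metis
  moreover have "\<not> alg_closed (cont_alg M)"
    using alg_closed_imp_extends_to[OF assms(1) _ Y(1-3)] Y(4) by blast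
  ultimately show ?thesis by metis
next
  case False
  then have "alg_closed (cont_alg M)" by (rule alg_closed_if_no_loop[OF assms])
  then show ?thesis using alg_closed_imp_extends_to[OF assms(1)] by blast
qed

end
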